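(* Let $K\ge 1$ and let $f\colon\mathbb{B}^2\to\mathbb{B}^2$ be a non-constant $K$-quasiregular mapping of the unit disk $\mathbb{B}^2=\{x\in\mathbb{R}^2:|x|<1\}$. Let $\rho=\rho_{\mathbb{B}^2}$ be the hyperbolic metric of $\mathbb{B}^2$, let $\lambda\ge 1$, and put $$W_\lambda(x,y)=\log\Big(1+2\lambda\sinh\frac{\rho(x,y)}{2}\Big),\qquad x,y\in\mathbb{B}^2.$$ Let $c(K)$ be the constant described in the context. Then for all $x,y\in\mathbb{B}^2$, $$W_\lambda(f(x),f(y))\le 2\lambda c(K)\max\big\{W_\lambda(x,y)^{1/K},\,W_\lambda(x,y)\big\}.$$
   Context: The hyperbolic metric of the unit disk is given by $\tanh\frac{\rho_{\mathbb{B}^2}(x,y)}{2}=\frac{|x-y|}{\sqrt{|x-y|^2+(1-|x|^2)(1-|y|^2)}}$; for a simply connected proper plane domain $G$ the hyperbolic metric $\rho_G$ is defined by transporting $\rho_{\mathbb{B}^2}$ via a Riemann map. The constant $c(K)$ (depending only on $K$) is the constant of the Schwarz lemma for quasiregular maps (Hariri–Klén–Vuorinen, Thm 16.39; Wang–Vuorinen, Thm 3.6): for all simply connected plane domains $G_1$ and every $K$-quasiregular map $f\colon G_1\to G_2=f(G_1)$ with $G_2$ simply connected, $\rho_{G_2}(f(x),f(y))\le c(K)\max\{\rho_{G_1}(x,y),\rho_{G_1}(x,y)^{1/K}\}$ for all $x,y\in G_1$; it satisfies $K\le c(K)\le \log\big(2(1+\sqrt{1-1/e^2})\big)(K-1)+K$.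 *)

theory Defs
  imports "HOL-Complex_Analysis.Complex_Analysis"
begin

text \<open>The plane R^2 is identified with the complex numbers; the unit disk is ball 0 1.\<close>

text \<open>Hyperbolic metric of the unit disk, via the formula for tanh(rho/2).\<close>
definition rho_disk :: "complex \<Rightarrow> complex \<Rightarrow> real" where
  "rho_disk x y = 2 * artanh (cmod (x - y) /
      sqrt ((cmod (x - y))\<^sup>2 + (1 - (cmod x)\<^sup>2) * (1 - (cmod y)\<^sup>2)))"

text \<open>Hyperbolic metric of a simply connected proper plane domain, transported
  from the disk by a Riemann map (conformal bijection onto the unit disk).\<close>
definition rho_dom :: "complex set \<Rightarrow> complex \<Rightarrow> complex \<Rightarrow> real" where
  "rho_dom G x y =
     (let h = (SOME h. h holomorphic_on G \<and> inj_on h G \<and> h ` G = ball 0 1)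
      in rho_disk (h x) (h y))"

definition weak_partials ::
  "complex set \<Rightarrow> (complex \<Rightarrow> complex) \<Rightarrow> (complex \<Rightarrow> complex) \<Rightarrow> (complex \<Rightarrow> complex) \<Rightarrow> bool" where
  "weak_partials G f D1 D2 \<longleftrightarrow>
     (\<forall>(\<phi>::complex \<Rightarrow> real) D\<phi>.
        (\<forall>z. (\<phi> has_derivative D\<phi> z) (at z)) \<and>
        continuous_on UNIV (\<lambda>z. D\<phi> z 1) \<and> continuous_on UNIV (\<lambda>z. D\<phi> z \<i>) \<and>
        compact (closure {z. \<phi> z \<noteq> 0}) \<and> closure {z. \<phi> z \<noteq> 0} \<subseteq> G \<longrightarrow>
        (LINT z|lborel. D\<phi> z 1 *\<^sub>R f z) = - (LINT z|lborel. \<phi> z *\<^sub>R D1 z) \<and>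
        (LINT z|lborel. D\<phi> z \<i> *\<^sub>R f z) = - (LINT z|lborel. \<phi> z *\<^sub>R D2 z))"

definition sobolev_12_loc ::
  "complex set \<Rightarrow> (complex \<Rightarrow> complex) \<Rightarrow> (complex \<Rightarrow> complex) \<Rightarrow> (complex \<Rightarrow> complex) \<Rightarrow> bool" where
  "sobolev_12_loc G f D1 D2 \<longleftrightarrow>
     continuous_on G f \<and>
     set_borel_measurable lborel G D1 \<and> set_borel_measurable lborel G D2 \<and>
     (\<forall>C. compact C \<and> C \<subseteq> G \<longrightarrow>
        set_integrable lborel C (\<lambda>z. (cmod (D1 z))\<^sup>2) \<and>
        set_integrable lborel C (\<lambda>z. (cmod (D2 z))\<^sup>2)) \<and>
     weak_partials G f D1 D2"

definition quasiregular :: "real \<Rightarrow> complex set \<Rightarrow> (complex \<Rightarrow> complex) \<Rightarrow> bool" where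
  "quasiregular K G f \<longleftrightarrow> K \<ge> 1 \<and> open G \<and> connected G \<and>
     (\<exists>D1 D2. sobolev_12_loc G f D1 D2 \<and>
        (AE z in lborel. z \<in> G \<longrightarrow>
           (onorm (\<lambda>h. Re h *\<^sub>R D1 z + Im h *\<^sub>R D2 z))\<^sup>2
             \<le> K * (Re (D1 z) * Im (D2 z) - Re (D2 z) * Im (D1 z))))"

definition qr_schwarz_const :: "real \<Rightarrow> real \<Rightarrow> bool" where
  "qr_schwarz_const K c \<longleftrightarrow>
     (\<forall>G1 f. open G1 \<and> connected G1 \<and> simply_connected G1 \<and> G1 \<noteq> UNIV \<and>
        quasiregular K G1 f \<and>
        open (f ` G1) \<and> connected (f ` G1) \<and> simply_connected (f ` G1) \<and> f ` G1 \<noteq> UNIV \<longrightarrow>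
        (\<forall>x\<in>G1. \<forall>y\<in>G1.
           rho_dom (f ` G1) (f x) (f y)
             \<le> c * max (rho_dom G1 x y) (rho_dom G1 x y powr (1 / K))))"

definition W_lam :: "real \<Rightarrow> complex \<Rightarrow> complex \<Rightarrow> real" where
  "W_lam lam x y = ln (1 + 2 * lam * sinh (rho_disk x y / 2))"

end

theory Submission
  imports Defs
begin

text \<open>
  The Schwarz constant only controls maps with simply connected image, while \<open>f\<close> may omit values in a
  complicated way. Replace \<open>f\<close> by a lift: among all continuous \<open>g\<close> from the disk to itself with
  \<open>f = \<Phi> \<circ> g\<close>, where \<open>\<Phi>\<close> is a holomorphic self-map of the disk without critical points on the image
  of \<open>g\<close>, choose one that moves \<open>g x\<close> and \<open>g y\<close> as far apart as possible. If \<open>g\<close> omitted a value,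
  Koebe's square root trick would separate the two points further; so \<open>g\<close> is onto. Locally \<open>g\<close> is a
  holomorphic function of \<open>f\<close>, hence \<open>g\<close> is again \<open>K\<close>-quasiregular, and the Schwarz constant applies
  to \<open>g\<close>. The Schwarz-Pick lemma for \<open>\<Phi>\<close> transfers the bound to \<open>f\<close>.

  A maximal \<open>g\<close> exists because the lifts are uniformly bounded away from the unit circle on compact
  sets. This is a Harnack inequality for quasiregular maps \<open>v\<close> into a strip, proved by the hole filling
  technique: the Jacobian is a null Lagrangian, which yields a Caccioppoli inequality and geometric
  decay of the energy of \<open>v\<close> on small disks, and Morrey's telescoping sum bounds the oscillation.

  Finally, \<open>\<rho>/2 \<le> W\<^sub>\<lambda> \<le> \<lambda>\<rho>\<close> turns the bound for \<open>\<rho>\<close> into the one for \<open>W\<^sub>\<lambda>\<close>.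
\<close>

section \<open>Functions with continuous partial derivatives\<close>

text \<open>Lifting \<open>f\<close> once through a universal covering of its image would not do,
  because the lift of a map that is not itself a covering can again miss part of the disk; an
  extremal choice gives surjectivity at one stroke. The price is compactness: a bound is needed for
  competitors not yet known to be onto, about which the Schwarz constant says nothing. It has to
  come from the analytic definition of \<open>quasiregular\<close>, hence the energy estimates. They
  only have to produce some bound \<open>\<tau> < 1\<close> on each smaller disk, so their numerical
  constants are not optimised and none of them enters the final inequality. The condition that
  \<open>\<Phi>\<close> has no critical point on the image of \<open>g\<close> keeps all branching
  in \<open>g\<close>; otherwise \<open>g\<close> would not be a local holomorphic function of
  \<open>f\<close>, and the argument that passes weak differentiability and \<open>K\<close> on to
  \<open>g\<close> would break down. A disk-valued map becomes a strip-valued one through the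
  logarithm of a Cayley transform, since the energy argument starts from a bound on the imaginary
  part alone.\<close>

definition has_partials ::
  "(complex \<Rightarrow> 'a::real_normed_vector) \<Rightarrow> (complex \<Rightarrow> 'a) \<Rightarrow> (complex \<Rightarrow> 'a) \<Rightarrow> complex \<Rightarrow> bool" where
  "has_partials u u1 u2 z \<longleftrightarrow> (u has_derivative (\<lambda>h. Re h *\<^sub>R u1 z + Im h *\<^sub>R u2 z)) (at z)"

text \<open>\<open>S\<close> is any compact set off which \<open>u\<close> vanishes, not the closed
  support itself, so products and cutoffs can be given a convenient carrier. The partial derivatives
  vanish off \<open>S\<close> as well, because its complement is open.\<close>

definition test_fun ::
  "(complex \<Rightarrow> 'a::real_normed_vector) \<Rightarrow> (complex \<Rightarrow> 'a) \<Rightarrow> (complex \<Rightarrow> 'a) \<Rightarrow> complex set \<Rightarrow> bool" where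
  "test_fun u u1 u2 S \<longleftrightarrow> (\<forall>z. has_partials u u1 u2 z) \<and> continuous_on UNIV u1 \<and>
     continuous_on UNIV u2 \<and> compact S \<and> (\<forall>z. z \<notin> S \<longrightarrow> u z = 0)"

lemma partials_bounded_linear: "bounded_linear (\<lambda>h. Re h *\<^sub>R a + Im h *\<^sub>R b)"
  by (intro bounded_linear_add bounded_linear_scaleR_const bounded_linear_Re bounded_linear_Im)

lemma has_partials_unique:
  assumes "has_partials u u1 u2 z" "has_partials u v1 v2 z"
  shows "u1 z = v1 z" "u2 z = v2 z"
proof -
  have "(\<lambda>h. Re h *\<^sub>R u1 z + Im h *\<^sub>R u2 z) = (\<lambda>h. Re h *\<^sub>R v1 z + Im h *\<^sub>R v2 z)"
    using assms has_derivative_unique unfolding has_partials_def by blast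
  from fun_cong[OF this, of 1] fun_cong[OF this, of \<i>] show "u1 z = v1 z" "u2 z = v2 z" by auto
qed

lemma has_partials_transform:
  assumes "has_partials u u1 u2 z" "open A" "z \<in> A" "\<And>w. w \<in> A \<Longrightarrow> v w = u w"
    "v1 z = u1 z" "v2 z = u2 z"
  shows "has_partials v v1 v2 z"
  using has_derivative_transform_within_open[of u _ z UNIV A v] assms
  unfolding has_partials_def by simp

lemma has_partials_imp_continuous: "has_partials u u1 u2 z \<Longrightarrow> isCont u z"
  unfolding has_partials_def by (rule has_derivative_continuous)

lemma has_partials_const: "has_partials (\<lambda>z. c) (\<lambda>z. 0) (\<lambda>z. 0) z"
  unfolding has_partials_def by simp

lemma has_partials_add:
  assumes "has_partials u u1 u2 z" "has_partials v v1 v2 z"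
  shows "has_partials (\<lambda>z. u z + v z) (\<lambda>z. u1 z + v1 z) (\<lambda>z. u2 z + v2 z) z"
  using has_derivative_add[OF assms[unfolded has_partials_def]] unfolding has_partials_def
  by (simp add: algebra_simps scaleR_add_right)

lemma has_partials_minus:
  assumes "has_partials u u1 u2 z"
  shows "has_partials (\<lambda>z. - u z) (\<lambda>z. - u1 z) (\<lambda>z. - u2 z) z"
  using has_derivative_minus[OF assms[unfolded has_partials_def]] unfolding has_partials_def by simp

lemma has_partials_diff:
  assumes "has_partials u u1 u2 z" "has_partials v v1 v2 z"
  shows "has_partials (\<lambda>z. u z - v z) (\<lambda>z. u1 z - v1 z) (\<lambda>z. u2 z - v2 z) z"
  using has_partials_add[OF assms(1) has_partials_minus[OF assms(2)]] by simp

lemma has_partials_scaleR: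
  fixes u :: "complex \<Rightarrow> real"
  assumes "has_partials u u1 u2 z" "has_partials v v1 v2 z"
  shows "has_partials (\<lambda>z. u z *\<^sub>R v z) (\<lambda>z. u1 z *\<^sub>R v z + u z *\<^sub>R v1 z)
           (\<lambda>z. u2 z *\<^sub>R v z + u z *\<^sub>R v2 z) z"
  using has_derivative_scaleR[OF assms[unfolded has_partials_def]] unfolding has_partials_def
  by (simp add: algebra_simps scaleR_add_right scaleR_add_left)

lemma has_partials_mult:
  fixes u v :: "complex \<Rightarrow> real"
  assumes "has_partials u u1 u2 z" "has_partials v v1 v2 z"
  shows "has_partials (\<lambda>z. u z * v z) (\<lambda>z. u1 z * v z + u z * v1 z)
           (\<lambda>z. u2 z * v z + u z * v2 z) z"
  using has_partials_scaleR[OF assms] by simp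

lemma has_partials_Re_diff: "has_partials (\<lambda>z. Re (z - a)) (\<lambda>z. 1) (\<lambda>z. 0) z"
  unfolding has_partials_def by (auto intro!: derivative_eq_intros)

lemma has_partials_Im_diff: "has_partials (\<lambda>z. Im (z - a)) (\<lambda>z. 0) (\<lambda>z. 1) z"
  unfolding has_partials_def by (auto intro!: derivative_eq_intros)

lemma has_partials_bounded_linear:
  assumes "bounded_linear L" "has_partials u u1 u2 z"
  shows "has_partials (\<lambda>z. L (u z)) (\<lambda>z. L (u1 z)) (\<lambda>z. L (u2 z)) z"
proof -
  interpret bounded_linear L by fact
  show ?thesis
    using has_derivative[OF assms(2)[unfolded has_partials_def]] unfolding has_partials_def
    by (simp add: add scaleR)
qed

text \<open>\<open>has_partials\<close> reads the two derivative functions only at \<open>z\<close>,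
  so they may carry the coefficient \<open>q'\<close> frozen at \<open>u z\<close>; users replace it
  by the true function after unfolding the definition.\<close>

lemma has_partials_real_chain:
  fixes u :: "complex \<Rightarrow> real"
  assumes "(q has_real_derivative q') (at (u z))" "has_partials u u1 u2 z"
  shows "has_partials (\<lambda>z. q (u z)) (\<lambda>z. q' * u1 z) (\<lambda>z. q' * u2 z) z"
proof -
  have "(q has_derivative (*) q') (at (u z))"
    using assms(1) by (simp add: has_field_derivative_def)
  from has_derivative_compose[OF assms(2)[unfolded has_partials_def] this]
  show ?thesis unfolding has_partials_def by (simp add: algebra_simps)
qed

lemma has_partials_holomorphic_chain:
  assumes "(F has_field_derivative F') (at (u z))" "has_partials u u1 u2 z"
  shows "has_partials (\<lambda>z. F (u z)) (\<lambda>z. F' * u1 z) (\<lambda>z. F' * u2 z) z"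
proof -
  have "(F has_derivative (*) F') (at (u z))"
    using assms(1) by (simp add: has_field_derivative_def)
  from has_derivative_compose[OF assms(2)[unfolded has_partials_def] this]
  show ?thesis unfolding has_partials_def by (simp add: algebra_simps scaleR_conv_of_real)
qed

lemma has_partials_norm_sq:
  "has_partials (\<lambda>z. (cmod (z - a))\<^sup>2) (\<lambda>z. 2 * Re (z - a)) (\<lambda>z. 2 * Im (z - a)) z"
proof -
  have "has_partials (\<lambda>z. Re (z - a) * Re (z - a) + Im (z - a) * Im (z - a))
     (\<lambda>z. (1 * Re (z - a) + Re (z - a) * 1) + (0 * Im (z - a) + Im (z - a) * 0))
     (\<lambda>z. (0 * Re (z - a) + Re (z - a) * 0) + (1 * Im (z - a) + Im (z - a) * 1)) z"
    by (intro has_partials_add has_partials_mult has_partials_Re_diff has_partials_Im_diff)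
  moreover have "(\<lambda>z. (cmod (z - a))\<^sup>2) = (\<lambda>z. Re (z - a) * Re (z - a) + Im (z - a) * Im (z - a))"
    by (simp only: cmod_power2) (simp add: power2_eq_square)
  moreover have "(\<lambda>z. (1 * Re (z - a) + Re (z - a) * 1) + (0 * Im (z - a) + Im (z - a) * 0)) = (\<lambda>z. 2 * Re (z - a))"
    "(\<lambda>z. (0 * Re (z - a) + Re (z - a) * 0) + (1 * Im (z - a) + Im (z - a) * 1)) = (\<lambda>z. 2 * Im (z - a))"
    by auto
  ultimately show ?thesis by simp
qed

lemma test_funD:
  assumes "test_fun u u1 u2 S"
  shows "has_partials u u1 u2 z" "continuous_on A u" "continuous_on A u1" "continuous_on A u2" "compact S"
    "z \<notin> S \<Longrightarrow> u z = 0" "z \<notin> S \<Longrightarrow> u1 z = 0" "z \<notin> S \<Longrightarrow> u2 z = 0"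
proof -
  show hp: "has_partials u u1 u2 z" for z using assms by (auto simp: test_fun_def)
  show "continuous_on A u"
    by (intro continuous_at_imp_continuous_on ballI has_partials_imp_continuous[OF hp])
  show "continuous_on A u1" "continuous_on A u2" "compact S" "z \<notin> S \<Longrightarrow> u z = 0"
    using assms by (auto simp: test_fun_def intro: continuous_on_subset)
  have o: "open (-S)" using \<open>compact S\<close> by (simp add: compact_imp_closed open_Compl)
  assume z: "z \<notin> S"
  have "has_partials u (\<lambda>_. 0) (\<lambda>_. 0) z"
    by (rule has_partials_transform[OF has_partials_const[of 0] o]) (use z assms in \<open>auto simp: test_fun_def\<close>)
  from has_partials_unique[OF hp this] show "u1 z = 0" "u2 z = 0" by auto
qed

section \<open>Compactly supported functions and the integrals of their partial derivatives\<close>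

lemma continuous_compact_support_integrable:
  fixes f :: "complex \<Rightarrow> 'a::{banach,second_countable_topology}"
  assumes "compact S" "continuous_on S f" "\<And>z. z \<notin> S \<Longrightarrow> f z = 0"
  shows "integrable lborel f"
proof -
  have "set_integrable lborel S f" using borel_integrable_compact[OF assms(1,2)]
    by (simp add: set_integrable_def indicator_scaleR_eq_if)
  moreover have "indicator S z *\<^sub>R f z = f z" for z using assms(3)[of z] by (cases "z \<in> S") auto
  ultimately show ?thesis by (simp add: set_integrable_def)
qed

lemma continuous_compact_support_bounded:
  fixes f :: "complex \<Rightarrow> 'a::real_normed_vector"
  assumes "compact S" "continuous_on S f" "\<And>z. z \<notin> S \<Longrightarrow> f z = 0"
  obtains B where "B > 0" "\<And>z. norm (f z) \<le> B"
proof -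
  have "bounded (f ` S)" using assms compact_continuous_image compact_imp_bounded by blast
  then obtain B where "B > 0" "\<forall>x\<in>S. norm (f x) \<le> B" by (auto simp: bounded_pos)
  then show ?thesis using assms(3) that[of B] by (metis norm_zero less_imp_le)
qed

lemma continuous_compact_support_uniformly:
  fixes f :: "complex \<Rightarrow> 'a::real_normed_vector"
  assumes "compact S" "continuous_on UNIV f" "\<And>z. z \<notin> S \<Longrightarrow> f z = 0" "e > 0"
  obtains d where "d > 0" "\<And>z w. dist z w < d \<Longrightarrow> dist (f z) (f w) < e"
proof -
  obtain r where r: "\<And>z. z \<in> S \<Longrightarrow> cmod z \<le> r"
    using compact_imp_bounded[OF assms(1)] by (auto simp: bounded_iff)
  have "uniformly_continuous_on (cball 0 (r+1)) f"
    by (rule compact_uniformly_continuous) (auto intro: continuous_on_subset[OF assms(2)])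
  then obtain d where d: "d > 0" "\<And>z w. z \<in> cball 0 (r+1) \<Longrightarrow> w \<in> cball 0 (r+1) \<Longrightarrow> dist w z < d \<Longrightarrow> dist (f w) (f z) < e"
    unfolding uniformly_continuous_on_def using \<open>e > 0\<close> by metis
  have "dist (f z) (f w) < e" if zw: "dist z w < min d 1" for z w
  proof (cases "z \<in> S \<or> w \<in> S")
    case True
    have "cmod z \<le> cmod w + dist z w" "cmod w \<le> cmod z + dist z w"
      using norm_triangle_sub[of z w] norm_triangle_sub[of w z] by (auto simp: dist_norm norm_minus_commute)
    then have "z \<in> cball 0 (r+1)" "w \<in> cball 0 (r+1)" using True r[of z] r[of w] zw by auto
    then show ?thesis using d zw by auto
  next
    case False then show ?thesis using assms(3,4) by auto
  qed
  then show ?thesis using that[of "min d 1"] d by auto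
qed

lemma lborel_integral_shift:
  fixes f :: "complex \<Rightarrow> 'a::{banach,second_countable_topology}"
  shows "(LINT z|lborel. f (c + z)) = (LINT z|lborel. f z)"
    and "integrable lborel f \<Longrightarrow> integrable lborel (\<lambda>z. f (c + z))"
proof -
  show "integrable lborel f \<Longrightarrow> integrable lborel (\<lambda>z. f (c + z))"
    using integrable_distr[of "(+) c" lborel borel f] by (simp add: lborel_distr_plus)
  show "(LINT z|lborel. f (c + z)) = (LINT z|lborel. f z)"
  proof (cases "f \<in> borel_measurable borel")
    case True
    then show ?thesis using integral_distr[of "(+) c" lborel borel f] by (simp add: lborel_distr_plus)
  next
    case False
    have "(\<lambda>z. f (c + z)) \<notin> borel_measurable borel"
    proof
      assume "(\<lambda>z. f (c + z)) \<in> borel_measurable borel"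
      then have "(\<lambda>z. f (c + (-c + z))) \<in> borel_measurable borel" by measurable
      then show False using False by simp
    qed
    then have "\<not> integrable lborel (\<lambda>z. f (c + z))" "\<not> integrable lborel f"
      using False borel_measurable_integrable by force+
    then show ?thesis by (simp add: not_integrable_integral_eq)
  qed
qed

text \<open>Translation invariance gives \<open>\<integral> (u (t d + z) - u z) / t = 0\<close>; let \<open>t \<rightarrow> 0\<close>.\<close>

lemma integral_test_fun_partials:
  fixes u :: "complex \<Rightarrow> 'a::{banach,second_countable_topology}"
  assumes T: "test_fun u u1 u2 S"
  shows "(LINT z|lborel. u1 z) = 0" "(LINT z|lborel. u2 z) = 0"
proof -
  note td = test_funD[OF T]
  obtain B1 where B1: "B1 > 0" "\<And>z. norm (u1 z) \<le> B1"
    using continuous_compact_support_bounded[OF td(5) td(3) td(7)] by blast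
  obtain B2 where B2: "B2 > 0" "\<And>z. norm (u2 z) \<le> B2"
    using continuous_compact_support_bounded[OF td(5) td(4) td(8)] by blast
  obtain r where r: "\<And>z. z \<in> S \<Longrightarrow> cmod z \<le> r"
    using compact_imp_bounded[OF td(5)] by (auto simp: bounded_iff)
  have iu: "integrable lborel u" by (rule continuous_compact_support_integrable[OF td(5) td(2) td(6)])
  \<comment> \<open>The mean value inequality bounds all difference quotients by
    \<open>B1 + B2\<close>, which provides the dominating function for the limit below.\<close>
  have lip: "norm (u w - u z) \<le> (B1 + B2) * norm (w - z)" for z w
  proof (rule differentiable_bound[of UNIV u "\<lambda>z h. Re h *\<^sub>R u1 z + Im h *\<^sub>R u2 z"])
    show "onorm (\<lambda>h. Re h *\<^sub>R u1 z + Im h *\<^sub>R u2 z) \<le> B1 + B2" for z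
    proof (rule onorm_bound)
      fix h
      have "norm (Re h *\<^sub>R u1 z + Im h *\<^sub>R u2 z) \<le> \<bar>Re h\<bar> * norm (u1 z) + \<bar>Im h\<bar> * norm (u2 z)"
        by (metis norm_scaleR norm_triangle_ineq)
      also have "\<dots> \<le> cmod h * B1 + cmod h * B2"
        by (intro add_mono mult_mono abs_Re_le_cmod abs_Im_le_cmod B1 B2) auto
      finally show "norm (Re h *\<^sub>R u1 z + Im h *\<^sub>R u2 z) \<le> (B1 + B2) * norm h" by (simp add: algebra_simps)
    qed (use B1 B2 in auto)
  qed (use td(1) in \<open>auto simp: has_partials_def\<close>)
  have key: "(LINT z|lborel. Re d *\<^sub>R u1 z + Im d *\<^sub>R u2 z) = 0" if d: "cmod d = 1" for d
  proof -
    define t where "t n = inverse (real (Suc n))" for n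
    have t: "t n > 0" "t n \<le> 1" for n by (auto simp: t_def field_simps)
    have t0: "t \<longlonglongrightarrow> 0" unfolding t_def by (rule LIMSEQ_inverse_real_of_nat)
    define s where "s n z = (u (t n *\<^sub>R d + z) - u z) /\<^sub>R t n" for n z
    have i: "integrable lborel (s n)" for n
      unfolding s_def by (intro integrable_scaleR_right Bochner_Integration.integrable_diff lborel_integral_shift iu)
    have z: "(LINT z|lborel. s n z) = 0" for n
      unfolding s_def
      by (subst integral_scaleR_right, (intro Bochner_Integration.integrable_diff lborel_integral_shift iu)?)
         (simp add: Bochner_Integration.integral_diff lborel_integral_shift iu)
    \<comment> \<open>The steps have length at most \<open>1\<close>, so every quotient vanishes
      outside the disk of radius \<open>r + 1\<close>.\<close>
    have "(\<lambda>n. LINT z|lborel. s n z) \<longlonglongrightarrow> (LINT z|lborel. Re d *\<^sub>R u1 z + Im d *\<^sub>R u2 z)"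
    proof (rule integral_dominated_convergence[where w = "\<lambda>z. indicator (cball 0 (r+1)) z *\<^sub>R (B1+B2)"])
      show "integrable lborel (\<lambda>z::complex. indicator (cball 0 (r+1)) z *\<^sub>R (B1+B2))"
        by (intro continuous_compact_support_integrable[of "cball 0 (r+1)"]) (auto intro!: continuous_on_eq[OF continuous_on_const[of _ "B1+B2"]])
      show "AE z in lborel. (\<lambda>n. s n z) \<longlonglongrightarrow> Re d *\<^sub>R u1 z + Im d *\<^sub>R u2 z"
      proof (rule AE_I2)
        fix z
        let ?L = "Re d *\<^sub>R u1 z + Im d *\<^sub>R u2 z"
        have "((\<lambda>h. norm (u (z + h) - u z - (Re h *\<^sub>R u1 z + Im h *\<^sub>R u2 z)) / norm h) \<longlongrightarrow> 0) (at 0)"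
          using td(1)[of z] by (simp add: has_partials_def has_derivative_at)
        moreover have "filterlim (\<lambda>n. t n *\<^sub>R d) (at 0) sequentially"
        proof -
          have "(\<lambda>n. t n *\<^sub>R d) \<longlonglongrightarrow> 0 *\<^sub>R d" by (intro tendsto_intros t0)
          moreover have "t n *\<^sub>R d \<noteq> 0" for n using t(1)[of n] d by auto
          ultimately show ?thesis by (simp add: filterlim_at)
        qed
        ultimately have "(\<lambda>n. norm (u (z + t n *\<^sub>R d) - u z -
            (Re (t n *\<^sub>R d) *\<^sub>R u1 z + Im (t n *\<^sub>R d) *\<^sub>R u2 z)) / norm (t n *\<^sub>R d)) \<longlonglongrightarrow> 0"
          by (rule filterlim_compose)
        moreover have "norm (u (z + t n *\<^sub>R d) - u z -
            (Re (t n *\<^sub>R d) *\<^sub>R u1 z + Im (t n *\<^sub>R d) *\<^sub>R u2 z)) / norm (t n *\<^sub>R d) = norm (s n z - ?L)" for n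
        proof -
          have "s n z - ?L = (u (z + t n *\<^sub>R d) - u z - t n *\<^sub>R ?L) /\<^sub>R t n"
            using t(1)[of n] by (simp add: s_def scaleR_diff_right add.commute)
          then show ?thesis using t(1)[of n] d by (simp add: scaleR_add_right divide_inverse mult.commute)
        qed
        ultimately have "(\<lambda>n. norm (s n z - ?L)) \<longlonglongrightarrow> 0" by simp
        then show "(\<lambda>n. s n z) \<longlonglongrightarrow> ?L"
          by (metis LIM_zero_cancel tendsto_norm_zero_cancel)
      qed
      show "AE z in lborel. norm (s n z) \<le> indicator (cball 0 (r+1)) z *\<^sub>R (B1+B2)" for n
      proof (rule AE_I2)
        fix z
        show "norm (s n z) \<le> indicator (cball 0 (r+1)) z *\<^sub>R (B1+B2)"
        proof (cases "z \<in> cball 0 (r+1)")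
          case True
          have "norm (s n z) = norm (u (t n *\<^sub>R d + z) - u z) / t n"
            unfolding s_def using t[of n] by (simp add: divide_inverse mult.commute)
          also have "\<dots> \<le> (B1+B2) * norm (t n *\<^sub>R d + z - z) / t n"
            by (intro divide_right_mono lip) (use t[of n] in auto)
          also have "\<dots> = B1 + B2" using t[of n] d by simp
          finally show ?thesis using True by simp
        next
          case False
          have "cmod z \<le> cmod (t n *\<^sub>R d + z) + cmod (t n *\<^sub>R d)"
            using norm_triangle_ineq4[of "t n *\<^sub>R d + z" "t n *\<^sub>R d"] by simp
          moreover have "cmod (t n *\<^sub>R d) \<le> 1" using t[of n] d by simp
          ultimately have "t n *\<^sub>R d + z \<notin> S" "z \<notin> S" using False r[of z] r[of "t n *\<^sub>R d + z"] by auto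
          then show ?thesis using td(6) B1 B2 by (simp add: s_def)
        qed
      qed
      show "(\<lambda>z. Re d *\<^sub>R u1 z + Im d *\<^sub>R u2 z) \<in> borel_measurable lborel"
        by (auto intro!: borel_measurable_continuous_onI continuous_intros td)
      show "s n \<in> borel_measurable lborel" for n using i by (rule borel_measurable_integrable)
    qed
    then show ?thesis using z by (simp add: LIMSEQ_const_iff)
  qed
  from key[of 1] key[of \<i>] show "(LINT z|lborel. u1 z) = 0" "(LINT z|lborel. u2 z) = 0" by simp_all
qed

text \<open>From the exponent 2 on, the truncated power glues differentiably at \<open>0\<close>,
  since the difference quotient there is at most \<open>\<bar>h\<bar> ^ Suc n\<close> in absolute
  value. Such powers give compactly supported functions with explicit derivatives.\<close>

lemma max_power_has_real_derivative:
  "((\<lambda>x::real. (max 0 x) ^ Suc (Suc n)) has_real_derivative real (Suc (Suc n)) * (max 0 x) ^ Suc n) (at x)"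
proof (cases "x = 0")
  case False
  then consider "x > 0" | "x < 0" by linarith
  then show ?thesis
  proof cases
    case 1
    have "((\<lambda>x::real. x ^ Suc (Suc n)) has_real_derivative real (Suc (Suc n)) * x ^ Suc n) (at x)"
      using DERIV_pow[of "Suc (Suc n)" x UNIV] by simp
    then have "((\<lambda>x::real. (max 0 x) ^ Suc (Suc n)) has_real_derivative real (Suc (Suc n)) * x ^ Suc n) (at x)"
      by (rule has_field_derivative_transform_within_open[of _ _ _ "{0<..}"]) (use 1 in auto)
    then show ?thesis using 1 by simp
  next
    case 2
    have "((\<lambda>x::real. 0) has_real_derivative 0) (at x)" by simp
    then have "((\<lambda>x::real. (max 0 x) ^ Suc (Suc n)) has_real_derivative 0) (at x)"
      by (rule has_field_derivative_transform_within_open[of _ _ _ "{..<0}"]) (use 2 in auto)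
    then show ?thesis using 2 by simp
  qed
next
  case True
  have "((\<lambda>h::real. (max 0 h) ^ Suc (Suc n) / h) \<longlongrightarrow> 0) (at 0)"
  proof (rule Lim_null_comparison[where g = "\<lambda>h. \<bar>h\<bar> ^ Suc n"])
    have "\<bar>(max 0 h) ^ Suc (Suc n) / h\<bar> \<le> \<bar>h\<bar> ^ Suc n" for h :: real
    proof (cases "h > 0")
      case False
      then have "max 0 h = 0" by simp
      then show ?thesis by (simp del: power_Suc add: power_0_left)
    qed (simp add: abs_mult)
    then show "\<forall>\<^sub>F h in at 0. norm ((max 0 h) ^ Suc (Suc n) / h) \<le> \<bar>h\<bar> ^ Suc n" for h :: real
      by (simp del: power_Suc)
    have "((\<lambda>h::real. \<bar>h\<bar> ^ Suc n) \<longlongrightarrow> \<bar>0\<bar> ^ Suc n) (at 0)" by (intro tendsto_intros)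
    then show "((\<lambda>h::real. \<bar>h\<bar> ^ Suc n) \<longlongrightarrow> 0) (at 0)" by simp
  qed
  then show ?thesis using True by (simp add: DERIV_def)
qed

lemma max_sq_has_real_derivative:
  "((\<lambda>x::real. (max 0 x)\<^sup>2) has_real_derivative 2 * max 0 x) (at x)"
  using max_power_has_real_derivative[of 0 x] by (simp add: numeral_2_eq_2)

lemma max_cube_has_real_derivative:
  "((\<lambda>x::real. (max 0 x) ^ 3) has_real_derivative 3 * (max 0 x)\<^sup>2) (at x)"
  using max_power_has_real_derivative[of 1 x] by (simp add: numeral_2_eq_2 numeral_3_eq_3)

text \<open>With \<open>s\<close> equal to \<open>0\<close> on the circle of radius \<open>R\<close>
  and to \<open>1\<close> on that of radius \<open>sqrt 2 * R\<close>, the cutoff is a truncation of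
  \<open>1 - s^2\<close>, squared. The outer square is the point: it bounds the gradient by a
  multiple of \<open>sqrt (\<phi> z)\<close> rather than by a constant, so a term linear in the
  gradient can be absorbed by the energy weighted with the cutoff in
  \<open>caccioppoli\<close>.\<close>

lemma cutoff_exists:
  assumes R: "R > 0"
  obtains \<phi> \<phi>1 \<phi>2 where "test_fun \<phi> \<phi>1 \<phi>2 (cball a (2 * R))"
    "\<And>z. 0 \<le> \<phi> z" "\<And>z. \<phi> z \<le> (1::real)"
    "\<And>z. z \<in> cball a R \<Longrightarrow> \<phi> z = 1" "\<And>z. z \<in> cball a R \<Longrightarrow> \<phi>1 z = 0" "\<And>z. z \<in> cball a R \<Longrightarrow> \<phi>2 z = 0"
    "\<And>z. \<bar>\<phi>1 z\<bar> \<le> 16 / R * sqrt (\<phi> z)" "\<And>z. \<bar>\<phi>2 z\<bar> \<le> 16 / R * sqrt (\<phi> z)"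
proof -
  define s where "s z = (1 / R\<^sup>2) * (cmod (z - a))\<^sup>2 - 1" for z
  define q where "q z = 1 - (max 0 (s z))\<^sup>2" for z
  define \<phi> where "\<phi> z = (max 0 (q z))\<^sup>2" for z
  define c where "c z = 2 * max 0 (q z) * (- (2 * max 0 (s z)))" for z
  define \<phi>1 where "\<phi>1 z = c z * (1 / R\<^sup>2 * (2 * Re (z - a)))" for z
  define \<phi>2 where "\<phi>2 z = c z * (1 / R\<^sup>2 * (2 * Im (z - a)))" for z
  have hs: "has_partials s (\<lambda>z. 1 / R\<^sup>2 * (2 * Re (z - a))) (\<lambda>z. 1 / R\<^sup>2 * (2 * Im (z - a))) z" for z
    using has_partials_diff[OF has_partials_mult[OF has_partials_const[of "1 / R\<^sup>2"] has_partials_norm_sq[of a]] has_partials_const[of 1], of z]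
    unfolding s_def[abs_def] by (simp del: minus_complex.sel)
  have hq: "has_partials q (\<lambda>w. - (2 * max 0 (s z)) * (1 / R\<^sup>2 * (2 * Re (w - a)))) (\<lambda>w. - (2 * max 0 (s z)) * (1 / R\<^sup>2 * (2 * Im (w - a)))) z" for z
    using has_partials_diff[OF has_partials_const[of 1] has_partials_real_chain[OF max_sq_has_real_derivative hs], of z]
    unfolding q_def[abs_def] by (simp del: minus_complex.sel add: mult.assoc)
  have hp: "has_partials \<phi> \<phi>1 \<phi>2 z" for z
    using has_partials_real_chain[OF max_sq_has_real_derivative hq, of z]
    unfolding \<phi>_def[abs_def] has_partials_def \<phi>1_def \<phi>2_def c_def by (simp del: minus_complex.sel add: mult.assoc)
  have cs: "continuous_on UNIV s" unfolding s_def by (intro continuous_intros)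
  have cq: "continuous_on UNIV q" unfolding q_def by (intro continuous_intros cs)
  have cc: "continuous_on UNIV c" unfolding c_def by (intro continuous_intros cs cq)
  have s0: "s z \<le> 0" if "z \<in> cball a R" for z
  proof -
    have "(cmod (z - a))\<^sup>2 \<le> R\<^sup>2" using that R by (intro power_mono) (auto simp: dist_norm norm_minus_commute)
    then show ?thesis using R by (simp add: s_def divide_le_eq)
  qed
  have s1: "q z \<le> 0" if "s z \<ge> 1" for z
    using that power_mono[of 1 "s z" 2] by (simp add: q_def)
  have s2: "cmod (z - a) < 2 * R" if "s z < 1" for z
  proof -
    have "(cmod (z - a))\<^sup>2 < 2 * R\<^sup>2" using that R by (simp add: s_def divide_less_eq field_simps)
    also have "\<dots> \<le> (2 * R)\<^sup>2" by (simp add: power_mult_distrib)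
    finally have "(cmod (z - a))\<^sup>2 < (2 * R)\<^sup>2" .
    from power_less_imp_less_base[OF this] show ?thesis using R by simp
  qed
  \<comment> \<open>\<open>\<bar>c z\<bar>\<close> is at most \<open>4 * sqrt (\<phi> z)\<close> and
    the other factor at most \<open>4 / R\<close>, because \<open>\<bar>t\<bar> \<le> 2 * R\<close>
    where \<open>s z < 1\<close>; hence the 16.\<close>
  have bd: "\<bar>c z * (1 / R\<^sup>2 * (2 * t))\<bar> \<le> 16 / R * sqrt (\<phi> z)" if "\<bar>t\<bar> \<le> cmod (z - a)" for z t
  proof (cases "s z < 1")
    case True
    have "\<bar>c z\<bar> = 4 * max 0 (q z) * max 0 (s z)" by (simp add: c_def abs_mult)
    also have "\<dots> \<le> 4 * max 0 (q z) * 1" using True by (intro mult_left_mono) auto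
    finally have 1: "\<bar>c z\<bar> \<le> 4 * sqrt (\<phi> z)" by (simp add: \<phi>_def)
    have "\<bar>t\<bar> \<le> 2 * R" using that s2[OF True] by linarith
    then have 2: "\<bar>1 / R\<^sup>2 * (2 * t)\<bar> \<le> 4 / R" using R by (simp add: abs_mult field_simps power2_eq_square)
    have "\<bar>c z * (1 / R\<^sup>2 * (2 * t))\<bar> \<le> (4 * sqrt (\<phi> z)) * (4 / R)"
      unfolding abs_mult[of "c z"] by (rule mult_mono[OF 1 2]) (auto simp: \<phi>_def)
    then show ?thesis by (simp add: field_simps)
  next
    case False
    then have "max 0 (q z) = 0" using s1[of z] by simp
    then show ?thesis by (simp add: c_def \<phi>_def)
  qed
  show ?thesis
  proof (rule that[of \<phi> \<phi>1 \<phi>2])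
    show "test_fun \<phi> \<phi>1 \<phi>2 (cball a (2 * R))"
      unfolding test_fun_def
    proof (intro conjI allI impI)
      show "continuous_on UNIV \<phi>1" "continuous_on UNIV \<phi>2"
        unfolding \<phi>1_def \<phi>2_def by (intro continuous_intros cc)+
      fix z assume "z \<notin> cball a (2 * R)"
      then have "\<not> s z < 1" using s2[of z] by (auto simp: dist_norm norm_minus_commute)
      then show "\<phi> z = 0" using s1[of z] by (simp add: \<phi>_def)
    qed (auto intro: hp)
    show "\<phi> z \<le> 1" for z
      unfolding \<phi>_def by (rule power_le_one) (auto simp: q_def)
    show "\<phi> z = 1" "\<phi>1 z = 0" "\<phi>2 z = 0" if "z \<in> cball a R" for z
      using s0[OF that] by (auto simp: \<phi>_def q_def \<phi>1_def \<phi>2_def c_def)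
    show "\<bar>\<phi>1 z\<bar> \<le> 16 / R * sqrt (\<phi> z)" "\<bar>\<phi>2 z\<bar> \<le> 16 / R * sqrt (\<phi> z)" for z
      unfolding \<phi>1_def \<phi>2_def by (rule bd, simp only: abs_Re_le_cmod abs_Im_le_cmod)+
  qed (simp add: \<phi>_def)
qed

section \<open>Translates, radial bumps and their telescoping differences\<close>

lemma has_partials_translate:
  assumes "has_partials u u1 u2 (z - a)"
  shows "has_partials (\<lambda>z. u (z - a)) (\<lambda>z. u1 (z - a)) (\<lambda>z. u2 (z - a)) z"
proof -
  have "((\<lambda>z. z - a) has_derivative (\<lambda>h. h)) (at z)" by (auto intro!: derivative_eq_intros)
  from has_derivative_compose[OF this assms[unfolded has_partials_def]] show ?thesis
    by (simp add: has_partials_def)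
qed

lemma test_fun_translate:
  assumes T: "test_fun u u1 u2 (cball 0 r)"
  shows "test_fun (\<lambda>z. u (z - a)) (\<lambda>z. u1 (z - a)) (\<lambda>z. u2 (z - a)) (cball a r)"
proof -
  note td = test_funD[OF T]
  have "continuous_on UNIV (\<lambda>z. u1 (z - a))" "continuous_on UNIV (\<lambda>z. u2 (z - a))"
    by (rule continuous_on_compose2[OF td(3)] continuous_on_compose2[OF td(4)]; auto intro!: continuous_intros)+
  moreover have "u (z - a) = 0" if "z \<notin> cball a r" for z
    using that by (intro td(6)) (auto simp: dist_norm norm_minus_commute)
  ultimately show ?thesis
    unfolding test_fun_def using has_partials_translate[OF td(1)] by auto
qed

text \<open>The exponent \<open>3\<close> makes \<open>bump Q\<close> twice continuously differentiable.\<close>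

definition bump :: "real \<Rightarrow> complex \<Rightarrow> real" where
  "bump Q w = 4 * Q * (max 0 (1 - Q * (cmod w)\<^sup>2)) ^ 3"

definition bump_x :: "real \<Rightarrow> complex \<Rightarrow> real" where
  "bump_x Q w = - 24 * Q\<^sup>2 * (max 0 (1 - Q * (cmod w)\<^sup>2))\<^sup>2 * Re w"

definition bump_y :: "real \<Rightarrow> complex \<Rightarrow> real" where
  "bump_y Q w = - 24 * Q\<^sup>2 * (max 0 (1 - Q * (cmod w)\<^sup>2))\<^sup>2 * Im w"

definition bump_xx :: "real \<Rightarrow> complex \<Rightarrow> real" where
  "bump_xx Q w = 96 * Q ^ 3 * max 0 (1 - Q * (cmod w)\<^sup>2) * (Re w)\<^sup>2 - 24 * Q\<^sup>2 * (max 0 (1 - Q * (cmod w)\<^sup>2))\<^sup>2"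

definition bump_yy :: "real \<Rightarrow> complex \<Rightarrow> real" where
  "bump_yy Q w = 96 * Q ^ 3 * max 0 (1 - Q * (cmod w)\<^sup>2) * (Im w)\<^sup>2 - 24 * Q\<^sup>2 * (max 0 (1 - Q * (cmod w)\<^sup>2))\<^sup>2"

definition bump_xy :: "real \<Rightarrow> complex \<Rightarrow> real" where
  "bump_xy Q w = 96 * Q ^ 3 * max 0 (1 - Q * (cmod w)\<^sup>2) * Re w * Im w"

lemma has_partials_one_minus_norm_sq:
  "has_partials (\<lambda>w. 1 - Q * (cmod w)\<^sup>2) (\<lambda>w. - 2 * Q * Re w) (\<lambda>w. - 2 * Q * Im w) w"
  using has_partials_diff[OF has_partials_const[of 1]
      has_partials_mult[OF has_partials_const[of Q] has_partials_norm_sq[of 0]], of w]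
  by (simp add: algebra_simps)

lemma bump_outside:
  assumes "Q > 0" "cmod w \<ge> 1 / sqrt Q"
  shows "max 0 (1 - Q * (cmod w)\<^sup>2) = 0"
proof -
  have "(1 / sqrt Q)\<^sup>2 \<le> (cmod w)\<^sup>2" using assms by (intro power_mono) auto
  then have "1 \<le> Q * (cmod w)\<^sup>2" using assms by (simp add: power_divide divide_le_eq mult.commute)
  then show ?thesis by simp
qed

lemma has_partials_bump: "has_partials (bump Q) (bump_x Q) (bump_y Q) w"
proof -
  have "has_partials (\<lambda>w. (max 0 (1 - Q * (cmod w)\<^sup>2)) ^ 3)
     (\<lambda>v. 3 * (max 0 (1 - Q * (cmod w)\<^sup>2))\<^sup>2 * (- 2 * Q * Re v)) (\<lambda>v. 3 * (max 0 (1 - Q * (cmod w)\<^sup>2))\<^sup>2 * (- 2 * Q * Im v)) w"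
    by (rule has_partials_real_chain[OF max_cube_has_real_derivative has_partials_one_minus_norm_sq])
  from has_partials_mult[OF has_partials_const[of "4 * Q"] this] show ?thesis
    unfolding has_partials_def bump_def[abs_def] bump_x_def bump_y_def by (simp add: algebra_simps power2_eq_square)
qed

lemma has_partials_bump_xy:
  "has_partials (bump_x Q) (bump_xx Q) (bump_xy Q) w" "has_partials (bump_y Q) (bump_xy Q) (bump_yy Q) w"
proof -
  have "has_partials (\<lambda>w. (max 0 (1 - Q * (cmod w)\<^sup>2))\<^sup>2)
     (\<lambda>v. 2 * (max 0 (1 - Q * (cmod w)\<^sup>2)) * (- 2 * Q * Re v)) (\<lambda>v. 2 * (max 0 (1 - Q * (cmod w)\<^sup>2)) * (- 2 * Q * Im v)) w"
    by (rule has_partials_real_chain[OF max_sq_has_real_derivative has_partials_one_minus_norm_sq])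
  note * = has_partials_mult[OF has_partials_const[of "- 24 * Q\<^sup>2"] this]
  show "has_partials (bump_x Q) (bump_xx Q) (bump_xy Q) w"
    using has_partials_mult[OF * has_partials_Re_diff[of 0]]
    unfolding has_partials_def bump_x_def[abs_def] bump_xx_def bump_xy_def
    by (simp add: algebra_simps power2_eq_square power3_eq_cube)
  show "has_partials (bump_y Q) (bump_xy Q) (bump_yy Q) w"
    using has_partials_mult[OF * has_partials_Im_diff[of 0]]
    unfolding has_partials_def bump_y_def[abs_def] bump_yy_def bump_xy_def
    by (simp add: algebra_simps power2_eq_square power3_eq_cube)
qed

lemma continuous_on_bump:
  "continuous_on A (bump Q)" "continuous_on A (bump_x Q)" "continuous_on A (bump_y Q)"
  "continuous_on A (bump_xx Q)" "continuous_on A (bump_xy Q)" "continuous_on A (bump_yy Q)"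
  unfolding bump_def[abs_def] bump_x_def[abs_def] bump_y_def[abs_def] bump_xx_def[abs_def] bump_xy_def[abs_def] bump_yy_def[abs_def]
  by (intro continuous_intros)+

lemma test_fun_bump:
  assumes "Q > 0"
  shows "test_fun (bump Q) (bump_x Q) (bump_y Q) (cball 0 (1 / sqrt Q))"
    "test_fun (bump_x Q) (bump_xx Q) (bump_xy Q) (cball 0 (1 / sqrt Q))"
    "test_fun (bump_y Q) (bump_xy Q) (bump_yy Q) (cball 0 (1 / sqrt Q))"
proof -
  have "bump Q w = 0" "bump_x Q w = 0" "bump_y Q w = 0" if "w \<notin> cball 0 (1 / sqrt Q)" for w
    using that bump_outside[OF assms, of w] by (auto simp: bump_def bump_x_def bump_y_def)
  then show "test_fun (bump Q) (bump_x Q) (bump_y Q) (cball 0 (1 / sqrt Q))"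
    "test_fun (bump_x Q) (bump_xx Q) (bump_xy Q) (cball 0 (1 / sqrt Q))"
    "test_fun (bump_y Q) (bump_xy Q) (bump_yy Q) (cball 0 (1 / sqrt Q))"
    unfolding test_fun_def by (auto intro!: has_partials_bump has_partials_bump_xy continuous_on_bump)
qed

text \<open>The radial field \<open>w \<mapsto> Q * rprof (Q |w|^2) * w\<close> has divergence \<open>2 * bump Q\<close> and equals \<open>w / |w|^2\<close> outside
  the disk of radius \<open>1 / sqrt Q\<close>, so differences of two such fields have compact support.\<close>

definition rprof :: "real \<Rightarrow> real" where
  "rprof s = (if s < 1 then 1 + (1 - s) + (1 - s)\<^sup>2 + (1 - s) ^ 3 else 1 / s)"

definition rprof' :: "real \<Rightarrow> real" where
  "rprof' s = (if s < 1 then - (1 + 2 * (1 - s) + 3 * (1 - s)\<^sup>2) else - 1 / s\<^sup>2)"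

text \<open>The two branches share the value \<open>1\<close> and the slope \<open>-1\<close> at
  \<open>s = 1\<close>, so the one-sided derivatives there can be glued.\<close>

lemma rprof_has_real_derivative: "(rprof has_real_derivative rprof' s) (at s)"
proof -
  have 1: "((\<lambda>s. 1 + (1 - s) + (1 - s)\<^sup>2 + (1 - s) ^ 3) has_real_derivative
      - (1 + 2 * (1 - s) + 3 * (1 - s)\<^sup>2)) (at s within A)" for s :: real and A
    by (auto intro!: derivative_eq_intros)
  have 2: "((\<lambda>s. 1 / s) has_real_derivative - 1 / s\<^sup>2) (at s within A)" if "s > 0" for s :: real and A
    using that by (auto intro!: derivative_eq_intros simp: power2_eq_square)
  show ?thesis
  proof (cases "s = 1")
    case False
    show ?thesis
    proof (cases "s < 1")
      case True
      show ?thesis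
        by (rule has_field_derivative_transform_within_open[of "\<lambda>s. 1 + (1 - s) + (1 - s)\<^sup>2 + (1 - s) ^ 3" _ _ "{..<1}"])
           (use True 1[of s UNIV] in \<open>auto simp: rprof_def rprof'_def\<close>)
    next
      case F: False
      show ?thesis
        by (rule has_field_derivative_transform_within_open[of "\<lambda>s. 1 / s" _ _ "{1<..}"])
           (use False F 2[of s UNIV] in \<open>auto simp: rprof_def rprof'_def\<close>)
    qed
  next
    case True
    have l: "(rprof has_real_derivative -1) (at 1 within {..1})"
      by (rule has_field_derivative_transform_within[of "\<lambda>s. 1 + (1 - s) + (1 - s)\<^sup>2 + (1 - s) ^ 3" _ _ _ 1])
         (use 1[of 1 "{..1}"] in \<open>auto simp: rprof_def\<close>)
    have r: "(rprof has_real_derivative -1) (at 1 within {1..})"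
      by (rule has_field_derivative_transform_within[of "\<lambda>s. 1 / s" _ _ _ 1])
         (use 2[of 1 "{1..}"] in \<open>auto simp: rprof_def\<close>)
    have "(rprof has_real_derivative -1) (at 1 within {..1} \<union> {1..})"
      using l r unfolding has_field_derivative_iff by (simp add: Lim_within_Un)
    moreover have "{..1} \<union> {1..} = (UNIV :: real set)" by auto
    ultimately show ?thesis using True by (simp add: rprof'_def)
  qed
qed

lemma continuous_on_rprof': "continuous_on UNIV rprof'"
proof -
  have "continuous_on ({..1} \<union> {1..}) (\<lambda>s::real. if s \<le> 1 then - (1 + 2 * (1 - s) + 3 * (1 - s)\<^sup>2) else - 1 / s\<^sup>2)"
    by (rule continuous_on_If) (auto intro!: continuous_intros)
  moreover have "{..1} \<union> {1..} = (UNIV :: real set)" by auto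
  moreover have "rprof' = (\<lambda>s::real. if s \<le> 1 then - (1 + 2 * (1 - s) + 3 * (1 - s)\<^sup>2) else - 1 / s\<^sup>2)"
    by (auto simp: rprof'_def fun_eq_iff)
  ultimately show ?thesis by metis
qed

lemma rprof_bounds: "s \<ge> 0 \<Longrightarrow> 0 \<le> rprof s \<and> rprof s \<le> 4"
proof (cases "s < 1")
  case True
  assume "s \<ge> 0"
  then have "(1 - s)\<^sup>2 \<le> 1" "(1 - s) ^ 3 \<le> 1" using True by (auto intro!: power_le_one)
  then show ?thesis using True \<open>s \<ge> 0\<close> by (auto simp: rprof_def)
qed (auto simp: rprof_def field_simps)

text \<open>With \<open>u = 1 - s\<close> the polynomial branch is the geometric sum
  \<open>1 + u + u^2 + u^3\<close>, so \<open>s * rprof s = 1 - u^4\<close>; the left side is twice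
  the derivative of \<open>s * rprof s\<close>, that is \<open>8 * u^3\<close>. On the other branch
  \<open>s * rprof s\<close> is constant.\<close>

lemma rprof_identity: "2 * rprof s + 2 * s * rprof' s = 8 * (max 0 (1 - s)) ^ 3"
proof (cases "s < 1")
  case True
  then show ?thesis by (simp add: rprof_def rprof'_def) algebra
qed (auto simp: rprof_def rprof'_def power2_eq_square)

text \<open>Half the difference of the radial fields at \<open>4 * Q\<close> and \<open>Q\<close> is
  a compactly supported field whose divergence is the difference of the two bumps. Tested against
  \<open>v\<close>, a change of scale thus becomes an integral of the weak derivatives of
  \<open>v\<close> against \<open>X\<close> and \<open>Y\<close>, the engine of Morrey's sum. The
  bound is \<open>8 * Q\<close> for the radial factor times the radius
  \<open>1 / sqrt Q\<close>.\<close>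

lemma bump_telescope:
  assumes Q: "Q > 0"
  obtains X X1 X2 Y Y1 Y2 where
    "test_fun X X1 X2 (cball 0 (1 / sqrt Q))" "test_fun Y Y1 Y2 (cball 0 (1 / sqrt Q))"
    "\<And>w. bump (4 * Q) w - bump Q w = X1 w + Y2 w"
    "\<And>w. \<bar>X w\<bar> \<le> 8 * sqrt Q" "\<And>w. \<bar>Y w\<bar> \<le> 8 * sqrt Q"
proof -
  define g where "g w = (1/2) * (4 * Q * rprof (4 * Q * (cmod w)\<^sup>2) - Q * rprof (Q * (cmod w)\<^sup>2))" for w
  define d where "d w = (1/2) * ((4 * Q)\<^sup>2 * rprof' (4 * Q * (cmod w)\<^sup>2) - Q\<^sup>2 * rprof' (Q * (cmod w)\<^sup>2))" for w
  have hn: "has_partials (\<lambda>w. c * (cmod w)\<^sup>2) (\<lambda>w. c * (2 * Re w)) (\<lambda>w. c * (2 * Im w)) w" for c w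
    using has_partials_mult[OF has_partials_const[of c] has_partials_norm_sq[of 0], of w] by simp
  have hr: "has_partials (\<lambda>w. rprof (c * (cmod w)\<^sup>2)) (\<lambda>v. rprof' (c * (cmod w)\<^sup>2) * (c * (2 * Re v)))
      (\<lambda>v. rprof' (c * (cmod w)\<^sup>2) * (c * (2 * Im v))) w" for c w
    by (rule has_partials_real_chain[OF rprof_has_real_derivative hn])
  have hg: "has_partials g (\<lambda>w. d w * (2 * Re w)) (\<lambda>w. d w * (2 * Im w)) w" for w
    using has_partials_mult[OF has_partials_const[of "1/2"] has_partials_diff[OF
        has_partials_mult[OF has_partials_const[of "4*Q"] hr[of "4*Q"]] has_partials_mult[OF has_partials_const[of Q] hr[of Q]]], of w]
    unfolding has_partials_def g_def[abs_def] d_def by (simp add: algebra_simps power2_eq_square)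
  have hX: "has_partials (\<lambda>w. g w * Re w) (\<lambda>w. d w * (2 * Re w) * Re w + g w) (\<lambda>w. d w * (2 * Im w) * Re w) w" for w
    using has_partials_mult[OF hg has_partials_Re_diff[of 0], of w] by simp
  have hY: "has_partials (\<lambda>w. g w * Im w) (\<lambda>w. d w * (2 * Re w) * Im w) (\<lambda>w. d w * (2 * Im w) * Im w + g w) w" for w
    using has_partials_mult[OF hg has_partials_Im_diff[of 0], of w] by simp
  have cr: "continuous_on UNIV (\<lambda>w. rprof' (c * (cmod w)\<^sup>2))" for c
    by (rule continuous_on_compose2[OF continuous_on_rprof']) (auto intro!: continuous_intros)
  have cd: "continuous_on UNIV d" unfolding d_def by (intro continuous_intros cr)
  have cg: "continuous_on UNIV g"
    by (intro continuous_at_imp_continuous_on ballI has_partials_imp_continuous[OF hg])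
  have g0: "g w = 0" if "cmod w \<ge> 1 / sqrt Q" for w
  proof -
    have "(1 / sqrt Q)\<^sup>2 \<le> (cmod w)\<^sup>2" using Q that by (intro power_mono) auto
    then have "1 \<le> Q * (cmod w)\<^sup>2" using Q by (simp add: power_divide divide_le_eq mult.commute)
    then show ?thesis using Q by (auto simp: g_def rprof_def field_simps)
  qed
  have gb: "\<bar>g w\<bar> \<le> 8 * Q" for w
  proof -
    let ?A = "rprof (4 * Q * (cmod w)\<^sup>2)" and ?B = "rprof (Q * (cmod w)\<^sup>2)"
    have "0 \<le> ?A" "?A \<le> 4" "0 \<le> ?B" "?B \<le> 4"
      using rprof_bounds[of "4 * Q * (cmod w)\<^sup>2"] rprof_bounds[of "Q * (cmod w)\<^sup>2"] Q by auto
    then have "\<bar>2 * ?A - ?B / 2\<bar> \<le> 8" by linarith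
    then have "Q * \<bar>2 * ?A - ?B / 2\<bar> \<le> Q * 8" using Q by (intro mult_left_mono) auto
    moreover have "g w = Q * (2 * ?A - ?B / 2)" by (simp add: g_def algebra_simps)
    ultimately show ?thesis using Q by (simp add: abs_mult)
  qed
  have bd: "\<bar>g w * t\<bar> \<le> 8 * sqrt Q" if "\<bar>t\<bar> \<le> cmod w" for w t
  proof (cases "cmod w \<ge> 1 / sqrt Q")
    case False
    then have "\<bar>g w * t\<bar> \<le> (8 * Q) * (1 / sqrt Q)"
      unfolding abs_mult using gb[of w] that Q by (intro mult_mono) auto
    also have "\<dots> = 8 * (Q / sqrt Q)" by simp
    also have "\<dots> = 8 * sqrt Q" using Q by (subst real_div_sqrt) auto
    finally show ?thesis .
  qed (use g0[of w] Q in simp)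
  have id: "bump (4 * Q) w - bump Q w = (d w * (2 * Re w) * Re w + g w) + (d w * (2 * Im w) * Im w + g w)" for w
  proof -
    have "(d w * (2 * Re w) * Re w + g w) + (d w * (2 * Im w) * Im w + g w) = 2 * g w + 2 * (cmod w)\<^sup>2 * d w"
      by (simp only: cmod_power2) (simp add: power2_eq_square algebra_simps)
    also have "\<dots> = (4 * Q / 2) * (2 * rprof (4 * Q * (cmod w)\<^sup>2) + 2 * (4 * Q * (cmod w)\<^sup>2) * rprof' (4 * Q * (cmod w)\<^sup>2))
       - (Q / 2) * (2 * rprof (Q * (cmod w)\<^sup>2) + 2 * (Q * (cmod w)\<^sup>2) * rprof' (Q * (cmod w)\<^sup>2))"
      unfolding g_def d_def by (simp add: algebra_simps power2_eq_square)
    also have "\<dots> = bump (4 * Q) w - bump Q w" unfolding rprof_identity bump_def by simp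
    finally show ?thesis by simp
  qed
  show ?thesis
  proof (rule that[of "\<lambda>w. g w * Re w" "\<lambda>w. d w * (2 * Re w) * Re w + g w" "\<lambda>w. d w * (2 * Im w) * Re w"
        "\<lambda>w. g w * Im w" "\<lambda>w. d w * (2 * Re w) * Im w" "\<lambda>w. d w * (2 * Im w) * Im w + g w"])
    show "test_fun (\<lambda>w. g w * Re w) (\<lambda>w. d w * (2 * Re w) * Re w + g w) (\<lambda>w. d w * (2 * Im w) * Re w) (cball 0 (1 / sqrt Q))"
      "test_fun (\<lambda>w. g w * Im w) (\<lambda>w. d w * (2 * Re w) * Im w) (\<lambda>w. d w * (2 * Im w) * Im w + g w) (cball 0 (1 / sqrt Q))"
      unfolding test_fun_def using hX hY g0 by (auto intro!: continuous_intros cd cg)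
  qed (rule id bd abs_Re_le_cmod abs_Im_le_cmod)+
qed

definition bump_mass :: real where "bump_mass = (LINT w|lborel. bump 1 w)"

text \<open>Quadrupling \<open>Q\<close> halves the radius \<open>1 / sqrt Q\<close>, so
  \<open>moll n\<close> lives on the disk of radius \<open>(1/2) ^ n\<close> and
  \<open>moll_telescope\<close> links consecutive dyadic scales.\<close>

definition moll :: "nat \<Rightarrow> complex \<Rightarrow> real" where "moll n w = bump (4 ^ n) w / bump_mass"

lemma sqrt_four_power: "sqrt (4 ^ n) = 2 ^ n"
  by (metis power_mult mult.commute power2_eq_square num_double numeral_times_numeral real_sqrt_abs power_even_abs_numeral real_sqrt_power real_sqrt_four)

lemma bump_nonneg: "Q > 0 \<Longrightarrow> bump Q w \<ge> 0"
  by (simp add: bump_def)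

lemma bump_integrable: "Q > 0 \<Longrightarrow> integrable lborel (bump Q)"
  using continuous_compact_support_integrable[OF test_funD(5,2,6)[OF test_fun_bump(1)]] by blast

text \<open>Consecutive bumps differ by the divergence of a compactly supported field, whose
  integral vanishes, so the mass is the same at every scale.\<close>

lemma integral_bump: "(LINT w|lborel. bump (4 ^ n) w) = bump_mass"
proof (induction n)
  case 0 then show ?case by (simp add: bump_mass_def)
next
  case (Suc n)
  obtain X X1 X2 Y Y1 Y2 where XY:
    "test_fun X X1 X2 (cball 0 (1 / sqrt (4^n)))" "test_fun Y Y1 Y2 (cball 0 (1 / sqrt (4^n)))"
    "\<And>w. bump (4 * 4^n) w - bump (4^n) w = X1 w + Y2 w"
    using bump_telescope[of "4^n"] by (metis zero_less_numeral zero_less_power)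
  have "(LINT w|lborel. bump (4 * 4^n) w) - (LINT w|lborel. bump (4^n) w) = (LINT w|lborel. bump (4 * 4^n) w - bump (4^n) w)"
    by (subst Bochner_Integration.integral_diff) (auto intro!: bump_integrable)
  also have "\<dots> = (LINT w|lborel. X1 w) + (LINT w|lborel. Y2 w)"
    unfolding XY(3) using continuous_compact_support_integrable[OF test_funD(5,3,7)[OF XY(1)]]
      continuous_compact_support_integrable[OF test_funD(5,4,8)[OF XY(2)]]
    by (subst Bochner_Integration.integral_add) auto
  also have "\<dots> = 0" using integral_test_fun_partials[OF XY(1)] integral_test_fun_partials[OF XY(2)] by simp
  finally show ?case using Suc by simp
qed

lemma bump_mass_pos: "bump_mass > 0"
proof -
  have "bump_mass \<noteq> 0"
  proof
    assume "bump_mass = 0"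
    then have "AE w in lborel. bump 1 w = 0"
      unfolding bump_mass_def using integral_nonneg_eq_0_iff_AE[OF bump_integrable[of 1]] bump_nonneg[of 1] by auto
    then have "AE w in lborel. w \<notin> ball (0::complex) 1"
    proof eventually_elim
      case (elim w)
      then have "1 - (cmod w)\<^sup>2 \<le> 0" by (auto simp: bump_def max_def split: if_splits)
      then show "w \<notin> ball 0 1" using abs_square_less_1[of "cmod w"] by auto
    qed
    then have "ball (0::complex) 1 \<in> null_sets lborel" by (subst AE_iff_null_sets) auto
    then have "negligible (ball (0::complex) 1)"
      by (simp add: negligible_iff_null_sets null_sets_completionI)
    then show False using open_not_negligible[of "ball (0::complex) 1"] by simp
  qed
  moreover have "bump_mass \<ge> 0" unfolding bump_mass_def by (intro integral_nonneg_AE) (auto simp: bump_nonneg)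
  ultimately show ?thesis by simp
qed

section \<open>Mollification\<close>

definition moll_x :: "nat \<Rightarrow> complex \<Rightarrow> real" where "moll_x n w = bump_x (4 ^ n) w / bump_mass"
definition moll_y :: "nat \<Rightarrow> complex \<Rightarrow> real" where "moll_y n w = bump_y (4 ^ n) w / bump_mass"
definition moll_xx :: "nat \<Rightarrow> complex \<Rightarrow> real" where "moll_xx n w = bump_xx (4 ^ n) w / bump_mass"
definition moll_xy :: "nat \<Rightarrow> complex \<Rightarrow> real" where "moll_xy n w = bump_xy (4 ^ n) w / bump_mass"
definition moll_yy :: "nat \<Rightarrow> complex \<Rightarrow> real" where "moll_yy n w = bump_yy (4 ^ n) w / bump_mass"

lemma test_fun_divide:
  fixes u :: "complex \<Rightarrow> real"
  assumes T: "test_fun u u1 u2 S"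
  shows "test_fun (\<lambda>z. u z / c) (\<lambda>z. u1 z / c) (\<lambda>z. u2 z / c) S"
  unfolding test_fun_def
proof (intro conjI allI impI)
  show "has_partials (\<lambda>z. u z / c) (\<lambda>z. u1 z / c) (\<lambda>z. u2 z / c) z" for z
    by (rule has_partials_bounded_linear[OF bounded_linear_divide test_funD(1)[OF T]])
qed (use test_funD[OF T] in \<open>auto intro!: continuous_intros simp: divide_inverse\<close>)

lemma inverse_sqrt_four_power: "1 / sqrt (4 ^ n) = (1/2) ^ n"
  by (simp add: sqrt_four_power power_one_over)

lemma test_fun_moll:
  "test_fun (moll n) (moll_x n) (moll_y n) (cball 0 ((1/2) ^ n))"
  "test_fun (moll_x n) (moll_xx n) (moll_xy n) (cball 0 ((1/2) ^ n))"
  "test_fun (moll_y n) (moll_xy n) (moll_yy n) (cball 0 ((1/2) ^ n))"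
  using test_fun_divide[OF test_fun_bump(1)[of "4^n"]] test_fun_divide[OF test_fun_bump(2)[of "4^n"]]
    test_fun_divide[OF test_fun_bump(3)[of "4^n"]]
  unfolding moll_def[abs_def] moll_x_def[abs_def] moll_y_def[abs_def] moll_xx_def[abs_def]
    moll_xy_def[abs_def] moll_yy_def[abs_def] inverse_sqrt_four_power by auto

lemma moll_nonneg: "moll n w \<ge> 0"
  unfolding moll_def using bump_nonneg[of "4^n" w] bump_mass_pos by simp

lemma moll_le: "moll n w \<le> 4 * 4 ^ n / bump_mass"
proof -
  have "(max 0 (1 - 4^n * (cmod w)\<^sup>2)) ^ 3 \<le> (1::real)"
    by (rule power_le_one) auto
  then have "bump (4^n) w \<le> 4 * 4 ^ n" unfolding bump_def by simp
  then show ?thesis unfolding moll_def using bump_mass_pos by (intro divide_right_mono) auto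
qed

lemma moll_outside: "cmod w \<ge> (1/2) ^ n \<Longrightarrow> moll n w = 0"
  unfolding moll_def bump_def using bump_outside[of "4^n" w] inverse_sqrt_four_power[of n] by simp

lemma moll_integrable: "integrable lborel (\<lambda>\<zeta>. moll n (\<zeta> - z))"
  using continuous_compact_support_integrable[OF test_funD(5,2,6)[OF test_fun_translate[OF test_fun_moll(1)]]] .

lemma moll_integral: "(LINT \<zeta>|lborel. moll n (\<zeta> - z)) = 1"
proof -
  have "(LINT \<zeta>|lborel. moll n (\<zeta> - z)) = (LINT \<zeta>|lborel. moll n \<zeta>)"
    using lborel_integral_shift(1)[of "moll n" "- z"] by (simp add: add.commute)
  also have "\<dots> = 1"
    unfolding moll_def using integral_bump[of n] bump_mass_pos by simp
  finally show ?thesis .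
qed

lemma moll_sym: "moll n (z - w) = moll n (w - z)"
  by (simp add: moll_def bump_def norm_minus_commute)

lemma moll_telescope:
  obtains X X1 X2 Y Y1 Y2 where
    "test_fun X X1 X2 (cball 0 ((1/2) ^ n))" "test_fun Y Y1 Y2 (cball 0 ((1/2) ^ n))"
    "\<And>w. moll (Suc n) w - moll n w = X1 w + Y2 w"
    "\<And>w. \<bar>X w\<bar> \<le> 8 * 2 ^ n / bump_mass" "\<And>w. \<bar>Y w\<bar> \<le> 8 * 2 ^ n / bump_mass"
proof -
  have "(0::real) < 4 ^ n" by simp
  then obtain X X1 X2 Y Y1 Y2 where XY:
    "test_fun X X1 X2 (cball 0 (1 / sqrt (4^n)))" "test_fun Y Y1 Y2 (cball 0 (1 / sqrt (4^n)))"
    "\<And>w. bump (4 * 4^n) w - bump (4^n) w = X1 w + Y2 w"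
    "\<And>w. \<bar>X w\<bar> \<le> 8 * sqrt (4^n)" "\<And>w. \<bar>Y w\<bar> \<le> 8 * sqrt (4^n)"
    by (rule bump_telescope) blast
  show ?thesis
  proof (rule that[OF test_fun_divide[OF XY(1)[unfolded inverse_sqrt_four_power]] test_fun_divide[OF XY(2)[unfolded inverse_sqrt_four_power]]])
    show "moll (Suc n) w - moll n w = X1 w / bump_mass + Y2 w / bump_mass" for w
      using XY(3)[of w] by (simp add: moll_def add_divide_distrib[symmetric] diff_divide_distrib[symmetric])
    show "\<bar>X w / bump_mass\<bar> \<le> 8 * 2 ^ n / bump_mass" "\<bar>Y w / bump_mass\<bar> \<le> 8 * 2 ^ n / bump_mass" for w
      using XY(4,5)[of w] bump_mass_pos by (auto simp: sqrt_four_power abs_divide intro!: divide_right_mono)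
  qed
qed

text \<open>The kernel is translated but not reflected, so
  \<open>\<zeta> \<mapsto> k (\<zeta> - z)\<close> is a translate of \<open>k\<close> and can serve
  as a test function in weak identities. The resulting sign in \<open>has_partials_mconv\<close>
  cancels that of the weak derivative; for the even kernel \<open>moll n\<close> this is ordinary
  convolution.\<close>

definition mconv :: "(complex \<Rightarrow> real) \<Rightarrow> (complex \<Rightarrow> 'a::{banach,second_countable_topology}) \<Rightarrow> complex \<Rightarrow> 'a" where
  "mconv k h z = (LINT \<zeta>|lborel. k (\<zeta> - z) *\<^sub>R h \<zeta>)"

lemma integrable_bounded_scaleR:
  fixes k :: "complex \<Rightarrow> real" and h :: "complex \<Rightarrow> 'a::{banach,second_countable_topology}"
  assumes "k \<in> borel_measurable borel" "\<And>z. \<bar>k z\<bar> \<le> B" "integrable lborel h"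
  shows "integrable lborel (\<lambda>z. k z *\<^sub>R h z)"
proof (rule Bochner_Integration.integrable_bound[where f = "\<lambda>z. B *\<^sub>R norm (h z)"])
  show "integrable lborel (\<lambda>z. B *\<^sub>R norm (h z))" using assms(3) by simp
  show "AE z in lborel. norm (k z *\<^sub>R h z) \<le> norm (B *\<^sub>R norm (h z))"
    using assms(2) by (intro AE_I2) (auto simp: abs_mult intro!: mult_right_mono order_trans[OF assms(2)])
  show "(\<lambda>z. k z *\<^sub>R h z) \<in> borel_measurable lborel" using assms(1,3) by measurable
qed

lemma mconv_integrable:
  fixes h :: "complex \<Rightarrow> 'a::{banach,second_countable_topology}"
  assumes "compact S" "continuous_on UNIV k" "\<And>z. z \<notin> S \<Longrightarrow> k z = 0" "integrable lborel h"
  shows "integrable lborel (\<lambda>\<zeta>. k (\<zeta> - z) *\<^sub>R h \<zeta>)"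
proof -
  obtain B where "\<And>z. norm (k z) \<le> B"
    using continuous_compact_support_bounded[OF assms(1) continuous_on_subset[OF assms(2)] assms(3)] by blast
  moreover have "(\<lambda>\<zeta>. k (\<zeta> - z)) \<in> borel_measurable borel"
    by (intro borel_measurable_continuous_onI continuous_on_compose2[OF assms(2)]) (auto intro!: continuous_intros)
  ultimately show ?thesis by (intro integrable_bounded_scaleR[where B=B] assms) auto
qed

lemma continuous_on_mconv:
  fixes h :: "complex \<Rightarrow> 'a::{banach,second_countable_topology}"
  assumes k: "compact S" "continuous_on UNIV k" "\<And>z. z \<notin> S \<Longrightarrow> k z = 0" and h: "integrable lborel h"
  shows "continuous_on A (mconv k h)"
proof -
  let ?I = "LINT \<zeta>|lborel. norm (h \<zeta>)"
  have I0: "?I \<ge> 0" by simp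
  have "\<exists>d>0. \<forall>w. dist w z < d \<longrightarrow> dist (mconv k h w) (mconv k h z) < e" if e: "e > 0" for e z
  proof -
    have "e / (?I + 1) > 0" using e I0 by (intro divide_pos_pos add_nonneg_pos) auto
    then obtain d where d: "d > 0" "\<And>z w. dist z w < d \<Longrightarrow> dist (k z) (k w) < e / (?I + 1)"
      using continuous_compact_support_uniformly[OF k] by metis
    have "dist (mconv k h w) (mconv k h z) < e" if w: "dist w z < d" for w
    proof -
      have "mconv k h w - mconv k h z = (LINT \<zeta>|lborel. (k (\<zeta> - w) - k (\<zeta> - z)) *\<^sub>R h \<zeta>)"
        unfolding mconv_def by (subst Bochner_Integration.integral_diff[symmetric]) (auto intro!: mconv_integrable[OF k h] simp: scaleR_diff_left)
      also have "norm \<dots> \<le> (LINT \<zeta>|lborel. norm ((k (\<zeta> - w) - k (\<zeta> - z)) *\<^sub>R h \<zeta>))"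
        by (rule integral_norm_bound)
      also have "\<dots> \<le> (LINT \<zeta>|lborel. e / (?I + 1) * norm (h \<zeta>))"
      proof (rule integral_mono_AE)
        show "integrable lborel (\<lambda>\<zeta>. norm ((k (\<zeta> - w) - k (\<zeta> - z)) *\<^sub>R h \<zeta>))"
          unfolding scaleR_diff_left by (intro integrable_norm Bochner_Integration.integrable_diff mconv_integrable[OF k h])
        show "AE \<zeta> in lborel. norm ((k (\<zeta> - w) - k (\<zeta> - z)) *\<^sub>R h \<zeta>) \<le> e / (?I + 1) * norm (h \<zeta>)"
        proof (rule AE_I2)
          fix \<zeta>
          have "dist (k (\<zeta> - w)) (k (\<zeta> - z)) < e / (?I + 1)"
            using w by (intro d) (simp add: dist_norm norm_minus_commute)
          then show "norm ((k (\<zeta> - w) - k (\<zeta> - z)) *\<^sub>R h \<zeta>) \<le> e / (?I + 1) * norm (h \<zeta>)"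
            unfolding norm_scaleR by (intro mult_right_mono) (auto simp: dist_norm)
        qed
      qed (use h in simp)
      also have "\<dots> = e * (?I / (?I + 1))" by simp
      also have "\<dots> < e * 1"
      proof (rule mult_strict_left_mono[OF _ e])
        have "I / (I + 1) < 1" if "I \<ge> 0" for I :: real using that by simp
        then show "?I / (?I + 1) < 1" using I0 .
      qed
      finally show ?thesis by (simp only: dist_norm mult_1_right)
    qed
    then show ?thesis using d(1) by auto
  qed
  then have "continuous_on UNIV (mconv k h)" unfolding continuous_on_iff by auto
  then show ?thesis by (rule continuous_on_subset) auto
qed

text \<open>Uniform continuity of the partial derivatives makes the Taylor remainder uniform in
  \<open>w\<close>. This is what lets \<open>has_partials_mconv\<close> differentiate under an
  integral against a merely integrable \<open>h\<close>.\<close>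

lemma test_fun_uniformly_differentiable:
  fixes u :: "complex \<Rightarrow> 'a::real_normed_vector"
  assumes T: "test_fun u u1 u2 S" and e: "e > 0"
  obtains d where "d > 0" "\<And>w h. cmod h < d \<Longrightarrow> norm (u (w + h) - u w - (Re h *\<^sub>R u1 w + Im h *\<^sub>R u2 w)) \<le> e * cmod h"
proof -
  note td = test_funD[OF T]
  obtain d1 where d1: "d1 > 0" "\<And>z w. dist z w < d1 \<Longrightarrow> dist (u1 z) (u1 w) < e/2"
    using continuous_compact_support_uniformly[OF td(5) td(3) td(7), of "e/2"] e by (metis half_gt_zero)
  obtain d2 where d2: "d2 > 0" "\<And>z w. dist z w < d2 \<Longrightarrow> dist (u2 z) (u2 w) < e/2"
    using continuous_compact_support_uniformly[OF td(5) td(4) td(8), of "e/2"] e by (metis half_gt_zero)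
  show ?thesis
  proof (rule that[of "min d1 d2"])
    fix w h assume h: "cmod h < min d1 d2"
    let ?g = "\<lambda>z. u z - (Re z *\<^sub>R u1 w + Im z *\<^sub>R u2 w)"
    have "norm (?g (w + h) - ?g w) \<le> e * norm (w + h - w)"
    proof (rule differentiable_bound[of "ball w (min d1 d2)" ?g "\<lambda>z h. (Re h *\<^sub>R u1 z + Im h *\<^sub>R u2 z) - (Re h *\<^sub>R u1 w + Im h *\<^sub>R u2 w)"])
      fix z assume z: "z \<in> ball w (min d1 d2)"
      have "(?g has_derivative (\<lambda>h. (Re h *\<^sub>R u1 z + Im h *\<^sub>R u2 z) - (Re h *\<^sub>R u1 w + Im h *\<^sub>R u2 w))) (at z)"
        by (intro has_derivative_diff td(1)[unfolded has_partials_def]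
            bounded_linear_imp_has_derivative partials_bounded_linear)
      then show "(?g has_derivative (\<lambda>h. (Re h *\<^sub>R u1 z + Im h *\<^sub>R u2 z) - (Re h *\<^sub>R u1 w + Im h *\<^sub>R u2 w))) (at z within ball w (min d1 d2))"
        by (rule has_derivative_at_withinI)
      show "onorm (\<lambda>h. (Re h *\<^sub>R u1 z + Im h *\<^sub>R u2 z) - (Re h *\<^sub>R u1 w + Im h *\<^sub>R u2 w)) \<le> e"
      proof (rule onorm_bound)
        fix h
        have "(Re h *\<^sub>R u1 z + Im h *\<^sub>R u2 z) - (Re h *\<^sub>R u1 w + Im h *\<^sub>R u2 w) = Re h *\<^sub>R (u1 z - u1 w) + Im h *\<^sub>R (u2 z - u2 w)"
          by (simp add: algebra_simps)
        also have "norm \<dots> \<le> \<bar>Re h\<bar> * norm (u1 z - u1 w) + \<bar>Im h\<bar> * norm (u2 z - u2 w)"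
          by (metis norm_scaleR norm_triangle_ineq)
        also have "\<dots> \<le> cmod h * (e/2) + cmod h * (e/2)"
          using d1(2)[of z w] d2(2)[of z w] z
          by (intro add_mono mult_mono abs_Re_le_cmod abs_Im_le_cmod) (auto simp: dist_norm norm_minus_commute)
        finally show "norm ((Re h *\<^sub>R u1 z + Im h *\<^sub>R u2 z) - (Re h *\<^sub>R u1 w + Im h *\<^sub>R u2 w)) \<le> e * norm h" by simp
      qed (use e in auto)
    qed (use h d1 d2 in \<open>auto simp: dist_norm\<close>)
    then show "norm (u (w + h) - u w - (Re h *\<^sub>R u1 w + Im h *\<^sub>R u2 w)) \<le> e * cmod h"
      by (simp add: algebra_simps)
  qed (use d1 d2 in auto)
qed

lemma has_partials_mconv:
  fixes h :: "complex \<Rightarrow> 'a::{banach,second_countable_topology}"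
  assumes T: "test_fun k k1 k2 S" and h: "integrable lborel h"
  shows "has_partials (mconv k h) (\<lambda>z. - mconv k1 h z) (\<lambda>z. - mconv k2 h z) z"
proof -
  note td = test_funD[OF T]
  note i0 = mconv_integrable[OF td(5) td(2) td(6) h]
  note i1 = mconv_integrable[OF td(5) td(3) td(7) h]
  note i2 = mconv_integrable[OF td(5) td(4) td(8) h]
  let ?I = "LINT \<zeta>|lborel. norm (h \<zeta>)"
  let ?L = "\<lambda>y. Re y *\<^sub>R - mconv k1 h z + Im y *\<^sub>R - mconv k2 h z"
  have I0: "?I \<ge> 0" by simp
  show ?thesis
    unfolding has_partials_def has_derivative_at_alt
  proof (intro conjI allI impI partials_bounded_linear)
    fix e :: real assume e: "e > 0"
    have "e / (?I + 1) > 0" using e I0 by (intro divide_pos_pos add_nonneg_pos) auto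
    then obtain d where d: "d > 0" "\<And>w y. cmod y < d \<Longrightarrow> norm (k (w + y) - k w - (Re y *\<^sub>R k1 w + Im y *\<^sub>R k2 w)) \<le> e / (?I + 1) * cmod y"
      using test_fun_uniformly_differentiable[OF T] by metis
    have "norm (mconv k h w - mconv k h z - ?L (w - z)) \<le> e * norm (w - z)" if w: "norm (w - z) < d" for w
    proof -
      define y where "y = z - w"
      have y: "cmod y < d" "norm (w - z) = cmod y" using w by (auto simp: y_def norm_minus_commute)
      define r where "r \<zeta> = k (\<zeta> - z + y) - k (\<zeta> - z) - (Re y *\<^sub>R k1 (\<zeta> - z) + Im y *\<^sub>R k2 (\<zeta> - z))" for \<zeta>
      have split: "r \<zeta> *\<^sub>R h \<zeta> = k (\<zeta> - w) *\<^sub>R h \<zeta> - k (\<zeta> - z) *\<^sub>R h \<zeta> - (Re y *\<^sub>R (k1 (\<zeta> - z) *\<^sub>R h \<zeta>) + Im y *\<^sub>R (k2 (\<zeta> - z) *\<^sub>R h \<zeta>))" for \<zeta>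
        by (simp add: r_def y_def scaleR_diff_left scaleR_add_left)
      have ir: "integrable lborel (\<lambda>\<zeta>. r \<zeta> *\<^sub>R h \<zeta>)"
        unfolding split by (intro Bochner_Integration.integrable_diff Bochner_Integration.integrable_add integrable_scaleR_right i0 i1 i2)
      have eq: "mconv k h w - mconv k h z - ?L (w - z) = (LINT \<zeta>|lborel. r \<zeta> *\<^sub>R h \<zeta>)"
        unfolding split mconv_def using i0 i1 i2
        by (simp add: Bochner_Integration.integral_diff Bochner_Integration.integral_add y_def scaleR_diff_left
            del: scaleR_scaleR)
      have "norm (LINT \<zeta>|lborel. r \<zeta> *\<^sub>R h \<zeta>) \<le> (LINT \<zeta>|lborel. norm (r \<zeta> *\<^sub>R h \<zeta>))" by (rule integral_norm_bound)
      also have "\<dots> \<le> (LINT \<zeta>|lborel. (e / (?I + 1) * cmod y) * norm (h \<zeta>))"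
      proof (rule integral_mono_AE)
        show "integrable lborel (\<lambda>\<zeta>. norm (r \<zeta> *\<^sub>R h \<zeta>))" using ir by (rule integrable_norm)
        show "AE \<zeta> in lborel. norm (r \<zeta> *\<^sub>R h \<zeta>) \<le> (e / (?I + 1) * cmod y) * norm (h \<zeta>)"
        proof (rule AE_I2)
          fix \<zeta> show "norm (r \<zeta> *\<^sub>R h \<zeta>) \<le> (e / (?I + 1) * cmod y) * norm (h \<zeta>)"
            unfolding norm_scaleR r_def using d(2)[OF y(1), of "\<zeta> - z"] by (intro mult_right_mono) auto
        qed
      qed (use h in simp)
      also have "\<dots> = (e * cmod y) * (?I / (?I + 1))" by simp
      also have "\<dots> \<le> (e * cmod y) * 1"
      proof (rule mult_left_mono)
        have "I / (I + 1) \<le> 1" if "I \<ge> 0" for I :: real using that by simp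
        then show "?I / (?I + 1) \<le> 1" using I0 .
      qed (use e in auto)
      finally show ?thesis unfolding eq y(2) by simp
    qed
    then show "\<exists>d>0. \<forall>w. norm (w - z) < d \<longrightarrow> norm (mconv k h w - mconv k h z - ?L (w - z)) \<le> e * norm (w - z)"
      using d(1) by blast
  qed
qed

text \<open>Fubini, with the inner integral of \<open>moll n (\<zeta> - z)\<close> over
  \<open>z\<close> equal to \<open>1\<close>. Applied to a squared norm it makes the bilinear bounds
  below uniform in \<open>n\<close>.\<close>

lemma mconv_moll_integral:
  fixes q :: "complex \<Rightarrow> 'a::{banach,second_countable_topology}"
  assumes q: "integrable lborel q"
  shows "integrable lborel (mconv (moll n) q)" "(LINT z|lborel. mconv (moll n) q z) = (LINT z|lborel. q z)"
proof -
  let ?f = "\<lambda>(\<zeta>, z). moll n (\<zeta> - z) *\<^sub>R q \<zeta>"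
  have [measurable]: "moll n \<in> borel_measurable borel"
    by (intro borel_measurable_continuous_onI test_funD[OF test_fun_moll(1)])
  have [measurable]: "q \<in> borel_measurable borel" using q by auto
  have mi: "integrable lborel (\<lambda>z. moll n (\<zeta> - z))" "(LINT z|lborel. moll n (\<zeta> - z)) = 1" for \<zeta>
    using moll_integrable[of n \<zeta>] moll_integral[of n \<zeta>] by (simp_all add: moll_sym[of n _ \<zeta>])
  have int: "integrable (lborel \<Otimes>\<^sub>M lborel) ?f"
  proof (rule lborel_pair.Fubini_integrable)
    have "(LINT z|lborel. norm (?f (\<zeta>, z))) = norm (q \<zeta>)" for \<zeta>
      using mi[of \<zeta>] moll_nonneg[of n] by (simp add: abs_of_nonneg)
    then show "integrable lborel (\<lambda>\<zeta>. LINT z|lborel. norm (?f (\<zeta>, z)))" using q by (simp only: integrable_norm)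
    show "AE \<zeta> in lborel. integrable lborel (\<lambda>z. ?f (\<zeta>, z))"
      using mi by (intro AE_I2) simp
  qed measurable
  have "integrable lborel (\<lambda>z. LINT \<zeta>|lborel. moll n (\<zeta> - z) *\<^sub>R q \<zeta>)"
    using lborel_pair.integrable_snd[OF int] by simp
  then show "integrable lborel (mconv (moll n) q)" by (simp add: mconv_def[abs_def])
  have "(LINT z|lborel. LINT \<zeta>|lborel. moll n (\<zeta> - z) *\<^sub>R q \<zeta>) = (LINT \<zeta>|lborel. LINT z|lborel. moll n (\<zeta> - z) *\<^sub>R q \<zeta>)"
    using lborel_pair.Fubini_integral[OF int] by simp
  also have "\<dots> = (LINT \<zeta>|lborel. q \<zeta>)" using mi by simp
  finally show "(LINT z|lborel. mconv (moll n) q z) = (LINT z|lborel. q z)" by (simp add: mconv_def)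
qed

section \<open>Square-integrable functions of compact support, their approximation and weak
  limits\<close>

definition compact_L2 :: "real \<Rightarrow> (complex \<Rightarrow> 'a::{real_normed_vector,second_countable_topology}) \<Rightarrow> bool" where
  "compact_L2 r h \<longleftrightarrow> h \<in> borel_measurable borel \<and> integrable lborel (\<lambda>z. (norm (h z))\<^sup>2) \<and>
     (\<forall>z. z \<notin> cball 0 r \<longrightarrow> h z = 0)"

lemma integrable_indicator_cball: "integrable lborel (\<lambda>z. indicator (cball (a::complex) r) z :: real)"
  by (rule continuous_compact_support_integrable[of "cball a r"])
     (auto intro!: continuous_on_eq[OF continuous_on_const[of _ 1]])

lemma compact_L2_integrable:
  fixes h :: "complex \<Rightarrow> 'a::{banach,second_countable_topology}"
  assumes "compact_L2 r h"
  shows "integrable lborel h"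
proof (rule Bochner_Integration.integrable_bound[where f = "\<lambda>z. indicator (cball 0 r) z + (norm (h z))\<^sup>2"])
  show "integrable lborel (\<lambda>z. indicator (cball 0 r) z + (norm (h z))\<^sup>2)"
    using assms by (auto simp: compact_L2_def intro!: integrable_indicator_cball)
  show "h \<in> borel_measurable lborel" using assms by (simp add: compact_L2_def)
  show "AE z in lborel. norm (h z) \<le> norm (indicator (cball 0 r) z + (norm (h z))\<^sup>2)"
  proof (rule AE_I2)
    fix z
    have "norm (h z) \<le> 1 + (norm (h z))\<^sup>2"
      using zero_le_power2[of "norm (h z) - 1"] norm_ge_zero[of "h z"]
      unfolding power2_diff power_one mult_1_right by linarith
    then show "norm (h z) \<le> norm (indicator (cball 0 r) z + (norm (h z))\<^sup>2)"
      using assms by (cases "z \<in> cball 0 r") (auto simp: compact_L2_def)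
  qed
qed

lemma norm_power2_diff_le:
  fixes a b :: "'a::real_normed_vector"
  shows "(norm (a - b))\<^sup>2 \<le> 2 * (norm a)\<^sup>2 + 2 * (norm b)\<^sup>2"
proof -
  have "(norm (a - b))\<^sup>2 \<le> (norm a + norm b)\<^sup>2" by (intro power_mono norm_triangle_ineq4) auto
  also have "\<dots> \<le> 2 * (norm a)\<^sup>2 + 2 * (norm b)\<^sup>2"
    using zero_le_power2[of "norm a - norm b"] unfolding power2_diff power2_sum by linarith
  finally show ?thesis .
qed

lemma L2_approx_truncation:
  fixes h :: "complex \<Rightarrow> complex"
  assumes h: "compact_L2 r h" and d: "\<delta> > 0"
  obtains N :: nat where "(LINT z|lborel. (cmod (h z - (if cmod (h z) \<le> N then h z else 0)))\<^sup>2) < \<delta>"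
proof -
  have [measurable]: "h \<in> borel_measurable borel" using h by (simp add: compact_L2_def)
  have "(\<lambda>N::nat. LINT z|lborel. (cmod (h z - (if cmod (h z) \<le> N then h z else 0)))\<^sup>2) \<longlonglongrightarrow> (LINT z|(lborel::complex measure). (0::real))"
  proof (rule integral_dominated_convergence[where w = "\<lambda>z. (cmod (h z))\<^sup>2"])
    show "integrable lborel (\<lambda>z. (cmod (h z))\<^sup>2)" using h by (simp add: compact_L2_def)
    show "AE z in lborel. (\<lambda>N::nat. (cmod (h z - (if cmod (h z) \<le> N then h z else 0)))\<^sup>2) \<longlonglongrightarrow> 0"
    proof (rule AE_I2)
      fix z
      have "\<forall>\<^sub>F N in sequentially. cmod (h z) \<le> real N"
        by (meson eventually_sequentiallyI nat_le_real_less nle_le of_nat_mono order_trans real_nat_ceiling_ge)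
      then have "\<forall>\<^sub>F N::nat in sequentially. (cmod (h z - (if cmod (h z) \<le> N then h z else 0)))\<^sup>2 = 0"
        by eventually_elim simp
      then show "(\<lambda>N::nat. (cmod (h z - (if cmod (h z) \<le> N then h z else 0)))\<^sup>2) \<longlonglongrightarrow> 0"
        by (rule tendsto_eventually)
    qed
  qed auto
  then have "\<forall>\<^sub>F N::nat in sequentially. (LINT z|lborel. (cmod (h z - (if cmod (h z) \<le> N then h z else 0)))\<^sup>2) < \<delta>"
    using d by (intro order_tendstoD(2)[of _ 0]) auto
  then obtain N :: nat where "(LINT z|lborel. (cmod (h z - (if cmod (h z) \<le> N then h z else 0)))\<^sup>2) < \<delta>"
    using eventually_happens'[OF sequentially_bot] by blast
  then show ?thesis by (rule that)
qed

text \<open>Measurability supplies continuous functions converging almost everywhere, but without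
  bounds or compact support. The nearest-point projection onto the disk of radius \<open>N\<close>
  restores the bound, the cutoff \<open>\<eta>\<close> the support, and both leave the limit
  \<open>h\<close> unchanged; dominated convergence then applies.\<close>

lemma L2_approx_bounded:
  fixes h :: "complex \<Rightarrow> complex" and N :: nat
  assumes m: "h \<in> borel_measurable borel" and b: "\<And>z. cmod (h z) \<le> N" and s: "\<And>z. z \<notin> cball 0 r \<Longrightarrow> h z = 0"
    and r: "r > 0" and d: "\<delta> > 0"
  obtains k where "continuous_on UNIV k" "\<And>z. z \<notin> cball 0 (2 * r) \<Longrightarrow> k z = 0"
    "(LINT z|lborel. (cmod (h z - k z))\<^sup>2) < \<delta>"
proof -
  note [measurable] = m
  have "h measurable_on UNIV"
    using m by (intro lebesgue_measurable_imp_measurable_on measurable_completion) auto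
  then obtain A g where A: "negligible A" and g: "\<And>n. continuous_on UNIV (g n)" and
    lim: "\<And>z. z \<notin> A \<Longrightarrow> (\<lambda>n. g n z) \<longlonglongrightarrow> h z"
    unfolding measurable_on_def by auto
  obtain \<eta> \<eta>1 \<eta>2 where \<eta>: "test_fun \<eta> \<eta>1 \<eta>2 (cball 0 (2 * r))" "\<And>z. 0 \<le> \<eta> z" "\<And>z. \<eta> z \<le> (1::real)"
    "\<And>z. z \<in> cball 0 r \<Longrightarrow> \<eta> z = 1"
    using cutoff_exists[OF r, of 0] by metis
  let ?p = "closest_point (cball (0::complex) N)"
  have cp: "continuous_on UNIV ?p" by (intro continuous_on_closest_point) auto
  have pN: "cmod (?p w) \<le> N" for w
    using closest_point_in_set[of "cball (0::complex) N" w] by simp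
  define k where "k n z = \<eta> z *\<^sub>R ?p (g n z)" for n z
  have ck: "continuous_on UNIV (k n)" for n
    unfolding k_def by (intro continuous_intros test_funD(2)[OF \<eta>(1)] continuous_on_compose2[OF cp g]) auto
  note [measurable] = borel_measurable_continuous_onI[OF ck]
  have k0: "k n z = 0" if "z \<notin> cball 0 (2 * r)" for n z
    using test_funD(6)[OF \<eta>(1) that] by (simp add: k_def)
  have kN: "cmod (k n z) \<le> N" for n z
  proof -
    have "cmod (k n z) = \<eta> z * cmod (?p (g n z))" using \<eta>(2)[of z] by (simp add: k_def)
    also have "\<dots> \<le> 1 * real N" by (intro mult_mono \<eta> pN) auto
    finally show ?thesis by simp
  qed
  have "AE z in lebesgue. z \<notin> A"
    using A by (simp add: negligible_iff_null_sets AE_not_in)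
  then have AE: "AE z in lborel. z \<notin> A" by (simp add: AE_completion_iff)
  have "(\<lambda>n. LINT z|lborel. (cmod (h z - k n z))\<^sup>2) \<longlonglongrightarrow> (LINT z|(lborel::complex measure). (0::real))"
  proof (rule integral_dominated_convergence[where w = "\<lambda>z. (2 * real N)\<^sup>2 * indicator (cball 0 (2 * r)) z"])
    show "integrable lborel (\<lambda>z::complex. (2 * real N)\<^sup>2 * indicator (cball 0 (2 * r)) z)"
      by (intro integrable_mult_right integrable_indicator_cball)
    show "AE z in lborel. (\<lambda>n. (cmod (h z - k n z))\<^sup>2) \<longlonglongrightarrow> 0"
      using AE
    proof eventually_elim
      case (elim z)
      have "(\<lambda>n. \<eta> z *\<^sub>R ?p (g n z)) \<longlonglongrightarrow> \<eta> z *\<^sub>R ?p (h z)"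
        by (intro tendsto_intros isCont_tendsto_compose[OF _ lim[OF elim]])
           (use cp in \<open>simp add: continuous_on_eq_continuous_at\<close>)
      also have "?p (h z) = h z" using b[of z] by (intro closest_point_self) auto
      also have "\<eta> z *\<^sub>R h z = h z" using \<eta>(4)[of z] s[of z] by (cases "z \<in> cball 0 r") auto
      finally have "(\<lambda>n. k n z) \<longlonglongrightarrow> h z" by (simp add: k_def)
      then have "(\<lambda>n. (cmod (h z - k n z))\<^sup>2) \<longlonglongrightarrow> (cmod (h z - h z))\<^sup>2" by (intro tendsto_intros)
      then show ?case by simp
    qed
    show "AE z in lborel. norm ((cmod (h z - k n z))\<^sup>2) \<le> (2 * real N)\<^sup>2 * indicator (cball 0 (2 * r)) z" for n
    proof (rule AE_I2)
      fix z
      show "norm ((cmod (h z - k n z))\<^sup>2) \<le> (2 * real N)\<^sup>2 * indicator (cball 0 (2 * r)) z"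
      proof (cases "z \<in> cball 0 (2 * r)")
        case True
        have "cmod (h z - k n z) \<le> 2 * real N"
          using norm_triangle_ineq4[of "h z" "k n z"] b[of z] kN[of n z] by linarith
        then show ?thesis using True power_mono[of "cmod (h z - k n z)" "2 * real N" 2] by simp
      next
        case False
        then have "h z = 0" using r by (intro s) auto
        then show ?thesis using False k0[of z n] by simp
      qed
    qed
  qed auto
  then have "\<forall>\<^sub>F n in sequentially. (LINT z|lborel. (cmod (h z - k n z))\<^sup>2) < \<delta>"
    using d by (intro order_tendstoD(2)[of _ 0]) auto
  then obtain n where "(LINT z|lborel. (cmod (h z - k n z))\<^sup>2) < \<delta>"
    using eventually_happens'[OF sequentially_bot] by blast
  then show ?thesis using that[of "k n"] ck k0 by blast
qed

lemma compact_L2_diff: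
  fixes h k :: "complex \<Rightarrow> complex"
  assumes "compact_L2 r h" "compact_L2 r k"
  shows "compact_L2 r (\<lambda>z. h z - k z)"
proof -
  have [measurable]: "h \<in> borel_measurable borel" "k \<in> borel_measurable borel" using assms by (auto simp: compact_L2_def)
  have "integrable lborel (\<lambda>z. (cmod (h z - k z))\<^sup>2)"
  proof (rule Bochner_Integration.integrable_bound[where f = "\<lambda>z. 2 * (cmod (h z))\<^sup>2 + 2 * (cmod (k z))\<^sup>2"])
    show "integrable lborel (\<lambda>z. 2 * (cmod (h z))\<^sup>2 + 2 * (cmod (k z))\<^sup>2)" using assms by (auto simp: compact_L2_def)
    show "AE z in lborel. norm ((cmod (h z - k z))\<^sup>2) \<le> norm (2 * (cmod (h z))\<^sup>2 + 2 * (cmod (k z))\<^sup>2)"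
      using norm_power2_diff_le[of "h _" "k _"] by (intro AE_I2) simp
  qed measurable
  then show ?thesis using assms by (auto simp: compact_L2_def)
qed

lemma compact_L2_continuous:
  fixes k :: "complex \<Rightarrow> 'a::{real_normed_vector,second_countable_topology}"
  assumes "continuous_on UNIV k" "\<And>z. z \<notin> cball 0 r \<Longrightarrow> k z = 0"
  shows "compact_L2 r k"
  unfolding compact_L2_def using assms
  by (auto intro!: borel_measurable_continuous_onI continuous_compact_support_integrable[of "cball 0 r"]
      continuous_intros intro: continuous_on_subset)

lemma compact_L2_mono: "compact_L2 r h \<Longrightarrow> r \<le> s \<Longrightarrow> compact_L2 s h"
  by (auto simp: compact_L2_def)

lemma L2_approx_continuous:
  fixes h :: "complex \<Rightarrow> complex"
  assumes h: "compact_L2 r h" and r: "r > 0" and d: "\<delta> > 0"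
  obtains k where "continuous_on UNIV k" "\<And>z. z \<notin> cball 0 (2 * r) \<Longrightarrow> k z = 0"
    "(LINT z|lborel. (cmod (h z - k z))\<^sup>2) < \<delta>"
proof -
  have [measurable]: "h \<in> borel_measurable borel" using h by (simp add: compact_L2_def)
  \<comment> \<open>A quarter for each of the two errors, because the squared triangle inequality
    costs a factor \<open>2\<close>.\<close>
  have "\<delta> / 4 > 0" using d by simp
  from L2_approx_truncation[OF h this] obtain N :: nat where
    N: "(LINT z|lborel. (cmod (h z - (if cmod (h z) \<le> N then h z else 0)))\<^sup>2) < \<delta> / 4" by blast
  define g where "g z = (if cmod (h z) \<le> N then h z else 0)" for z
  have [measurable]: "g \<in> borel_measurable borel" unfolding g_def by measurable
  have g: "\<And>z. cmod (g z) \<le> N" "\<And>z. z \<notin> cball 0 r \<Longrightarrow> g z = 0"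
    using h by (auto simp: g_def compact_L2_def)
  obtain k where k: "continuous_on UNIV k" "\<And>z. z \<notin> cball 0 (2 * r) \<Longrightarrow> k z = 0"
    "(LINT z|lborel. (cmod (g z - k z))\<^sup>2) < \<delta> / 4"
    using L2_approx_bounded[of g N r "\<delta>/4"] g r d by auto
  have gl: "compact_L2 r g"
  proof -
    have "integrable lborel (\<lambda>z. (cmod (g z))\<^sup>2)"
      by (rule Bochner_Integration.integrable_bound[where f = "\<lambda>z. (cmod (h z))\<^sup>2"])
         (use h in \<open>auto simp: compact_L2_def g_def\<close>)
    then show ?thesis using g by (auto simp: compact_L2_def)
  qed
  have h2: "compact_L2 (2*r) h" and g2: "compact_L2 (2*r) g" using h gl r by (auto intro: compact_L2_mono)
  have k2: "compact_L2 (2*r) k" using k by (intro compact_L2_continuous) auto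
  have i: "integrable lborel (\<lambda>z. (cmod (h z - k z))\<^sup>2)" "integrable lborel (\<lambda>z. (cmod (h z - g z))\<^sup>2)" "integrable lborel (\<lambda>z. (cmod (g z - k z))\<^sup>2)"
    using compact_L2_diff[OF h2 k2] compact_L2_diff[OF h2 g2] compact_L2_diff[OF g2 k2] by (auto simp: compact_L2_def)
  have "(LINT z|lborel. (cmod (h z - k z))\<^sup>2) \<le> (LINT z|lborel. 2 * (cmod (h z - g z))\<^sup>2 + 2 * (cmod (g z - k z))\<^sup>2)"
  proof (rule integral_mono)
    fix z show "(cmod (h z - k z))\<^sup>2 \<le> 2 * (cmod (h z - g z))\<^sup>2 + 2 * (cmod (g z - k z))\<^sup>2"
      using norm_power2_diff_le[of "h z - g z" "k z - g z"] by (simp add: norm_minus_commute)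
  qed (use i in auto)
  also have "\<dots> = 2 * (LINT z|lborel. (cmod (h z - g z))\<^sup>2) + 2 * (LINT z|lborel. (cmod (g z - k z))\<^sup>2)"
    using i by simp
  also have "\<dots> < \<delta>" using N k(3) by (simp add: g_def)
  finally show ?thesis using that k by blast
qed

text \<open>Young's inequality \<open>a * b \<le> l / 2 * a^2 + b^2 / (2 * l)\<close>, integrated
  against a kernel of mass one, takes the place of Cauchy-Schwarz. The bound does not depend on
  \<open>n\<close>, and the free weight \<open>l\<close> lets either factor be made to count
  little.\<close>

lemma mconv_bilinear_bound:
  fixes F h :: "complex \<Rightarrow> complex"
  assumes F: "compact_L2 r F" and h: "compact_L2 s h" and l: "l > 0"
  shows "integrable lborel (\<lambda>z. F z * mconv (moll n) h z)"
    and "cmod (LINT z|lborel. F z * mconv (moll n) h z) \<le>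
      l / 2 * (LINT z|lborel. (cmod (F z))\<^sup>2) + (LINT z|lborel. (cmod (h z))\<^sup>2) / (2 * l)"
proof -
  let ?q = "\<lambda>z. (cmod (h z))\<^sup>2"
  let ?b = "\<lambda>z. l / 2 * (cmod (F z))\<^sup>2 + mconv (moll n) ?q z / (2 * l)"
  have ih: "integrable lborel h" and iq: "integrable lborel ?q" and iF: "integrable lborel (\<lambda>z. (cmod (F z))\<^sup>2)"
    using h F compact_L2_integrable by (auto simp: compact_L2_def)
  have [measurable]: "F \<in> borel_measurable borel" using F by (simp add: compact_L2_def)
  have [measurable]: "mconv (moll n) h \<in> borel_measurable borel"
    using mconv_moll_integral(1)[OF ih, of n] by auto
  note td = test_funD[OF test_fun_moll(1)[of n]]
  have pw: "cmod (F z * mconv (moll n) h z) \<le> ?b z" for z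
  proof -
    have "cmod (F z * mconv (moll n) h z) = cmod (LINT \<zeta>|lborel. F z * (moll n (\<zeta> - z) *\<^sub>R h \<zeta>))"
      unfolding mconv_def by (simp only: integral_mult_right_zero)
    also have "\<dots> \<le> (LINT \<zeta>|lborel. cmod (F z * (moll n (\<zeta> - z) *\<^sub>R h \<zeta>)))" by (rule integral_norm_bound)
    also have "\<dots> \<le> (LINT \<zeta>|lborel. (l / 2 * (cmod (F z))\<^sup>2) * moll n (\<zeta> - z) + (moll n (\<zeta> - z) *\<^sub>R ?q \<zeta>) / (2 * l))"
    proof (rule integral_mono)
      show "integrable lborel (\<lambda>\<zeta>. cmod (F z * (moll n (\<zeta> - z) *\<^sub>R h \<zeta>)))"
        using mconv_integrable[OF td(5) td(2) td(6) ih, of z] by (intro integrable_norm integrable_mult_right)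
      show "integrable lborel (\<lambda>\<zeta>. (l / 2 * (cmod (F z))\<^sup>2) * moll n (\<zeta> - z) + (moll n (\<zeta> - z) *\<^sub>R ?q \<zeta>) / (2 * l))"
        by (intro Bochner_Integration.integrable_add integrable_mult_right moll_integrable integrable_divide mconv_integrable[OF td(5) td(2) td(6) iq])
      fix \<zeta>
      have "0 \<le> (l * cmod (F z) - cmod (h \<zeta>))\<^sup>2 / (2 * l)" using l by simp
      also have "\<dots> = l / 2 * (cmod (F z))\<^sup>2 + ?q \<zeta> / (2 * l) - cmod (F z) * cmod (h \<zeta>)"
        using l by (simp add: power2_diff field_simps power2_eq_square)
      finally have "cmod (F z) * cmod (h \<zeta>) \<le> l / 2 * (cmod (F z))\<^sup>2 + ?q \<zeta> / (2 * l)" by simp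
      from mult_left_mono[OF this moll_nonneg[of n "\<zeta> - z"]]
      show "cmod (F z * (moll n (\<zeta> - z) *\<^sub>R h \<zeta>)) \<le> (l / 2 * (cmod (F z))\<^sup>2) * moll n (\<zeta> - z) + (moll n (\<zeta> - z) *\<^sub>R ?q \<zeta>) / (2 * l)"
        using moll_nonneg[of n "\<zeta> - z"] by (simp add: norm_mult algebra_simps abs_of_nonneg)
    qed
    also have "\<dots> = ?b z"
      using moll_integrable[of n z] mconv_integrable[OF td(5) td(2) td(6) iq, of z] moll_integral[of n z]
      by (simp add: mconv_def)
    finally show ?thesis .
  qed
  have ib: "integrable lborel ?b"
    using iF mconv_moll_integral(1)[OF iq, of n] by (intro Bochner_Integration.integrable_add integrable_mult_right integrable_divide)
  show i: "integrable lborel (\<lambda>z. F z * mconv (moll n) h z)"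
  proof (rule Bochner_Integration.integrable_bound[OF ib])
    show "AE z in lborel. norm (F z * mconv (moll n) h z) \<le> norm (?b z)"
      using pw by (intro AE_I2) (metis abs_ge_self order_trans real_norm_def)
  qed measurable
  have "cmod (LINT z|lborel. F z * mconv (moll n) h z) \<le> (LINT z|lborel. cmod (F z * mconv (moll n) h z))"
    by (rule integral_norm_bound)
  also have "\<dots> \<le> (LINT z|lborel. ?b z)" using i ib pw by (intro integral_mono) auto
  also have "\<dots> = l / 2 * (LINT z|lborel. (cmod (F z))\<^sup>2) + (LINT z|lborel. ?q z) / (2 * l)"
    using iF mconv_moll_integral[OF iq, of n] by simp
  finally show "cmod (LINT z|lborel. F z * mconv (moll n) h z) \<le>
      l / 2 * (LINT z|lborel. (cmod (F z))\<^sup>2) + (LINT z|lborel. (cmod (h z))\<^sup>2) / (2 * l)" .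
qed

lemma compact_L2_bilinear_bound:
  fixes F h :: "complex \<Rightarrow> complex"
  assumes F: "compact_L2 r F" and h: "compact_L2 s h" and l: "l > 0"
  shows "integrable lborel (\<lambda>z. F z * h z)"
    and "cmod (LINT z|lborel. F z * h z) \<le>
      l / 2 * (LINT z|lborel. (cmod (F z))\<^sup>2) + (LINT z|lborel. (cmod (h z))\<^sup>2) / (2 * l)"
proof -
  let ?b = "\<lambda>z. l / 2 * (cmod (F z))\<^sup>2 + (cmod (h z))\<^sup>2 / (2 * l)"
  have iq: "integrable lborel (\<lambda>z. (cmod (h z))\<^sup>2)" and iF: "integrable lborel (\<lambda>z. (cmod (F z))\<^sup>2)"
    using h F by (auto simp: compact_L2_def)
  have [measurable]: "F \<in> borel_measurable borel" "h \<in> borel_measurable borel" using F h by (auto simp: compact_L2_def)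
  have pw: "cmod (F z * h z) \<le> ?b z" for z
  proof -
    have "0 \<le> (l * cmod (F z) - cmod (h z))\<^sup>2 / (2 * l)" using l by simp
    also have "\<dots> = ?b z - cmod (F z) * cmod (h z)"
      using l by (simp add: power2_diff field_simps power2_eq_square)
    finally show ?thesis by (simp add: norm_mult)
  qed
  have ib: "integrable lborel ?b" using iF iq by simp
  show i: "integrable lborel (\<lambda>z. F z * h z)"
  proof (rule Bochner_Integration.integrable_bound[OF ib])
    show "AE z in lborel. norm (F z * h z) \<le> norm (?b z)"
      using pw by (intro AE_I2) (metis abs_ge_self order_trans real_norm_def)
  qed measurable
  have "cmod (LINT z|lborel. F z * h z) \<le> (LINT z|lborel. cmod (F z * h z))"
    by (rule integral_norm_bound)
  also have "\<dots> \<le> (LINT z|lborel. ?b z)" using i ib pw by (intro integral_mono) auto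
  also have "\<dots> = l / 2 * (LINT z|lborel. (cmod (F z))\<^sup>2) + (LINT z|lborel. (cmod (h z))\<^sup>2) / (2 * l)"
    using iF iq by simp
  finally show "cmod (LINT z|lborel. F z * h z) \<le>
      l / 2 * (LINT z|lborel. (cmod (F z))\<^sup>2) + (LINT z|lborel. (cmod (h z))\<^sup>2) / (2 * l)" .
qed

lemma integrable_indicator_compact:
  fixes u :: "complex \<Rightarrow> 'a::{banach,second_countable_topology}"
  assumes "compact D" "continuous_on D u"
  shows "integrable lborel (\<lambda>\<zeta>. indicator D \<zeta> *\<^sub>R u \<zeta>)"
  using borel_integrable_compact[OF assms] by (simp add: indicator_scaleR_eq_if)

text \<open>The zero extension may jump at the edge of \<open>D\<close>, so convergence is claimed
  only at points whose closed disk of radius \<open>r\<close> lies in \<open>D\<close>; there the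
  kernel eventually sees nothing but values of \<open>u\<close>.\<close>

lemma mconv_moll_uniform_limit:
  fixes u :: "complex \<Rightarrow> 'a::{banach,second_countable_topology}"
  assumes D: "compact D" "continuous_on D u" and r: "r > 0" "\<And>z. z \<in> C \<Longrightarrow> cball z r \<subseteq> D"
  shows "uniform_limit C (\<lambda>n. mconv (moll n) (\<lambda>\<zeta>. indicator D \<zeta> *\<^sub>R u \<zeta>)) u sequentially"
proof (rule uniform_limitI)
  fix e :: real assume e: "e > 0"
  let ?h = "\<lambda>\<zeta>. indicator D \<zeta> *\<^sub>R u \<zeta>"
  have ih: "integrable lborel ?h" by (rule integrable_indicator_compact[OF D])
  have "uniformly_continuous_on D u" using D by (intro compact_uniformly_continuous)
  then obtain d where d: "d > 0" "\<And>z w. z \<in> D \<Longrightarrow> w \<in> D \<Longrightarrow> dist w z < d \<Longrightarrow> dist (u w) (u z) < e/2"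
    unfolding uniformly_continuous_on_def using e by (metis half_gt_zero)
  have "(\<lambda>n. (1/2::real) ^ n) \<longlonglongrightarrow> 0" by (intro LIMSEQ_power_zero) auto
  then have "\<forall>\<^sub>F n in sequentially. (1/2::real) ^ n < min d r" using d r by (intro order_tendstoD) auto
  then show "\<forall>\<^sub>F n in sequentially. \<forall>z\<in>C. dist (mconv (moll n) ?h z) (u z) < e"
  proof eventually_elim
    case (elim n)
    note td = test_funD[OF test_fun_moll(1)[of n]]
    show ?case
    proof
      fix z assume z: "z \<in> C"
      note i1 = mconv_integrable[OF td(5) td(2) td(6) ih, of z]
      have "u z = (LINT \<zeta>|lborel. moll n (\<zeta> - z) *\<^sub>R u z)"
        using moll_integral[of n z] moll_integrable[of n z] by simp
      then have eq: "mconv (moll n) ?h z - u z = (LINT \<zeta>|lborel. moll n (\<zeta> - z) *\<^sub>R (?h \<zeta> - u z))"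
        unfolding mconv_def scaleR_diff_right using moll_integrable[of n z] i1
        by (subst Bochner_Integration.integral_diff) auto
      have "norm (LINT \<zeta>|lborel. moll n (\<zeta> - z) *\<^sub>R (?h \<zeta> - u z)) \<le> (LINT \<zeta>|lborel. norm (moll n (\<zeta> - z) *\<^sub>R (?h \<zeta> - u z)))"
        by (rule integral_norm_bound)
      also have "\<dots> \<le> (LINT \<zeta>|lborel. (e/2) * moll n (\<zeta> - z))"
      proof (rule integral_mono)
        show "integrable lborel (\<lambda>\<zeta>. norm (moll n (\<zeta> - z) *\<^sub>R (?h \<zeta> - u z)))"
          unfolding scaleR_diff_right using i1 moll_integrable[of n z] by (intro integrable_norm Bochner_Integration.integrable_diff) auto
        show "integrable lborel (\<lambda>\<zeta>. (e/2) * moll n (\<zeta> - z))" by (intro integrable_mult_right moll_integrable)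
        fix \<zeta>
        show "norm (moll n (\<zeta> - z) *\<^sub>R (?h \<zeta> - u z)) \<le> (e/2) * moll n (\<zeta> - z)"
        proof (cases "cmod (\<zeta> - z) < (1/2) ^ n")
          case True
          then have \<zeta>: "\<zeta> \<in> D" "z \<in> D" "dist \<zeta> z < d"
            using r(1) r(2)[OF z] elim by (auto simp: dist_norm norm_minus_commute subset_iff)
          then have "norm (u \<zeta> - u z) \<le> e/2" using d(2)[of z \<zeta>] by (simp add: dist_norm)
          then have "moll n (\<zeta> - z) * norm (u \<zeta> - u z) \<le> moll n (\<zeta> - z) * (e/2)"
            using moll_nonneg by (intro mult_left_mono)
          then show ?thesis using \<zeta> moll_nonneg[of n "\<zeta> - z"] by (simp add: mult.commute abs_of_nonneg)
        next
          case False
          then show ?thesis using moll_outside[of n "\<zeta> - z"] by simp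
        qed
      qed
      also have "\<dots> = e/2" using moll_integral[of n z] by simp
      finally show "dist (mconv (moll n) ?h z) (u z) < e" using e unfolding dist_norm eq by simp
    qed
  qed
qed

lemma mconv_diff:
  fixes h k :: "complex \<Rightarrow> 'a::{banach,second_countable_topology}"
  assumes "integrable lborel h" "integrable lborel k"
  shows "mconv (moll n) (\<lambda>z. h z - k z) z = mconv (moll n) h z - mconv (moll n) k z"
proof -
  note td = test_funD[OF test_fun_moll(1)[of n]]
  show ?thesis unfolding mconv_def scaleR_diff_right
    by (intro Bochner_Integration.integral_diff mconv_integrable[OF td(5) td(2) td(6)] assms)
qed

text \<open>A density argument: for a continuous \<open>k\<close> close to \<open>h\<close> in mean
  square the convergence is uniform, and the two error terms with \<open>h - k\<close> are small by
  bounds independent of \<open>n\<close>.\<close>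

lemma mconv_weak_limit:
  fixes F h :: "complex \<Rightarrow> complex"
  assumes F: "compact_L2 r F" and h: "compact_L2 r h" and r: "r > 0"
  shows "(\<lambda>n. LINT z|lborel. F z * mconv (moll n) h z) \<longlonglongrightarrow> (LINT z|lborel. F z * h z)"
proof (rule metric_LIMSEQ_I)
  fix e :: real assume e: "e > 0"
  define M where "M = (LINT z|lborel. (cmod (F z))\<^sup>2)"
  define M1 where "M1 = (LINT z|lborel. cmod (F z))"
  have M: "M \<ge> 0" "M1 \<ge> 0" by (auto simp: M_def M1_def)
  \<comment> \<open>With this weight and an approximation error below \<open>l * e / 4\<close>, each
    of the two terms of Young's inequality is at most \<open>e / 8\<close>; the \<open>1\<close>
    covers the case \<open>M = 0\<close>.\<close>
  define l where "l = e / (4 * (M + 1))"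
  have l: "l > 0" using e M by (simp add: l_def)
  have "l * e / 4 > 0" using l e by simp
  then obtain k where k: "continuous_on UNIV k" "\<And>z. z \<notin> cball 0 (2 * r) \<Longrightarrow> k z = 0"
    "(LINT z|lborel. (cmod (h z - k z))\<^sup>2) < l * e / 4"
    by (rule L2_approx_continuous[OF h r]) blast
  have h2: "compact_L2 (2*r) h" using h r by (auto intro: compact_L2_mono)
  have k2: "compact_L2 (2*r) k" using k by (intro compact_L2_continuous) auto
  have hk: "compact_L2 (2*r) (\<lambda>z. h z - k z)" by (rule compact_L2_diff[OF h2 k2])
  note ih = compact_L2_integrable[OF h2] and ik = compact_L2_integrable[OF k2] and iF = compact_L2_integrable[OF F]
  have l2: "l / 2 * M + (LINT z|lborel. (cmod (h z - k z))\<^sup>2) / (2 * l) < e / 4"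
  proof -
    have "l / 2 * M \<le> e / 8" using e M by (simp add: l_def field_simps)
    moreover have "(LINT z|lborel. (cmod (h z - k z))\<^sup>2) / (2 * l) < (l * e / 4) / (2 * l)"
      using k(3) l by (intro divide_strict_right_mono) auto
    moreover have "(l * e / 4) / (2 * l) = e / 8" using l by simp
    ultimately show ?thesis by linarith
  qed
  have D: "(\<lambda>\<zeta>. indicator (cball 0 (3 * r)) \<zeta> *\<^sub>R k \<zeta>) = k"
  proof
    fix z show "indicator (cball 0 (3 * r)) z *\<^sub>R k z = k z"
      using k(2)[of z] r by (cases "z \<in> cball 0 (2*r)") auto
  qed
  have "uniform_limit (cball 0 r) (\<lambda>n. mconv (moll n) (\<lambda>\<zeta>. indicator (cball 0 (3 * r)) \<zeta> *\<^sub>R k \<zeta>)) k sequentially"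
  proof (rule mconv_moll_uniform_limit[where r = r])
    show "cball z r \<subseteq> cball 0 (3 * r)" if "z \<in> cball 0 r" for z :: complex
    proof
      fix w assume "w \<in> cball z r"
      then show "w \<in> cball 0 (3 * r)" using that r norm_triangle_ineq2[of w z] by (auto simp: dist_norm norm_minus_commute)
    qed
  qed (use k r in \<open>auto intro: continuous_on_subset\<close>)
  then have ul: "uniform_limit (cball 0 r) (\<lambda>n. mconv (moll n) k) k sequentially" unfolding D .
  have "e / (4 * (M1 + 1)) > 0" using e M by simp
  from uniform_limitD[OF ul this] obtain n0 where
    n0: "\<And>n z. n \<ge> n0 \<Longrightarrow> z \<in> cball 0 r \<Longrightarrow> dist (mconv (moll n) k z) (k z) < e / (4 * (M1 + 1))"
    unfolding eventually_sequentially by blast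
  have "dist (LINT z|lborel. F z * mconv (moll n) h z) (LINT z|lborel. F z * h z) < e" if n: "n \<ge> n0" for n
  proof -
    note b1 = mconv_bilinear_bound[OF F hk l, of n] and b3 = compact_L2_bilinear_bound[OF F hk l]
    note bk = mconv_bilinear_bound(1)[OF F k2 l, of n] compact_L2_bilinear_bound(1)[OF F k2 l]
    note bh = mconv_bilinear_bound(1)[OF F h2 l, of n] compact_L2_bilinear_bound(1)[OF F h2 l]
    have i2: "integrable lborel (\<lambda>z. F z * (mconv (moll n) k z - k z))"
      unfolding right_diff_distrib by (intro Bochner_Integration.integrable_diff bk)
    have A: "(LINT z|lborel. F z * mconv (moll n) h z) - (LINT z|lborel. F z * h z) =
       (LINT z|lborel. F z * mconv (moll n) (\<lambda>z. h z - k z) z) + (LINT z|lborel. F z * (mconv (moll n) k z - k z))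
       - (LINT z|lborel. F z * (h z - k z))"
    proof -
      have "(LINT z|lborel. F z * mconv (moll n) (\<lambda>z. h z - k z) z) = (LINT z|lborel. F z * mconv (moll n) h z) - (LINT z|lborel. F z * mconv (moll n) k z)"
        unfolding mconv_diff[OF ih ik] right_diff_distrib by (intro Bochner_Integration.integral_diff bk bh)
      moreover have "(LINT z|lborel. F z * (mconv (moll n) k z - k z)) = (LINT z|lborel. F z * mconv (moll n) k z) - (LINT z|lborel. F z * k z)"
        unfolding right_diff_distrib by (intro Bochner_Integration.integral_diff bk bh)
      moreover have "(LINT z|lborel. F z * (h z - k z)) = (LINT z|lborel. F z * h z) - (LINT z|lborel. F z * k z)"
        unfolding right_diff_distrib by (intro Bochner_Integration.integral_diff bk bh)
      ultimately show ?thesis by simp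
    qed
    have "cmod (LINT z|lborel. F z * (mconv (moll n) k z - k z)) \<le> (LINT z|lborel. cmod (F z * (mconv (moll n) k z - k z)))"
      by (rule integral_norm_bound)
    also have "\<dots> \<le> (LINT z|lborel. e / (4 * (M1 + 1)) * cmod (F z))"
    proof (rule integral_mono)
      fix z
      show "cmod (F z * (mconv (moll n) k z - k z)) \<le> e / (4 * (M1 + 1)) * cmod (F z)"
      proof (cases "z \<in> cball 0 r")
        case True
        then have "cmod (mconv (moll n) k z - k z) \<le> e / (4 * (M1 + 1))" using n0[OF n] by (auto simp: dist_norm less_imp_le)
        then show ?thesis unfolding norm_mult by (subst mult.commute) (intro mult_right_mono, auto)
      next
        case False
        then have "F z = 0" using F by (simp add: compact_L2_def)
        then show ?thesis by simp
      qed
    qed (use i2 iF in \<open>auto intro: integrable_norm\<close>)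
    also have "\<dots> = (e / 4) * (M1 / (M1 + 1))" by (simp add: M1_def)
    also have "\<dots> \<le> (e / 4) * 1" using M e by (intro mult_left_mono) auto
    finally have B: "cmod (LINT z|lborel. F z * (mconv (moll n) k z - k z)) \<le> e / 4" by simp
    have C: "cmod (LINT z|lborel. F z * mconv (moll n) (\<lambda>z. h z - k z) z) < e / 4"
      "cmod (LINT z|lborel. F z * (h z - k z)) < e / 4"
      using b1(2) b3(2) l2 unfolding M_def by linarith+
    have "cmod ((LINT z|lborel. F z * mconv (moll n) h z) - (LINT z|lborel. F z * h z)) \<le> e/4 + e/4 + e/4"
      unfolding A by (intro order_trans[OF norm_triangle_ineq4] add_mono order_trans[OF norm_triangle_ineq]) (use B C in auto)
    then show ?thesis using e by (simp add: dist_norm)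
  qed
  then show "\<exists>n0. \<forall>n\<ge>n0. dist (LINT z|lborel. F z * mconv (moll n) h z) (LINT z|lborel. F z * h z) < e" by blast
qed

section \<open>Weak derivatives\<close>

lemma test_fun_indicator:
  fixes v :: "complex \<Rightarrow> 'a::real_normed_vector"
  assumes "test_fun \<phi> \<phi>1 \<phi>2 S" "S \<subseteq> D"
  shows "\<phi> z *\<^sub>R (indicator D z *\<^sub>R v z) = \<phi> z *\<^sub>R v z" "\<phi>1 z *\<^sub>R (indicator D z *\<^sub>R v z) = \<phi>1 z *\<^sub>R v z"
    "\<phi>2 z *\<^sub>R (indicator D z *\<^sub>R v z) = \<phi>2 z *\<^sub>R v z"
  using test_funD(6-8)[OF assms(1), of z] assms(2) by (cases "z \<in> D"; auto)+

lemma sobolev_weak: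
  fixes \<phi> :: "complex \<Rightarrow> real"
  assumes "weak_partials G v V1 V2" and T: "test_fun \<phi> \<phi>1 \<phi>2 S" and S: "S \<subseteq> G"
  shows "(LINT z|lborel. \<phi>1 z *\<^sub>R v z) = - (LINT z|lborel. \<phi> z *\<^sub>R V1 z)"
    "(LINT z|lborel. \<phi>2 z *\<^sub>R v z) = - (LINT z|lborel. \<phi> z *\<^sub>R V2 z)"
proof -
  note td = test_funD[OF T]
  let ?D = "\<lambda>z h. Re h *\<^sub>R \<phi>1 z + Im h *\<^sub>R \<phi>2 z"
  have cl: "closure {z. \<phi> z \<noteq> 0} \<subseteq> S"
    using td(5,6) by (intro closure_minimal) (auto simp: compact_imp_closed)
  have "compact (closure {z. \<phi> z \<noteq> 0})"
    using cl td(5) compact_imp_bounded bounded_subset by (auto simp: compact_eq_bounded_closed)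
  then have "(\<forall>z. (\<phi> has_derivative ?D z) (at z)) \<and>
        continuous_on UNIV (\<lambda>z. ?D z 1) \<and> continuous_on UNIV (\<lambda>z. ?D z \<i>) \<and>
        compact (closure {z. \<phi> z \<noteq> 0}) \<and> closure {z. \<phi> z \<noteq> 0} \<subseteq> G"
    using td(1)[unfolded has_partials_def] td(3,4) cl S by simp
  from assms(1)[unfolded weak_partials_def, rule_format, OF this]
  show "(LINT z|lborel. \<phi>1 z *\<^sub>R v z) = - (LINT z|lborel. \<phi> z *\<^sub>R V1 z)"
    "(LINT z|lborel. \<phi>2 z *\<^sub>R v z) = - (LINT z|lborel. \<phi> z *\<^sub>R V2 z)" by simp_all
qed

text \<open>Together with \<open>sobolev_weak\<close> this lets all later arguments use
  \<open>test_fun\<close>, whose carrier is any compact set, instead of the closed support in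
  \<open>weak_partials\<close>.\<close>

lemma weak_partialsI:
  assumes "\<And>(\<phi>::complex \<Rightarrow> real) \<phi>1 \<phi>2 S. test_fun \<phi> \<phi>1 \<phi>2 S \<Longrightarrow> S \<subseteq> G \<Longrightarrow>
     (LINT z|lborel. \<phi>1 z *\<^sub>R v z) = - (LINT z|lborel. \<phi> z *\<^sub>R V1 z) \<and>
     (LINT z|lborel. \<phi>2 z *\<^sub>R v z) = - (LINT z|lborel. \<phi> z *\<^sub>R V2 z)"
  shows "weak_partials G v V1 V2"
  unfolding weak_partials_def
proof (intro allI impI)
  fix \<phi> :: "complex \<Rightarrow> real" and D\<phi>
  assume *: "(\<forall>z. (\<phi> has_derivative D\<phi> z) (at z)) \<and>
        continuous_on UNIV (\<lambda>z. D\<phi> z 1) \<and> continuous_on UNIV (\<lambda>z. D\<phi> z \<i>) \<and>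
        compact (closure {z. \<phi> z \<noteq> 0}) \<and> closure {z. \<phi> z \<noteq> 0} \<subseteq> G"
  have "D\<phi> z = (\<lambda>h. Re h *\<^sub>R D\<phi> z 1 + Im h *\<^sub>R D\<phi> z \<i>)" for z
  proof
    fix h
    interpret linear "D\<phi> z" using * has_derivative_linear by blast
    have "h = Re h *\<^sub>R 1 + Im h *\<^sub>R \<i>" by (simp add: complex_eq_iff)
    then show "D\<phi> z h = Re h *\<^sub>R D\<phi> z 1 + Im h *\<^sub>R D\<phi> z \<i>" by (metis add scaleR)
  qed
  then have "has_partials \<phi> (\<lambda>z. D\<phi> z 1) (\<lambda>z. D\<phi> z \<i>) z" for z
    using * unfolding has_partials_def by metis
  then have "test_fun \<phi> (\<lambda>z. D\<phi> z 1) (\<lambda>z. D\<phi> z \<i>) (closure {z. \<phi> z \<noteq> 0})"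
    unfolding test_fun_def using * closure_subset[of "{z. \<phi> z \<noteq> 0}"] by blast
  from assms[OF this] * show
    "(LINT z|lborel. D\<phi> z 1 *\<^sub>R v z) = - (LINT z|lborel. \<phi> z *\<^sub>R V1 z) \<and>
     (LINT z|lborel. D\<phi> z \<i> *\<^sub>R v z) = - (LINT z|lborel. \<phi> z *\<^sub>R V2 z)" by blast
qed

lemma compact_L2_indicator_continuous:
  fixes v :: "complex \<Rightarrow> complex"
  assumes "compact D" "continuous_on D v" "D \<subseteq> cball 0 r"
  shows "compact_L2 r (\<lambda>z. indicator D z *\<^sub>R v z)"
proof -
  have "(\<lambda>z. indicator D z *\<^sub>R v z) \<in> borel_measurable borel"
    using integrable_indicator_compact[OF assms(1,2)] by auto
  moreover have "integrable lborel (\<lambda>z. indicator D z *\<^sub>R (cmod (v z))\<^sup>2)"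
    by (intro integrable_indicator_compact assms continuous_intros)
  then have "integrable lborel (\<lambda>z. (cmod (indicator D z *\<^sub>R v z))\<^sup>2)"
    by (rule Bochner_Integration.integrable_cong[THEN iffD1, rotated -1]) (auto simp: indicator_def)
  ultimately show ?thesis using assms(3) by (auto simp: compact_L2_def indicator_def)
qed

lemma sobolev_restrict:
  assumes "sobolev_12_loc G v V1 V2" "compact D" "D \<subseteq> G" "D \<subseteq> cball 0 r"
  shows "compact_L2 r (\<lambda>z. indicator D z *\<^sub>R v z)"
    "compact_L2 r (\<lambda>z. indicator D z *\<^sub>R V1 z)" "compact_L2 r (\<lambda>z. indicator D z *\<^sub>R V2 z)"
proof -
  show "compact_L2 r (\<lambda>z. indicator D z *\<^sub>R v z)"
    using assms by (intro compact_L2_indicator_continuous) (auto simp: sobolev_12_loc_def intro: continuous_on_subset)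
  have [measurable]: "D \<in> sets borel" using assms(2) by (simp add: borel_closed compact_imp_closed)
  have "compact_L2 r (\<lambda>z. indicator D z *\<^sub>R V z)"
    if V: "set_borel_measurable lborel G V" "set_integrable lborel D (\<lambda>z. (cmod (V z))\<^sup>2)" for V :: "complex \<Rightarrow> complex"
  proof -
    have [measurable]: "(\<lambda>z. indicator G z *\<^sub>R V z) \<in> borel_measurable borel"
      using V(1) by (simp add: set_borel_measurable_def)
    have "(\<lambda>z. indicator D z *\<^sub>R (indicator G z *\<^sub>R V z)) \<in> borel_measurable borel" by measurable
    moreover have "indicator D z *\<^sub>R (indicator G z *\<^sub>R V z) = indicator D z *\<^sub>R V z" for z
      using assms(3) by (auto simp: indicator_def)
    moreover have "(cmod (indicator D z *\<^sub>R V z))\<^sup>2 = indicator D z *\<^sub>R (cmod (V z))\<^sup>2" for z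
      by (auto simp: indicator_def)
    moreover have "indicator D z *\<^sub>R V z = 0" if "z \<notin> cball 0 r" for z
      using that assms(4) by (auto simp: indicator_def)
    ultimately show ?thesis using V(2) by (simp only: compact_L2_def set_integrable_def) simp
  qed
  then show "compact_L2 r (\<lambda>z. indicator D z *\<^sub>R V1 z)" "compact_L2 r (\<lambda>z. indicator D z *\<^sub>R V2 z)"
    using assms by (auto simp: sobolev_12_loc_def)
qed

lemma compact_enclosed_cball:
  fixes D :: "complex set"
  assumes "compact D" obtains r where "r > 0" "D \<subseteq> cball 0 r"
  using compact_imp_bounded[OF assms] by (auto simp: bounded_pos intro: that)

lemma compact_neighbourhood:
  fixes S :: "complex set"
  assumes "compact S" "open G" "S \<subseteq> G"
  obtains D e where "compact D" "D \<subseteq> G" "S \<subseteq> D" "e > 0" "\<And>z. z \<in> S \<Longrightarrow> cball z e \<subseteq> D"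
proof -
  obtain e where e: "e > 0" "(\<Union>x\<in>S. cball x e) \<subseteq> G"
    using compact_subset_open_imp_cball_epsilon_subset[OF assms] by blast
  show ?thesis
    by (rule that[of "\<Union>x\<in>S. cball x e" e]) (use e compact_minkowski_sum_cball[OF assms(1)] in auto)
qed

text \<open>The translated kernel is a test function carried by the disk of radius
  \<open>(1/2) ^ n\<close> around \<open>z\<close>, which lies in \<open>D\<close>; the zero
  extension is therefore not felt, and the derivatives of the mollification at \<open>z\<close> are
  the mollified weak derivatives.\<close>

lemma mconv_sobolev:
  assumes v: "sobolev_12_loc G v V1 V2" and D: "D \<subseteq> G" and z: "cball z ((1/2) ^ n) \<subseteq> D"
  shows "- mconv (moll_x n) (\<lambda>\<zeta>. indicator D \<zeta> *\<^sub>R v \<zeta>) z = mconv (moll n) (\<lambda>\<zeta>. indicator D \<zeta> *\<^sub>R V1 \<zeta>) z"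
    "- mconv (moll_y n) (\<lambda>\<zeta>. indicator D \<zeta> *\<^sub>R v \<zeta>) z = mconv (moll n) (\<lambda>\<zeta>. indicator D \<zeta> *\<^sub>R V2 \<zeta>) z"
proof -
  note T = test_fun_translate[OF test_fun_moll(1)[of n], of z]
  have "weak_partials G v V1 V2" using v by (simp add: sobolev_12_loc_def)
  note w = sobolev_weak[OF this T] and i = test_fun_indicator[OF T z]
  show "- mconv (moll_x n) (\<lambda>\<zeta>. indicator D \<zeta> *\<^sub>R v \<zeta>) z = mconv (moll n) (\<lambda>\<zeta>. indicator D \<zeta> *\<^sub>R V1 \<zeta>) z"
    "- mconv (moll_y n) (\<lambda>\<zeta>. indicator D \<zeta> *\<^sub>R v \<zeta>) z = mconv (moll n) (\<lambda>\<zeta>. indicator D \<zeta> *\<^sub>R V2 \<zeta>) z"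
    unfolding mconv_def i using w z D by auto
qed

text \<open>A uniformly convergent factor against a weakly convergent one. The difference
  \<open>F n - F0\<close> has squared norm at most \<open>d^2 * A\<close>, and the weight
  \<open>1 / d\<close> in the bilinear bound turns this into a multiple of \<open>d\<close>. The
  shift \<open>n0\<close> serves callers whose \<open>F n\<close> makes sense only at fine
  scales.\<close>

lemma mconv_weak_limit_uniform:
  fixes F :: "nat \<Rightarrow> complex \<Rightarrow> complex"
  assumes F: "\<And>n. continuous_on UNIV (F n)" "\<And>n z. z \<notin> cball 0 r \<Longrightarrow> F n z = 0"
    and lim: "uniform_limit UNIV F F0 sequentially"
    and h: "compact_L2 r h" and r: "r > 0"
  shows "(\<lambda>n. LINT z|lborel. F n z * mconv (moll (n + n0)) h z) \<longlonglongrightarrow> (LINT z|lborel. F0 z * h z)"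
proof -
  have F0: "continuous_on UNIV F0"
    by (rule uniform_limit_theorem[OF _ lim]) (auto intro!: always_eventually F)
  have F00: "F0 z = 0" if "z \<notin> cball 0 r" for z
  proof -
    have "(\<lambda>n. F n z) \<longlonglongrightarrow> F0 z" using lim by (auto intro: tendsto_uniform_limitI)
    then show ?thesis using F(2)[OF that] by (simp add: LIMSEQ_const_iff)
  qed
  have FL: "compact_L2 r (F n)" for n by (intro compact_L2_continuous F)
  have F0L: "compact_L2 r F0" by (intro compact_L2_continuous F0 F00)
  have FD: "compact_L2 r (\<lambda>z. F n z - F0 z)" for n by (rule compact_L2_diff[OF FL F0L])
  define H where "H = (LINT z|lborel. (cmod (h z))\<^sup>2)"
  define A where "A = (LINT z|(lborel::complex measure). indicator (cball 0 r) z :: real)"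
  have HA: "H \<ge> 0" "A \<ge> 0" by (auto simp: H_def A_def)
  have 1: "(\<lambda>n. LINT z|lborel. F0 z * mconv (moll (n + n0)) h z) \<longlonglongrightarrow> (LINT z|lborel. F0 z * h z)"
    by (rule LIMSEQ_ignore_initial_segment[OF mconv_weak_limit[OF F0L h r]])
  have 2: "(\<lambda>n. LINT z|lborel. (F n z - F0 z) * mconv (moll (n + n0)) h z) \<longlonglongrightarrow> 0"
  proof (rule metric_LIMSEQ_I)
    fix e :: real assume e: "e > 0"
    define d where "d = e / (A + H + 1)"
    have d: "d > 0" using e HA by (simp add: d_def)
    obtain N where N: "\<And>n z. n \<ge> N \<Longrightarrow> dist (F n z) (F0 z) < d"
      using uniform_limitD[OF lim d] by (auto simp: eventually_sequentially)
    have "cmod (LINT z|lborel. (F n z - F0 z) * mconv (moll (n + n0)) h z) < e" if n: "n \<ge> N" for n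
    proof -
      have "(LINT z|lborel. (cmod (F n z - F0 z))\<^sup>2) \<le> (LINT z|(lborel::complex measure). d\<^sup>2 * indicator (cball 0 r) z)"
      proof (rule integral_mono)
        fix z show "(cmod (F n z - F0 z))\<^sup>2 \<le> d\<^sup>2 * indicator (cball 0 r) z"
          using N[OF n, of z] F(2)[of z n] F00[of z] by (cases "z \<in> cball 0 r") (auto simp: dist_norm intro!: power_mono)
      qed (use FD[of n] in \<open>auto simp: compact_L2_def intro!: integrable_indicator_cball\<close>)
      also have "\<dots> = d\<^sup>2 * A" by (simp add: A_def)
      finally have b: "(LINT z|lborel. (cmod (F n z - F0 z))\<^sup>2) \<le> d\<^sup>2 * A" .
      have "cmod (LINT z|lborel. (F n z - F0 z) * mconv (moll (n + n0)) h z) \<le> (1/d) / 2 * (LINT z|lborel. (cmod (F n z - F0 z))\<^sup>2) + H / (2 * (1/d))"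
        unfolding H_def using d by (intro mconv_bilinear_bound(2)[OF FD h]) auto
      also have "\<dots> \<le> (1/d) / 2 * (d\<^sup>2 * A) + H / (2 * (1/d))"
        using b d by (intro add_right_mono mult_left_mono) auto
      also have "\<dots> = d * (A + H) / 2" using d by (simp add: field_simps power2_eq_square)
      also have "\<dots> \<le> d * (A + H)" using d HA by simp
      also have "\<dots> < d * (A + H + 1)" using d by simp
      also have "\<dots> = e" using HA by (simp add: d_def)
      finally show ?thesis .
    qed
    then show "\<exists>N. \<forall>n\<ge>N. dist (LINT z|lborel. (F n z - F0 z) * mconv (moll (n + n0)) h z) 0 < e" by auto
  qed
  have "(LINT z|lborel. F n z * mconv (moll (n + n0)) h z) = (LINT z|lborel. (F n z - F0 z) * mconv (moll (n + n0)) h z) + (LINT z|lborel. F0 z * mconv (moll (n + n0)) h z)" for n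
    using mconv_bilinear_bound(1)[OF FD h zero_less_one, of n "n+n0"] mconv_bilinear_bound(1)[OF F0L h zero_less_one, of "n+n0"]
    by (subst Bochner_Integration.integral_add[symmetric]) (auto simp: algebra_simps)
  then show ?thesis using tendsto_add[OF 2 1] by simp
qed

section \<open>Chain rule for weak derivatives and lifting through holomorphic maps\<close>

lemma continuous_on_vanishing_outside:
  fixes \<phi> :: "complex \<Rightarrow> real" and g :: "complex \<Rightarrow> 'a::real_normed_vector"
  assumes S: "closed S" and \<phi>: "continuous_on UNIV \<phi>" "\<And>z. z \<notin> S \<Longrightarrow> \<phi> z = 0"
    and g: "\<And>z. z \<in> S \<Longrightarrow> isCont g z"
  shows "continuous_on UNIV (\<lambda>z. \<phi> z *\<^sub>R g z)"
proof (rule continuous_at_imp_continuous_on, intro ballI)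
  fix z
  show "isCont (\<lambda>z. \<phi> z *\<^sub>R g z) z"
  proof (cases "z \<in> S")
    case True
    then show ?thesis using \<phi>(1) g by (intro continuous_intros) (auto simp: continuous_on_eq_continuous_at)
  next
    case False
    have "isCont (\<lambda>z. 0::'a) z" by simp
    moreover have "\<forall>\<^sub>F w in nhds z. \<phi> w *\<^sub>R g w = 0"
      by (rule eventually_mono[OF eventually_nhds_in_open[of "-S" z]]) (use S False \<phi>(2) in auto)
    ultimately show ?thesis using isCont_cong[of "\<lambda>z. \<phi> z *\<^sub>R g z" "\<lambda>_. 0" z] by simp
  qed
qed

text \<open>For the mollifications \<open>F n\<close> the formula is the vanishing integral of a
  partial derivative of \<open>\<phi> * \<kappa> (F n)\<close>, and both sides pass to the limit. It
  is stated for a single test function and for \<open>\<kappa>\<close> on a neighbourhood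
  \<open>B\<close> of the image of \<open>S\<close>, because \<open>\<kappa>\<close> will be a local
  inverse of a holomorphic map.\<close>

lemma sobolev_chain_local:
  fixes \<phi> :: "complex \<Rightarrow> real"
  assumes f: "sobolev_12_loc G f D1 D2" and G: "open G" and T: "test_fun \<phi> \<phi>1 \<phi>2 S" and S: "S \<subseteq> G"
    and B: "open B" "f ` S \<subseteq> B" and k: "\<kappa> holomorphic_on B"
  shows "(LINT z|lborel. \<phi>1 z *\<^sub>R \<kappa> (f z)) = - (LINT z|lborel. \<phi> z *\<^sub>R (deriv \<kappa> (f z) * D1 z))"
    "(LINT z|lborel. \<phi>2 z *\<^sub>R \<kappa> (f z)) = - (LINT z|lborel. \<phi> z *\<^sub>R (deriv \<kappa> (f z) * D2 z))"
proof -
  note td = test_funD[OF T]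
  have cS: "closed S" using td(5) by (rule compact_imp_closed)
  obtain D e where D: "compact D" "D \<subseteq> G" "S \<subseteq> D" "e > 0" "\<And>z. z \<in> S \<Longrightarrow> cball z e \<subseteq> D"
    using compact_neighbourhood[OF td(5) G S] by blast
  obtain r where r: "r > 0" "D \<subseteq> cball 0 r" using compact_enclosed_cball[OF D(1)] .
  have Sr: "z \<notin> S" if "z \<notin> cball 0 r" for z using that r(2) D(3) by blast
  have cf: "continuous_on G f" using f by (simp add: sobolev_12_loc_def)
  have cfS: "isCont f z" if "z \<in> S" for z using cf G S that continuous_on_eq_continuous_at by blast
  have "compact (f ` S)" using cf S td(5) by (meson compact_continuous_image continuous_on_subset)
  \<comment> \<open>A compact neighbourhood of the image of \<open>S\<close>: from the index
    \<open>n0\<close> on, the mollified maps send \<open>S\<close> into it, and there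
    \<open>\<kappa>\<close> is bounded and its derivative uniformly continuous.\<close>
  then obtain T e2 where T: "compact T" "T \<subseteq> B" "f ` S \<subseteq> T" "e2 > 0" "\<And>w. w \<in> f ` S \<Longrightarrow> cball w e2 \<subseteq> T"
    using compact_neighbourhood[OF _ B] by metis
  note L = sobolev_restrict[OF f D(1,2) r(2)]
  note ifD = compact_L2_integrable[OF L(1)]
  define F where "F n = mconv (moll n) (\<lambda>\<zeta>. indicator D \<zeta> *\<^sub>R f \<zeta>)" for n
  have ul: "uniform_limit S F f sequentially"
    unfolding F_def by (rule mconv_moll_uniform_limit[OF D(1) continuous_on_subset[OF cf D(2)] D(4,5)])
  have "\<forall>\<^sub>F n in sequentially. (\<forall>z\<in>S. dist (F n z) (f z) < e2) \<and> (1/2) ^ n < e"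
    using uniform_limitD[OF ul T(4)] order_tendstoD(2)[OF LIMSEQ_power_zero[of "1/2::real"] D(4)]
    by (auto intro: eventually_conj)
  then obtain n0 where n0: "\<And>n z. n \<ge> n0 \<Longrightarrow> z \<in> S \<Longrightarrow> dist (F n z) (f z) < e2" "\<And>n. n \<ge> n0 \<Longrightarrow> (1/2) ^ n < e"
    by (auto simp: eventually_sequentially)
  have FT: "F (n + n0) z \<in> T" if "z \<in> S" for n z
    using n0(1)[of "n + n0" z] that T(5)[of "f z"] by (auto simp: dist_commute less_imp_le subset_iff)
  have FB: "F (n + n0) z \<in> B" if "z \<in> S" for n z using FT[OF that] T(2) by blast
  have fT: "f z \<in> T" if "z \<in> S" for z using that T(3) by blast
  have kd: "(\<kappa> has_field_derivative deriv \<kappa> w) (at w)" if "w \<in> B" for w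
    using k B(1) that holomorphic_derivI by blast
  have dk: "deriv \<kappa> holomorphic_on B" using k B(1) by (rule holomorphic_deriv)
  have ck: "isCont \<kappa> w" "isCont (deriv \<kappa>) w" if "w \<in> B" for w
    using that B(1) k dk holomorphic_on_imp_continuous_on continuous_on_eq_continuous_at by blast+
  have F_part: "has_partials (F n) (\<lambda>z. - mconv (moll_x n) (\<lambda>\<zeta>. indicator D \<zeta> *\<^sub>R f \<zeta>) z) (\<lambda>z. - mconv (moll_y n) (\<lambda>\<zeta>. indicator D \<zeta> *\<^sub>R f \<zeta>) z) z" for n z
    unfolding F_def by (rule has_partials_mconv[OF test_fun_moll(1) ifD])
  define A1 where "A1 n = mconv (moll n) (\<lambda>\<zeta>. indicator D \<zeta> *\<^sub>R D1 \<zeta>)" for n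
  define A2 where "A2 n = mconv (moll n) (\<lambda>\<zeta>. indicator D \<zeta> *\<^sub>R D2 \<zeta>)" for n
  have cA: "continuous_on X (A1 n)" "continuous_on X (A2 n)" for n X
    unfolding A1_def A2_def
    by (rule continuous_on_mconv[OF test_funD(5,2,6)[OF test_fun_moll(1)]] compact_L2_integrable[OF L(2)] compact_L2_integrable[OF L(3)] | assumption)+
  have cAi: "isCont (A1 n) z" "isCont (A2 n) z" for n z
    using cA[of UNIV n] by (auto simp: continuous_on_eq_continuous_at)
  have cF: "isCont (F n) z" for n z using F_part by (rule has_partials_imp_continuous)
  define P where "P n z = \<phi> z *\<^sub>R \<kappa> (F (n + n0) z)" for n z
  define P1 where "P1 n z = \<phi>1 z *\<^sub>R \<kappa> (F (n + n0) z) + \<phi> z *\<^sub>R (deriv \<kappa> (F (n + n0) z) * A1 (n + n0) z)" for n z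
  define P2 where "P2 n z = \<phi>2 z *\<^sub>R \<kappa> (F (n + n0) z) + \<phi> z *\<^sub>R (deriv \<kappa> (F (n + n0) z) * A2 (n + n0) z)" for n z
  have PT: "test_fun (P n) (P1 n) (P2 n) S" for n
    unfolding test_fun_def
  proof (intro conjI allI impI)
    show "compact S" by (rule td(5))
    show "P n z = 0" if "z \<notin> S" for z using td(6)[OF that] by (simp add: P_def)
    have cc: "isCont (\<lambda>z. \<kappa> (F (n + n0) z)) z" "isCont (\<lambda>z. deriv \<kappa> (F (n + n0) z)) z" if "z \<in> S" for z
      using ck[OF FB[OF that, of n]] cF by (auto intro: isCont_o2)
    show "continuous_on UNIV (P1 n)" "continuous_on UNIV (P2 n)"
      unfolding P1_def P2_def
      by (auto intro!: continuous_on_add continuous_on_vanishing_outside[OF cS] td(2-4) td(6-8) isCont_mult cc cAi)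
    show "has_partials (P n) (P1 n) (P2 n) z" for z
    proof (cases "z \<in> S")
      case True
      have zD: "cball z ((1/2) ^ (n + n0)) \<subseteq> D"
        using D(5)[OF True] n0(2)[of "n + n0"] subset_cball[of "(1/2)^(n+n0)" e z] by auto
      have "has_partials (F (n + n0)) (A1 (n + n0)) (A2 (n + n0)) z"
        using F_part[of "n + n0" z] unfolding has_partials_def mconv_sobolev[OF f D(2) zD] A1_def A2_def .
      from has_partials_scaleR[OF td(1) has_partials_holomorphic_chain[OF kd[OF FB[OF True]] this]]
      show ?thesis unfolding has_partials_def P_def[abs_def] P1_def P2_def .
    next
      case False
      show ?thesis
        by (rule has_partials_transform[OF has_partials_const[of 0], of "-S"])
           (use cS False td(6-8) in \<open>auto simp: P_def P1_def P2_def\<close>)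
    qed
  qed
  have bdk: "\<exists>M. \<forall>w\<in>T. cmod (\<kappa> w) \<le> M"
    using compact_continuous_image[OF continuous_on_subset[OF holomorphic_on_imp_continuous_on[OF k] T(2)] T(1)]
    by (auto dest!: compact_imp_bounded simp: bounded_iff)
  have lim1: "(\<lambda>n. LINT z|lborel. \<psi> z *\<^sub>R \<kappa> (F (n + n0) z)) \<longlonglongrightarrow> (LINT z|lborel. \<psi> z *\<^sub>R \<kappa> (f z))"
    if p: "continuous_on UNIV \<psi>" "\<And>z. z \<notin> S \<Longrightarrow> \<psi> z = 0" for \<psi> :: "complex \<Rightarrow> real"
  proof -
    obtain M where M: "\<And>w. w \<in> T \<Longrightarrow> cmod (\<kappa> w) \<le> M" using bdk by blast
    have cc: "isCont (\<lambda>z. \<kappa> (F (n + n0) z)) z" "isCont (\<lambda>z. \<kappa> (f z)) z" if "z \<in> S" for z n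
      using ck[OF FB[OF that, of n]] ck[of "f z"] fT[OF that] T(2) cF cfS[OF that] by (auto intro: isCont_o2)
    show ?thesis
    proof (rule integral_dominated_convergence[where w = "\<lambda>z. \<bar>\<psi> z\<bar> * M"])
      have "integrable lborel \<psi>" using p by (intro continuous_compact_support_integrable[OF td(5)]) (auto intro: continuous_on_subset)
      then show "integrable lborel (\<lambda>z. \<bar>\<psi> z\<bar> * M)" by (intro integrable_mult_left) auto
      show "(\<lambda>z. \<psi> z *\<^sub>R \<kappa> (F (n + n0) z)) \<in> borel_measurable lborel" "(\<lambda>z. \<psi> z *\<^sub>R \<kappa> (f z)) \<in> borel_measurable lborel" for n
        by (auto intro!: borel_measurable_continuous_onI continuous_on_vanishing_outside[OF cS p] cc)
      show "AE z in lborel. norm (\<psi> z *\<^sub>R \<kappa> (F (n + n0) z)) \<le> \<bar>\<psi> z\<bar> * M" for n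
      proof (rule AE_I2)
        fix z show "norm (\<psi> z *\<^sub>R \<kappa> (F (n + n0) z)) \<le> \<bar>\<psi> z\<bar> * M"
          using M[OF FT[of z n]] p(2)[of z] by (cases "z \<in> S") (auto intro!: mult_left_mono)
      qed
      show "AE z in lborel. (\<lambda>n. \<psi> z *\<^sub>R \<kappa> (F (n + n0) z)) \<longlonglongrightarrow> \<psi> z *\<^sub>R \<kappa> (f z)"
      proof (rule AE_I2)
        fix z show "(\<lambda>n. \<psi> z *\<^sub>R \<kappa> (F (n + n0) z)) \<longlonglongrightarrow> \<psi> z *\<^sub>R \<kappa> (f z)"
        proof (cases "z \<in> S")
          case True
          have "(\<lambda>n. F (n + n0) z) \<longlonglongrightarrow> f z"
            by (rule LIMSEQ_ignore_initial_segment[OF tendsto_uniform_limitI[OF ul True]])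
          then have "(\<lambda>n. \<kappa> (F (n + n0) z)) \<longlonglongrightarrow> \<kappa> (f z)"
            by (rule isCont_tendsto_compose[rotated]) (use ck fT[OF True] T(2) in auto)
          then show ?thesis by (intro tendsto_intros)
        qed (use p in auto)
      qed
    qed
  qed
  define E where "E n z = \<phi> z *\<^sub>R deriv \<kappa> (F (n + n0) z)" for n z
  define E0 where "E0 z = \<phi> z *\<^sub>R deriv \<kappa> (f z)" for z
  \<comment> \<open>The mollified derivatives converge only weakly, so their coefficients have to
    converge uniformly.\<close>
  have ule: "uniform_limit UNIV E E0 sequentially"
  proof (rule uniform_limitI)
    fix c :: real assume c: "c > 0"
    obtain M where M: "M > 0" "\<And>z. norm (\<phi> z) \<le> M"
      using continuous_compact_support_bounded[OF td(5) td(2) td(6)] by blast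
    have "uniformly_continuous_on T (deriv \<kappa>)"
      by (intro compact_uniformly_continuous T continuous_on_subset[OF holomorphic_on_imp_continuous_on[OF dk] T(2)])
    then obtain d where d: "d > 0" "\<And>w y. w \<in> T \<Longrightarrow> y \<in> T \<Longrightarrow> dist y w < d \<Longrightarrow> dist (deriv \<kappa> y) (deriv \<kappa> w) < c / M"
      unfolding uniformly_continuous_on_def using divide_pos_pos[OF c M(1)] by blast
    have "\<forall>\<^sub>F n in sequentially. \<forall>z\<in>S. dist (F (n + n0) z) (f z) < d"
      using uniform_limitD[OF ul d(1)] by (subst eventually_sequentially_seg)
    then show "\<forall>\<^sub>F n in sequentially. \<forall>z\<in>UNIV. dist (E n z) (E0 z) < c"
    proof eventually_elim
      case (elim n)
      show ?case
      proof
        fix z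
        show "dist (E n z) (E0 z) < c"
        proof (cases "z \<in> S")
          case True
          have "cmod (deriv \<kappa> (F (n + n0) z) - deriv \<kappa> (f z)) < c / M"
            using d(2)[OF fT[OF True] FT[OF True]] elim True by (auto simp: dist_norm)
          moreover have "dist (E n z) (E0 z) = \<bar>\<phi> z\<bar> * cmod (deriv \<kappa> (F (n + n0) z) - deriv \<kappa> (f z))"
            unfolding E_def E0_def dist_norm scaleR_diff_right[symmetric] by simp
          ultimately have "dist (E n z) (E0 z) \<le> M * cmod (deriv \<kappa> (F (n + n0) z) - deriv \<kappa> (f z))"
            using M(2)[of z] by (auto intro!: mult_right_mono)
          also have "\<dots> < M * (c / M)" using M(1) \<open>cmod (deriv \<kappa> (F (n + n0) z) - deriv \<kappa> (f z)) < c / M\<close>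
            by (intro mult_strict_left_mono)
          also have "\<dots> = c" using M(1) by simp
          finally show ?thesis .
        next
          case False
          then show ?thesis using td(6) c by (simp add: E_def E0_def)
        qed
      qed
    qed
  qed
  have cE: "continuous_on UNIV (E n)" for n
    unfolding E_def by (intro continuous_on_vanishing_outside[OF cS td(2) td(6)]) (auto intro: isCont_o2 cF ck FB)
  have lim2: "(\<lambda>n. LINT z|lborel. E n z * mconv (moll (n + n0)) (\<lambda>\<zeta>. indicator D \<zeta> *\<^sub>R V \<zeta>) z) \<longlonglongrightarrow> (LINT z|lborel. \<phi> z *\<^sub>R (deriv \<kappa> (f z) * V z))"
    if V: "compact_L2 r (\<lambda>\<zeta>. indicator D \<zeta> *\<^sub>R V \<zeta>)" for V
  proof -
    have "(\<lambda>n. LINT z|lborel. E n z * mconv (moll (n + n0)) (\<lambda>\<zeta>. indicator D \<zeta> *\<^sub>R V \<zeta>) z) \<longlonglongrightarrow> (LINT z|lborel. E0 z * (indicator D z *\<^sub>R V z))"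
      by (rule mconv_weak_limit_uniform[OF cE _ ule V r(1)]) (use Sr td(6) in \<open>auto simp: E_def\<close>)
    moreover have "E0 z * (indicator D z *\<^sub>R V z) = \<phi> z *\<^sub>R (deriv \<kappa> (f z) * V z)" for z
      using td(6)[of z] D(3) by (cases "z \<in> D") (auto simp: E0_def)
    ultimately show ?thesis by simp
  qed
  have z: "(LINT z|lborel. \<psi> z *\<^sub>R \<kappa> (F (n + n0) z)) = - (LINT z|lborel. E n z * A (n + n0) z)"
    if "(LINT z|lborel. \<psi> z *\<^sub>R \<kappa> (F (n + n0) z) + \<phi> z *\<^sub>R (deriv \<kappa> (F (n + n0) z) * A (n + n0) z)) = 0"
      "continuous_on UNIV \<psi>" "\<And>z. z \<notin> S \<Longrightarrow> \<psi> z = 0" "continuous_on UNIV (A (n + n0))" for n \<psi> A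
  proof -
    have E: "E n z * A (n + n0) z = \<phi> z *\<^sub>R (deriv \<kappa> (F (n + n0) z) * A (n + n0) z)" for z by (simp add: E_def)
    have i1: "integrable lborel (\<lambda>z. \<psi> z *\<^sub>R \<kappa> (F (n + n0) z))"
    proof (rule continuous_compact_support_integrable[OF td(5)])
      have "continuous_on UNIV (\<lambda>z. \<psi> z *\<^sub>R \<kappa> (F (n + n0) z))"
        by (intro continuous_on_vanishing_outside[OF cS that(2,3)]) (auto intro: isCont_o2 cF ck FB)
      then show "continuous_on S (\<lambda>z. \<psi> z *\<^sub>R \<kappa> (F (n + n0) z))" by (rule continuous_on_subset) auto
    qed (use that in auto)
    have i2: "integrable lborel (\<lambda>z. E n z * A (n + n0) z)"
    proof (rule continuous_compact_support_integrable[OF td(5)])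
      show "continuous_on S (\<lambda>z. E n z * A (n + n0) z)"
        by (intro continuous_on_mult continuous_on_subset[OF cE] continuous_on_subset[OF that(4)]) auto
    qed (use td(6) in \<open>auto simp: E_def\<close>)
    show ?thesis using that(1) i1 i2 unfolding E[symmetric] by (simp add: eq_neg_iff_add_eq_0)
  qed
  have e1: "(LINT z|lborel. \<phi>1 z *\<^sub>R \<kappa> (F (n + n0) z)) = - (LINT z|lborel. E n z * A1 (n + n0) z)" for n
    using integral_test_fun_partials(1)[OF PT[of n]] by (intro z td cA) (simp_all add: P1_def td)
  have e2: "(LINT z|lborel. \<phi>2 z *\<^sub>R \<kappa> (F (n + n0) z)) = - (LINT z|lborel. E n z * A2 (n + n0) z)" for n
    using integral_test_fun_partials(2)[OF PT[of n]] by (intro z td cA) (simp_all add: P2_def td)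
  show "(LINT z|lborel. \<phi>1 z *\<^sub>R \<kappa> (f z)) = - (LINT z|lborel. \<phi> z *\<^sub>R (deriv \<kappa> (f z) * D1 z))"
    using LIMSEQ_unique[OF lim1[OF td(3) td(7)]] tendsto_minus[OF lim2[OF L(2)]] unfolding e1 A1_def by blast
  show "(LINT z|lborel. \<phi>2 z *\<^sub>R \<kappa> (f z)) = - (LINT z|lborel. \<phi> z *\<^sub>R (deriv \<kappa> (f z) * D2 z))"
    using LIMSEQ_unique[OF lim1[OF td(4) td(8)]] tendsto_minus[OF lim2[OF L(3)]] unfolding e2 A2_def by blast
qed

lemma test_fun_mult:
  fixes u v :: "complex \<Rightarrow> real"
  assumes "test_fun u u1 u2 S" "\<And>z. has_partials v v1 v2 z" "continuous_on UNIV v1" "continuous_on UNIV v2"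
    "compact T" "T \<subseteq> S" "\<And>z. z \<in> S - T \<Longrightarrow> u z * v z = 0"
  shows "test_fun (\<lambda>z. u z * v z) (\<lambda>z. u1 z * v z + u z * v1 z) (\<lambda>z. u2 z * v z + u z * v2 z) T"
  unfolding test_fun_def
proof (intro conjI allI impI)
  have "continuous_on UNIV v"
    by (intro continuous_at_imp_continuous_on ballI has_partials_imp_continuous[OF assms(2)])
  then show "continuous_on UNIV (\<lambda>z. u1 z * v z + u z * v1 z)" "continuous_on UNIV (\<lambda>z. u2 z * v z + u z * v2 z)"
    using test_funD[OF assms(1)] assms(3,4) by (auto intro!: continuous_intros)
  show "u z * v z = 0" if "z \<notin> T" for z
    using test_funD(6)[OF assms(1), of z] assms(7)[of z] that by (cases "z \<in> S") auto
qed (use assms test_funD[OF assms(1)] in \<open>auto intro: has_partials_mult\<close>)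

lemma compact_L2_bounded_scaleR_integrable:
  fixes V :: "complex \<Rightarrow> complex" and \<phi> :: "complex \<Rightarrow> real"
  assumes T: "test_fun \<phi> \<phi>1 \<phi>2 S" and V: "compact_L2 r (\<lambda>z. indicator S z *\<^sub>R V z)"
  shows "integrable lborel (\<lambda>z. \<phi> z *\<^sub>R V z)" 
proof -
  note td = test_funD[OF T]
  obtain M where "\<And>z. norm (\<phi> z) \<le> M" using continuous_compact_support_bounded[OF td(5) td(2) td(6)] by blast
  then have "integrable lborel (\<lambda>z. \<phi> z *\<^sub>R (indicator S z *\<^sub>R V z))"
    by (intro integrable_bounded_scaleR[of \<phi> M] borel_measurable_continuous_onI td(2) compact_L2_integrable[OF V]) auto
  then show ?thesis unfolding test_fun_indicator(1)[OF T order_refl] .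
qed

text \<open>A partition of unity, built one disk at a time by induction over a finite cover:
  \<open>\<phi> * \<eta>\<close> is handled by the local hypothesis,
  \<open>\<phi> * (1 - \<eta>)\<close> by the remaining disks.\<close>

lemma weak_partials_local:
  fixes v V1 V2 :: "complex \<Rightarrow> complex"
  assumes G: "open G" and v: "continuous_on G v"
    and V: "\<And>C. compact C \<Longrightarrow> C \<subseteq> G \<Longrightarrow> \<exists>r. compact_L2 r (\<lambda>z. indicator C z *\<^sub>R V1 z) \<and> compact_L2 r (\<lambda>z. indicator C z *\<^sub>R V2 z)"
    and loc: "\<And>a. a \<in> G \<Longrightarrow> \<exists>d>0. \<forall>(\<phi>::complex \<Rightarrow> real) \<phi>1 \<phi>2 S. test_fun \<phi> \<phi>1 \<phi>2 S \<longrightarrow> S \<subseteq> ball a d \<inter> G \<longrightarrow>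
     (LINT z|lborel. \<phi>1 z *\<^sub>R v z) = - (LINT z|lborel. \<phi> z *\<^sub>R V1 z) \<and>
     (LINT z|lborel. \<phi>2 z *\<^sub>R v z) = - (LINT z|lborel. \<phi> z *\<^sub>R V2 z)"
  shows "weak_partials G v V1 V2"
proof -
  define I where "I \<phi> \<phi>1 \<phi>2 \<longleftrightarrow> (LINT z|lborel. \<phi>1 z *\<^sub>R v z) = - (LINT z|lborel. \<phi> z *\<^sub>R V1 z) \<and>
     (LINT z|lborel. \<phi>2 z *\<^sub>R v z) = - (LINT z|lborel. \<phi> z *\<^sub>R V2 z)" for \<phi> \<phi>1 \<phi>2 :: "complex \<Rightarrow> real"
  have "\<forall>a\<in>G. \<exists>d. d > 0 \<and> (\<forall>\<phi> \<phi>1 \<phi>2 S. test_fun \<phi> \<phi>1 \<phi>2 S \<longrightarrow> S \<subseteq> ball a d \<inter> G \<longrightarrow> I \<phi> \<phi>1 \<phi>2)"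
    using loc unfolding I_def by auto
  from bchoice[OF this] obtain d where d: "\<And>a. a \<in> G \<Longrightarrow> d a > 0"
    and dl: "\<And>a \<phi> \<phi>1 \<phi>2 S. a \<in> G \<Longrightarrow> test_fun \<phi> \<phi>1 \<phi>2 S \<Longrightarrow> S \<subseteq> ball a (d a) \<inter> G \<Longrightarrow> I \<phi> \<phi>1 \<phi>2"
    by blast
  \<comment> \<open>Thirds leave room for the cutoff: \<open>\<eta>\<close> is \<open>1\<close> on
    the disk of radius \<open>d a / 3\<close> and carried by that of radius
    \<open>2 * (d a / 3)\<close>, inside the disk where the local hypothesis holds.\<close>
  have main: "I \<phi> \<phi>1 \<phi>2"
    if "finite A" "A \<subseteq> G" "test_fun (\<phi>::complex \<Rightarrow> real) \<phi>1 \<phi>2 S" "S \<subseteq> G" "S \<subseteq> (\<Union>a\<in>A. ball a (d a / 3))" for A \<phi> \<phi>1 \<phi>2 S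
    using that
  proof (induction A arbitrary: \<phi> \<phi>1 \<phi>2 S rule: finite_induct)
    case empty
    then have "S = {}" by auto
    then have "\<phi> z = 0" "\<phi>1 z = 0" "\<phi>2 z = 0" for z using test_funD(6-8)[OF empty(2), of z] by auto
    then show ?case by (simp add: I_def)
  next
    case (insert a A)
    note T = insert.prems(2)
    note td = test_funD[OF T]
    have a: "a \<in> G" "d a > 0" using insert d by auto
    obtain \<eta> \<eta>1 \<eta>2 where \<eta>: "test_fun \<eta> \<eta>1 \<eta>2 (cball a (2 * (d a / 3)))" "\<And>z. z \<in> cball a (d a / 3) \<Longrightarrow> \<eta> z = (1::real)"
      using cutoff_exists[of "d a / 3" a] a by (metis zero_less_divide_iff zero_less_numeral)
    note he = test_funD[OF \<eta>(1)]
    let ?S1 = "S \<inter> cball a (2 * (d a / 3))" and ?S2 = "S - ball a (d a / 3)"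
    have T1: "test_fun (\<lambda>z. \<phi> z * \<eta> z) (\<lambda>z. \<phi>1 z * \<eta> z + \<phi> z * \<eta>1 z) (\<lambda>z. \<phi>2 z * \<eta> z + \<phi> z * \<eta>2 z) ?S1"
      by (rule test_fun_mult[OF T he(1)]) (use he td in \<open>auto intro: compact_Int\<close>)
    have hm: "has_partials (\<lambda>z. 1 - \<eta> z) (\<lambda>z. - \<eta>1 z) (\<lambda>z. - \<eta>2 z) z" for z
      using has_partials_diff[OF has_partials_const[of 1] he(1)] by simp
    have T2: "test_fun (\<lambda>z. \<phi> z * (1 - \<eta> z)) (\<lambda>z. \<phi>1 z * (1 - \<eta> z) + \<phi> z * (- \<eta>1 z)) (\<lambda>z. \<phi>2 z * (1 - \<eta> z) + \<phi> z * (- \<eta>2 z)) ?S2"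
      by (rule test_fun_mult[OF T hm]) (use he td \<eta>(2) in \<open>auto intro!: continuous_intros compact_diff\<close>)
    have 1: "(LINT z|lborel. (\<phi>1 z * \<eta> z + \<phi> z * \<eta>1 z) *\<^sub>R v z) = - (LINT z|lborel. (\<phi> z * \<eta> z) *\<^sub>R V1 z)"
      "(LINT z|lborel. (\<phi>2 z * \<eta> z + \<phi> z * \<eta>2 z) *\<^sub>R v z) = - (LINT z|lborel. (\<phi> z * \<eta> z) *\<^sub>R V2 z)"
      using dl[OF a(1) T1] insert.prems a(2) by (auto simp: subset_iff I_def)
    have 2: "(LINT z|lborel. (\<phi>1 z * (1 - \<eta> z) + \<phi> z * (- \<eta>1 z)) *\<^sub>R v z) = - (LINT z|lborel. (\<phi> z * (1 - \<eta> z)) *\<^sub>R V1 z)"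
      "(LINT z|lborel. (\<phi>2 z * (1 - \<eta> z) + \<phi> z * (- \<eta>2 z)) *\<^sub>R v z) = - (LINT z|lborel. (\<phi> z * (1 - \<eta> z)) *\<^sub>R V2 z)"
      using insert.IH[OF _ T2] insert.prems by (auto simp: I_def)
    have iv: "integrable lborel (\<lambda>z. u z *\<^sub>R v z)" if "continuous_on UNIV u" "\<And>z. z \<notin> S \<Longrightarrow> u z = 0" for u :: "complex \<Rightarrow> real"
      by (rule continuous_compact_support_integrable[OF td(5)])
         (use that insert.prems(3) v in \<open>auto intro!: continuous_intros intro: continuous_on_subset\<close>)
    have iT1: "integrable lborel (\<lambda>z. (\<phi>1 z * \<eta> z + \<phi> z * \<eta>1 z) *\<^sub>R v z)" "integrable lborel (\<lambda>z. (\<phi>2 z * \<eta> z + \<phi> z * \<eta>2 z) *\<^sub>R v z)"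
      by (rule iv; use he(2-4)[of UNIV] td(2-4)[of UNIV] td(6-8) in \<open>auto intro!: continuous_intros\<close>)+
    have iT2: "integrable lborel (\<lambda>z. (\<phi>1 z * (1 - \<eta> z) + \<phi> z * (- \<eta>1 z)) *\<^sub>R v z)" "integrable lborel (\<lambda>z. (\<phi>2 z * (1 - \<eta> z) + \<phi> z * (- \<eta>2 z)) *\<^sub>R v z)"
      by (rule iv; use he(2-4)[of UNIV] td(2-4)[of UNIV] td(6-8) in \<open>auto intro!: continuous_intros\<close>)+
    obtain r1 where r1: "compact_L2 r1 (\<lambda>z. indicator ?S1 z *\<^sub>R V1 z)" "compact_L2 r1 (\<lambda>z. indicator ?S1 z *\<^sub>R V2 z)"
      using V[OF test_funD(5)[OF T1]] insert.prems(3) by blast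
    obtain r2 where r2: "compact_L2 r2 (\<lambda>z. indicator ?S2 z *\<^sub>R V1 z)" "compact_L2 r2 (\<lambda>z. indicator ?S2 z *\<^sub>R V2 z)"
      using V[OF test_funD(5)[OF T2]] insert.prems(3) by blast
    note j1 = compact_L2_bounded_scaleR_integrable[OF T1 r1(1)] compact_L2_bounded_scaleR_integrable[OF T1 r1(2)]
    note j2 = compact_L2_bounded_scaleR_integrable[OF T2 r2(1)] compact_L2_bounded_scaleR_integrable[OF T2 r2(2)]
    have s: "(LINT z|lborel. \<phi>1 z *\<^sub>R v z) = (LINT z|lborel. (\<phi>1 z * \<eta> z + \<phi> z * \<eta>1 z) *\<^sub>R v z) + (LINT z|lborel. (\<phi>1 z * (1 - \<eta> z) + \<phi> z * (- \<eta>1 z)) *\<^sub>R v z)"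
      "(LINT z|lborel. \<phi>2 z *\<^sub>R v z) = (LINT z|lborel. (\<phi>2 z * \<eta> z + \<phi> z * \<eta>2 z) *\<^sub>R v z) + (LINT z|lborel. (\<phi>2 z * (1 - \<eta> z) + \<phi> z * (- \<eta>2 z)) *\<^sub>R v z)"
      by (subst Bochner_Integration.integral_add[OF iT1(1) iT2(1), symmetric] Bochner_Integration.integral_add[OF iT1(2) iT2(2), symmetric],
          rule Bochner_Integration.integral_cong[OF refl], simp add: algebra_simps)+
    have t: "(LINT z|lborel. \<phi> z *\<^sub>R V1 z) = (LINT z|lborel. (\<phi> z * \<eta> z) *\<^sub>R V1 z) + (LINT z|lborel. (\<phi> z * (1 - \<eta> z)) *\<^sub>R V1 z)"
      "(LINT z|lborel. \<phi> z *\<^sub>R V2 z) = (LINT z|lborel. (\<phi> z * \<eta> z) *\<^sub>R V2 z) + (LINT z|lborel. (\<phi> z * (1 - \<eta> z)) *\<^sub>R V2 z)"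
      by (subst Bochner_Integration.integral_add[OF j1(1) j2(1), symmetric] Bochner_Integration.integral_add[OF j1(2) j2(2), symmetric],
          rule Bochner_Integration.integral_cong[OF refl], simp add: algebra_simps)+
    show ?case unfolding I_def s t 1 2 by simp
  qed
  show ?thesis
  proof (rule weak_partialsI)
    fix \<phi> :: "complex \<Rightarrow> real" and \<phi>1 \<phi>2 S
    assume T: "test_fun \<phi> \<phi>1 \<phi>2 S" and S: "S \<subseteq> G"
    have "S \<subseteq> (\<Union>a\<in>S. ball a (d a / 3))" using d S by force
    then obtain A where "A \<subseteq> S" "finite A" "S \<subseteq> (\<Union>a\<in>A. ball a (d a / 3))"
      using compactE_image[OF test_funD(5)[OF T], of S "\<lambda>a. ball a (d a / 3)"] by auto
    then show "(LINT z|lborel. \<phi>1 z *\<^sub>R v z) = - (LINT z|lborel. \<phi> z *\<^sub>R V1 z) \<and>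
     (LINT z|lborel. \<phi>2 z *\<^sub>R v z) = - (LINT z|lborel. \<phi> z *\<^sub>R V2 z)"
      using main[OF _ _ T S] S unfolding I_def by blast
  qed
qed

text \<open>As \<open>deriv \<Phi>\<close> does not vanish along \<open>v\<close>, locally
  \<open>v z = \<kappa> (f z)\<close> for a holomorphic inverse branch \<open>\<kappa>\<close>,
  selected by continuity of \<open>v\<close>. The chain rule gives the derivatives
  \<open>D1 z / deriv \<Phi> (v z)\<close> and \<open>D2 z / deriv \<Phi> (v z)\<close>; the branch
  has disappeared from these formulas, so the local identities patch together.\<close>

lemma sobolev_lift:
  assumes f: "sobolev_12_loc G f D1 D2" and G: "open G" and v: "continuous_on G v"
    and U: "open U" "v ` G \<subseteq> U" and \<Phi>: "\<Phi> holomorphic_on U"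
    and nz: "\<And>z. z \<in> G \<Longrightarrow> deriv \<Phi> (v z) \<noteq> 0" and eq: "\<And>z. z \<in> G \<Longrightarrow> f z = \<Phi> (v z)"
  shows "sobolev_12_loc G v (\<lambda>z. D1 z / deriv \<Phi> (v z)) (\<lambda>z. D2 z / deriv \<Phi> (v z))"
proof -
  define w where "w z = inverse (deriv \<Phi> (v z))" for z
  have cd: "continuous_on G (\<lambda>z. deriv \<Phi> (v z))"
    using continuous_on_compose2[OF holomorphic_on_imp_continuous_on[OF holomorphic_deriv[OF \<Phi> U(1)]] v] U(2) by blast
  then have cw: "continuous_on G w" unfolding w_def using nz by (intro continuous_intros) auto
  have wm: "set_borel_measurable lborel G (\<lambda>z. D z / deriv \<Phi> (v z))" if "set_borel_measurable lborel G D" for D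
  proof -
    have [measurable]: "(\<lambda>z. indicator G z *\<^sub>R w z) \<in> borel_measurable borel"
      using cw G by (intro borel_measurable_continuous_on_indicator) auto
    have [measurable]: "(\<lambda>z. indicator G z *\<^sub>R D z) \<in> borel_measurable borel" using that by (simp add: set_borel_measurable_def)
    have "(\<lambda>z. (indicator G z *\<^sub>R D z) * (indicator G z *\<^sub>R w z)) \<in> borel_measurable borel" by measurable
    moreover have "(indicator G z *\<^sub>R D z) * (indicator G z *\<^sub>R w z) = indicator G z *\<^sub>R (D z / deriv \<Phi> (v z))" for z
      by (auto simp: indicator_def w_def divide_inverse)
    ultimately show ?thesis by (simp add: set_borel_measurable_def)
  qed
  have wi: "set_integrable lborel C (\<lambda>z. (cmod (D z / deriv \<Phi> (v z)))\<^sup>2)"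
    if "set_borel_measurable lborel G D" "set_integrable lborel C (\<lambda>z. (cmod (D z))\<^sup>2)" "compact C" "C \<subseteq> G" for C D
  proof -
    have "bounded (w ` C)"
      using compact_continuous_image[OF continuous_on_subset[OF cw \<open>C \<subseteq> G\<close>] \<open>compact C\<close>] by (rule compact_imp_bounded)
    then obtain M where M: "\<And>z. z \<in> C \<Longrightarrow> cmod (w z) \<le> M" unfolding bounded_iff by blast
    have [measurable]: "C \<in> sets borel" using that(3) by (simp add: borel_closed compact_imp_closed)
    have [measurable]: "(\<lambda>z. indicator G z *\<^sub>R (D z / deriv \<Phi> (v z))) \<in> borel_measurable borel"
      using wm[OF that(1)] by (simp add: set_borel_measurable_def)
    have "(\<lambda>z. indicator C z *\<^sub>R (cmod (indicator G z *\<^sub>R (D z / deriv \<Phi> (v z))))\<^sup>2) \<in> borel_measurable borel" by measurable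
    moreover have "indicator C z *\<^sub>R (cmod (indicator G z *\<^sub>R (D z / deriv \<Phi> (v z))))\<^sup>2 = indicator C z *\<^sub>R (cmod (D z / deriv \<Phi> (v z)))\<^sup>2" for z
      using that(4) by (auto simp: indicator_def)
    ultimately have m: "(\<lambda>z. indicator C z *\<^sub>R (cmod (D z / deriv \<Phi> (v z)))\<^sup>2) \<in> borel_measurable borel" by (simp only:)
    show ?thesis
      unfolding set_integrable_def
    proof (rule Bochner_Integration.integrable_bound[where f = "\<lambda>z. M\<^sup>2 * (indicator C z *\<^sub>R (cmod (D z))\<^sup>2)"])
      show "integrable lborel (\<lambda>z. M\<^sup>2 * (indicator C z *\<^sub>R (cmod (D z))\<^sup>2))" using that(2) by (simp add: set_integrable_def)
      show "AE z in lborel. norm (indicator C z *\<^sub>R (cmod (D z / deriv \<Phi> (v z)))\<^sup>2) \<le> norm (M\<^sup>2 * (indicator C z *\<^sub>R (cmod (D z))\<^sup>2))"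
      proof (rule AE_I2)
        fix z
        show "norm (indicator C z *\<^sub>R (cmod (D z / deriv \<Phi> (v z)))\<^sup>2) \<le> norm (M\<^sup>2 * (indicator C z *\<^sub>R (cmod (D z))\<^sup>2))"
        proof (cases "z \<in> C")
          case True
          have "(cmod (D z / deriv \<Phi> (v z)))\<^sup>2 = (cmod (w z))\<^sup>2 * (cmod (D z))\<^sup>2"
            by (simp add: w_def norm_mult norm_inverse divide_inverse power_mult_distrib mult.commute)
          also have "\<dots> \<le> M\<^sup>2 * (cmod (D z))\<^sup>2" using M[OF True] by (intro mult_right_mono power_mono) auto
          finally show ?thesis using True by simp
        qed simp
      qed
    qed (use m in simp)
  qed
  have f': "set_borel_measurable lborel G D1" "set_borel_measurable lborel G D2"
     "\<And>C. compact C \<Longrightarrow> C \<subseteq> G \<Longrightarrow> set_integrable lborel C (\<lambda>z. (cmod (D1 z))\<^sup>2)"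
     "\<And>C. compact C \<Longrightarrow> C \<subseteq> G \<Longrightarrow> set_integrable lborel C (\<lambda>z. (cmod (D2 z))\<^sup>2)"
     "continuous_on G f" "weak_partials G f D1 D2"
    using f by (auto simp: sobolev_12_loc_def)
  have pre: "compact_L2 r (\<lambda>z. indicator C z *\<^sub>R (D z / deriv \<Phi> (v z)))"
    if "set_borel_measurable lborel G D" "\<And>C. compact C \<Longrightarrow> C \<subseteq> G \<Longrightarrow> set_integrable lborel C (\<lambda>z. (cmod (D z))\<^sup>2)" "compact C" "C \<subseteq> G" "C \<subseteq> cball 0 r" for C D r
  proof -
    have [measurable]: "C \<in> sets borel" using that(3) by (simp add: borel_closed compact_imp_closed)
    have [measurable]: "(\<lambda>z. indicator G z *\<^sub>R (D z / deriv \<Phi> (v z))) \<in> borel_measurable borel"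
      using wm[OF that(1)] by (simp add: set_borel_measurable_def)
    have "(\<lambda>z. indicator C z *\<^sub>R (indicator G z *\<^sub>R (D z / deriv \<Phi> (v z)))) \<in> borel_measurable borel" by measurable
    moreover have "indicator C z *\<^sub>R (indicator G z *\<^sub>R (D z / deriv \<Phi> (v z))) = indicator C z *\<^sub>R (D z / deriv \<Phi> (v z))" for z
      using that(4) by (auto simp: indicator_def)
    moreover have "(cmod (indicator C z *\<^sub>R (D z / deriv \<Phi> (v z))))\<^sup>2 = indicator C z *\<^sub>R (cmod (D z / deriv \<Phi> (v z)))\<^sup>2" for z
      by (auto simp: indicator_def)
    moreover have "indicator C z *\<^sub>R (D z / deriv \<Phi> (v z)) = 0" if "z \<notin> cball 0 r" for z
      using that \<open>C \<subseteq> cball 0 r\<close> by (auto simp: indicator_def)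
    ultimately show ?thesis using wi[OF that(1) that(2)[OF that(3,4)] that(3,4)]
      by (simp only: compact_L2_def set_integrable_def simp_thms) auto
  qed
  have "weak_partials G v (\<lambda>z. D1 z / deriv \<Phi> (v z)) (\<lambda>z. D2 z / deriv \<Phi> (v z))"
  proof (rule weak_partials_local[OF G v])
    fix C assume C: "compact C" "C \<subseteq> G"
    obtain r where "r > 0" "C \<subseteq> cball 0 r" using compact_enclosed_cball[OF C(1)] .
    then show "\<exists>r. compact_L2 r (\<lambda>z. indicator C z *\<^sub>R (D1 z / deriv \<Phi> (v z))) \<and> compact_L2 r (\<lambda>z. indicator C z *\<^sub>R (D2 z / deriv \<Phi> (v z)))"
      using pre[OF f'(1,3) C] pre[OF f'(2,4) C] by blast
  next
    fix a assume a: "a \<in> G"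
    obtain \<rho> where \<rho>: "\<rho> > 0" "ball (v a) \<rho> \<subseteq> U" "inj_on \<Phi> (ball (v a) \<rho>)"
      using has_complex_derivative_locally_injective[OF \<Phi> _ U(1) nz[OF a]] U(2) a by blast
    have hb: "\<Phi> holomorphic_on ball (v a) \<rho>" using \<Phi> \<rho>(2) holomorphic_on_subset by blast
    obtain \<kappa> where \<kappa>: "\<kappa> holomorphic_on (\<Phi> ` ball (v a) \<rho>)"
      "\<And>z. z \<in> ball (v a) \<rho> \<Longrightarrow> deriv \<Phi> z * deriv \<kappa> (\<Phi> z) = 1" "\<And>z. z \<in> ball (v a) \<rho> \<Longrightarrow> \<kappa> (\<Phi> z) = z"
      using holomorphic_has_inverse[OF hb open_ball \<rho>(3)] by blast
    have ob: "open (\<Phi> ` ball (v a) \<rho>)" using open_mapping_thm3[OF hb open_ball \<rho>(3)] .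
    obtain d where d: "d > 0" "\<And>z. z \<in> G \<Longrightarrow> dist z a < d \<Longrightarrow> dist (v z) (v a) < \<rho>"
      using v a \<rho>(1) unfolding continuous_on_iff by blast
    show "\<exists>d>0. \<forall>(\<phi>::complex \<Rightarrow> real) \<phi>1 \<phi>2 S. test_fun \<phi> \<phi>1 \<phi>2 S \<longrightarrow> S \<subseteq> ball a d \<inter> G \<longrightarrow>
     (LINT z|lborel. \<phi>1 z *\<^sub>R v z) = - (LINT z|lborel. \<phi> z *\<^sub>R (D1 z / deriv \<Phi> (v z))) \<and>
     (LINT z|lborel. \<phi>2 z *\<^sub>R v z) = - (LINT z|lborel. \<phi> z *\<^sub>R (D2 z / deriv \<Phi> (v z)))"
    proof (intro exI[of _ d] conjI[OF d(1)] allI impI conjI)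
      fix \<phi> :: "complex \<Rightarrow> real" and \<phi>1 \<phi>2 S
      assume T: "test_fun \<phi> \<phi>1 \<phi>2 S" and S: "S \<subseteq> ball a d \<inter> G"
      note td = test_funD[OF T]
      have vS: "v z \<in> ball (v a) \<rho>" if "z \<in> S" for z using that S d(2)[of z] by (auto simp: dist_commute subset_iff)
      have fS: "f ` S \<subseteq> \<Phi> ` ball (v a) \<rho>" using vS eq S by auto
      have k1: "\<kappa> (f z) = v z" "deriv \<kappa> (f z) = inverse (deriv \<Phi> (v z))" if "z \<in> S" for z
        using \<kappa>(2,3)[OF vS[OF that]] eq[of z] S that nz[of z] by (auto simp: field_simps)
      have c: "\<phi>1 z *\<^sub>R \<kappa> (f z) = \<phi>1 z *\<^sub>R v z" "\<phi>2 z *\<^sub>R \<kappa> (f z) = \<phi>2 z *\<^sub>R v z"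
        "\<phi> z *\<^sub>R (deriv \<kappa> (f z) * D z) = \<phi> z *\<^sub>R (D z / deriv \<Phi> (v z))" for z D
        using k1[of z] td(6-8)[of z] by (cases "z \<in> S"; simp add: divide_inverse mult.commute)+
      have "S \<subseteq> G" using S by auto
      from sobolev_chain_local[OF f G T this ob fS \<kappa>(1)]
      show "(LINT z|lborel. \<phi>1 z *\<^sub>R v z) = - (LINT z|lborel. \<phi> z *\<^sub>R (D1 z / deriv \<Phi> (v z)))"
       "(LINT z|lborel. \<phi>2 z *\<^sub>R v z) = - (LINT z|lborel. \<phi> z *\<^sub>R (D2 z / deriv \<Phi> (v z)))"
        unfolding c by auto
    qed
  qed
  then show ?thesis
    unfolding sobolev_12_loc_def using v wm f' wi by auto
qed

lemma jacobian_scale: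
  "(cmod w)\<^sup>2 * (Re a * Im b - Re b * Im a) = Re (a * w) * Im (b * w) - Re (b * w) * Im (a * w)"
  unfolding cmod_power2 by (simp add: algebra_simps power2_eq_square)

text \<open>Dividing both partial derivatives by the complex number
  \<open>deriv \<Phi> (v z)\<close> composes the differential with a similarity: the squared
  operator norm and the Jacobian pick up the same factor, so \<open>K\<close> is unchanged.\<close>

lemma quasiregular_lift:
  assumes f: "quasiregular K G f" and v: "continuous_on G v"
    and U: "open U" "v ` G \<subseteq> U" and \<Phi>: "\<Phi> holomorphic_on U"
    and nz: "\<And>z. z \<in> G \<Longrightarrow> deriv \<Phi> (v z) \<noteq> 0" and eq: "\<And>z. z \<in> G \<Longrightarrow> f z = \<Phi> (v z)"
  shows "quasiregular K G v"
proof -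
  obtain D1 D2 where D: "sobolev_12_loc G f D1 D2"
    "AE z in lborel. z \<in> G \<longrightarrow> (onorm (\<lambda>h. Re h *\<^sub>R D1 z + Im h *\<^sub>R D2 z))\<^sup>2
             \<le> K * (Re (D1 z) * Im (D2 z) - Re (D2 z) * Im (D1 z))"
    and K: "K \<ge> 1" and G: "open G" "connected G"
    using f by (auto simp: quasiregular_def)
  let ?c = "\<lambda>z. deriv \<Phi> (v z)"
  have s: "sobolev_12_loc G v (\<lambda>z. D1 z / ?c z) (\<lambda>z. D2 z / ?c z)"
    by (rule sobolev_lift[OF D(1) G(1) v U \<Phi> nz eq])
  have "AE z in lborel. z \<in> G \<longrightarrow> (onorm (\<lambda>h. Re h *\<^sub>R (D1 z / ?c z) + Im h *\<^sub>R (D2 z / ?c z)))\<^sup>2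
             \<le> K * (Re (D1 z / ?c z) * Im (D2 z / ?c z) - Re (D2 z / ?c z) * Im (D1 z / ?c z))"
    using D(2)
  proof eventually_elim
    case (elim z)
    show ?case
    proof
      assume z: "z \<in> G"
      let ?w = "inverse (?c z)" and ?L = "\<lambda>h. Re h *\<^sub>R D1 z + Im h *\<^sub>R D2 z"
      have bl: "bounded_linear ?L" by (rule partials_bounded_linear)
      have "onorm (\<lambda>h. Re h *\<^sub>R (D1 z / ?c z) + Im h *\<^sub>R (D2 z / ?c z)) \<le> cmod ?w * onorm ?L"
      proof (rule onorm_bound)
        fix h
        have "Re h *\<^sub>R (D1 z / ?c z) + Im h *\<^sub>R (D2 z / ?c z) = ?w * ?L h" by (simp add: divide_inverse scaleR_conv_of_real algebra_simps)
        then have "norm (Re h *\<^sub>R (D1 z / ?c z) + Im h *\<^sub>R (D2 z / ?c z)) = cmod ?w * cmod (?L h)" by (simp only: norm_mult)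
        also have "\<dots> \<le> cmod ?w * (onorm ?L * cmod h)" by (intro mult_left_mono onorm[OF bl]) auto
        finally show "norm (Re h *\<^sub>R (D1 z / ?c z) + Im h *\<^sub>R (D2 z / ?c z)) \<le> cmod ?w * onorm ?L * cmod h" by (simp only: mult.assoc)
      qed (use onorm_pos_le[OF bl] in simp)
      then have "(onorm (\<lambda>h. Re h *\<^sub>R (D1 z / ?c z) + Im h *\<^sub>R (D2 z / ?c z)))\<^sup>2 \<le> (cmod ?w * onorm ?L)\<^sup>2"
        by (intro power_mono onorm_pos_le partials_bounded_linear)
      also have "\<dots> \<le> (cmod ?w)\<^sup>2 * (K * (Re (D1 z) * Im (D2 z) - Re (D2 z) * Im (D1 z)))"
        unfolding power_mult_distrib using elim z by (intro mult_left_mono) auto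
      also have "\<dots> = K * ((cmod ?w)\<^sup>2 * (Re (D1 z) * Im (D2 z) - Re (D2 z) * Im (D1 z)))" by simp
      also have "(cmod ?w)\<^sup>2 * (Re (D1 z) * Im (D2 z) - Re (D2 z) * Im (D1 z)) =
         Re (D1 z * ?w) * Im (D2 z * ?w) - Re (D2 z * ?w) * Im (D1 z * ?w)"
        by (rule jacobian_scale)
      finally show "(onorm (\<lambda>h. Re h *\<^sub>R (D1 z / ?c z) + Im h *\<^sub>R (D2 z / ?c z)))\<^sup>2
             \<le> K * (Re (D1 z / ?c z) * Im (D2 z / ?c z) - Re (D2 z / ?c z) * Im (D1 z / ?c z))"
        by (simp only: divide_inverse)
    qed
  qed
  then show ?thesis unfolding quasiregular_def using K G s by blast
qed

section \<open>Energy estimates\<close>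

text \<open>An instance of \<open>sobolev_lift\<close> for a translation; it lets the energy
  estimates measure the oscillation of \<open>v\<close> about any constant.\<close>

lemma sobolev_diff_const:
  assumes "sobolev_12_loc G v V1 V2" "open G"
  shows "sobolev_12_loc G (\<lambda>z. v z - c) V1 V2"
proof -
  have d: "deriv (\<lambda>w. w + c) x = 1" for x :: complex
    by (intro DERIV_imp_deriv) (auto intro!: derivative_eq_intros)
  have "sobolev_12_loc G (\<lambda>z. v z - c) (\<lambda>z. V1 z / deriv (\<lambda>w. w + c) (v z - c)) (\<lambda>z. V2 z / deriv (\<lambda>w. w + c) (v z - c))"
    by (rule sobolev_lift[OF assms, of _ UNIV])
       (use assms in \<open>auto simp: sobolev_12_loc_def d intro!: continuous_intros holomorphic_intros\<close>)
  then show ?thesis by (simp add: d)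
qed

lemma compact_L2_test_fun_scaleR:
  fixes V :: "complex \<Rightarrow> complex" and \<phi> :: "complex \<Rightarrow> real"
  assumes V: "compact_L2 r (\<lambda>z. indicator D z *\<^sub>R V z)" and "compact S" "S \<subseteq> D"
    "continuous_on UNIV \<phi>" "\<And>z. z \<notin> S \<Longrightarrow> \<phi> z = 0"
  shows "compact_L2 r (\<lambda>z. \<phi> z *\<^sub>R V z)"
proof -
  obtain M where M: "\<And>z. norm (\<phi> z) \<le> M"
    using continuous_compact_support_bounded[OF assms(2) continuous_on_subset[OF assms(4)] assms(5)] by blast
  have eq: "\<phi> z *\<^sub>R V z = \<phi> z *\<^sub>R (indicator D z *\<^sub>R V z)" for z
    using assms(3,5) by (cases "z \<in> D") auto
  have [measurable]: "(\<lambda>z. indicator D z *\<^sub>R V z) \<in> borel_measurable borel" "\<phi> \<in> borel_measurable borel"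
    using V assms(4) by (auto simp: compact_L2_def intro: borel_measurable_continuous_onI)
  have m: "(\<lambda>z. \<phi> z *\<^sub>R V z) \<in> borel_measurable borel" unfolding eq by measurable
  have "integrable lborel (\<lambda>z. (cmod (\<phi> z *\<^sub>R V z))\<^sup>2)"
  proof (rule Bochner_Integration.integrable_bound[where f = "\<lambda>z. M\<^sup>2 * (cmod (indicator D z *\<^sub>R V z))\<^sup>2"])
    show "integrable lborel (\<lambda>z. M\<^sup>2 * (cmod (indicator D z *\<^sub>R V z))\<^sup>2)"
      using V by (simp only: compact_L2_def integrable_mult_right)
    show "AE z in lborel. norm ((cmod (\<phi> z *\<^sub>R V z))\<^sup>2) \<le> norm (M\<^sup>2 * (cmod (indicator D z *\<^sub>R V z))\<^sup>2)"
    proof (rule AE_I2)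
      fix z
      have "(cmod (\<phi> z *\<^sub>R V z))\<^sup>2 = \<bar>\<phi> z\<bar>\<^sup>2 * (cmod (indicator D z *\<^sub>R V z))\<^sup>2"
        unfolding eq by (simp add: power_mult_distrib)
      also have "\<dots> \<le> M\<^sup>2 * (cmod (indicator D z *\<^sub>R V z))\<^sup>2"
        using M[of z] by (intro mult_right_mono power_mono) auto
      finally show "norm ((cmod (\<phi> z *\<^sub>R V z))\<^sup>2) \<le> norm (M\<^sup>2 * (cmod (indicator D z *\<^sub>R V z))\<^sup>2)" by simp
    qed
    show "(\<lambda>z. (cmod (\<phi> z *\<^sub>R V z))\<^sup>2) \<in> borel_measurable lborel" using m by measurable
  qed
  moreover have "\<phi> z *\<^sub>R V z = 0" if "z \<notin> cball 0 r" for z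
    unfolding eq using V that by (auto simp: compact_L2_def)
  ultimately show ?thesis using m by (simp add: compact_L2_def)
qed

lemma compact_L2_Re:
  assumes "compact_L2 r h" shows "compact_L2 r (\<lambda>z. complex_of_real (Re (h z)))"
proof -
  have [measurable]: "h \<in> borel_measurable borel" using assms by (simp add: compact_L2_def)
  have "integrable lborel (\<lambda>z. (cmod (complex_of_real (Re (h z))))\<^sup>2)"
    by (rule Bochner_Integration.integrable_bound[where f = "\<lambda>z. (cmod (h z))\<^sup>2"])
       (use assms in \<open>auto simp: compact_L2_def cmod_power2\<close>)
  then show ?thesis using assms by (auto simp: compact_L2_def)
qed

lemma mconv_Re:
  assumes "integrable lborel h"
  shows "mconv (moll n) (\<lambda>z. complex_of_real (Re (h z))) z = complex_of_real (Re (mconv (moll n) h z))"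
proof -
  note td = test_funD[OF test_fun_moll(1)[of n]]
  have i: "integrable lborel (\<lambda>\<zeta>. moll n (\<zeta> - z) *\<^sub>R h \<zeta>)"
    by (rule mconv_integrable[OF td(5) td(2) td(6) assms])
  have "Re (LINT \<zeta>|lborel. moll n (\<zeta> - z) *\<^sub>R h \<zeta>) = (LINT \<zeta>|lborel. Re (moll n (\<zeta> - z) *\<^sub>R h \<zeta>))"
    by (rule integral_bounded_linear[OF bounded_linear_Re i, symmetric])
  then show ?thesis unfolding mconv_def
    by (simp add: scaleR_conv_of_real integral_complex_of_real[symmetric] del: integral_complex_of_real)
qed

text \<open>Integration by parts for the Jacobian. Mollifying the real part makes the mixed second
  partials, which cancel, available.\<close>

lemma jacobian_by_parts:
  fixes \<psi> :: "complex \<Rightarrow> real"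
  assumes v: "sobolev_12_loc G v V1 V2" and G: "open G" and T: "test_fun \<psi> \<psi>1 \<psi>2 S" and S: "S \<subseteq> G"
  shows "integrable lborel (\<lambda>z. \<psi> z * (Re (V1 z) * Im (V2 z) - Re (V2 z) * Im (V1 z)))"
    "integrable lborel (\<lambda>z. Im (v z) * (\<psi>2 z * Re (V1 z) - \<psi>1 z * Re (V2 z)))"
    "(LINT z|lborel. \<psi> z * (Re (V1 z) * Im (V2 z) - Re (V2 z) * Im (V1 z))) =
     - (LINT z|lborel. Im (v z) * (\<psi>2 z * Re (V1 z) - \<psi>1 z * Re (V2 z)))"
proof -
  note td = test_funD[OF T]
  obtain D e where D: "compact D" "D \<subseteq> G" "S \<subseteq> D" "e > 0" "\<And>z. z \<in> S \<Longrightarrow> cball z e \<subseteq> D"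
    using compact_neighbourhood[OF td(5) G S] by blast
  obtain r where r: "r > 0" "D \<subseteq> cball 0 r" using compact_enclosed_cball[OF D(1)] .
  note L = sobolev_restrict[OF v D(1,2) r(2)]
  let ?h = "\<lambda>z. indicator D z *\<^sub>R v z"
  let ?R1 = "\<lambda>z. complex_of_real (Re (indicator D z *\<^sub>R V1 z))" and ?R2 = "\<lambda>z. complex_of_real (Re (indicator D z *\<^sub>R V2 z))"
  note ih = compact_L2_integrable[OF L(1)]
  have wp: "weak_partials G v V1 V2" using v by (simp add: sobolev_12_loc_def)
  have cv: "continuous_on D v" using v D(2) by (auto simp: sobolev_12_loc_def intro: continuous_on_subset)
  obtain n0 where n0: "\<And>n. n \<ge> n0 \<Longrightarrow> (1/2::real) ^ n < e"
    using order_tendstoD(2)[OF LIMSEQ_power_zero[of "1/2::real"] D(4)] by (auto simp: eventually_sequentially)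
  have F: "compact_L2 r (\<lambda>z. \<psi>2 z *\<^sub>R v z)" "compact_L2 r (\<lambda>z. \<psi>1 z *\<^sub>R v z)"
     "compact_L2 r (\<lambda>z. \<psi> z *\<^sub>R V1 z)" "compact_L2 r (\<lambda>z. \<psi> z *\<^sub>R V2 z)"
    by (rule compact_L2_test_fun_scaleR[OF L(1) td(5) D(3) td(4) td(8)] compact_L2_test_fun_scaleR[OF L(1) td(5) D(3) td(3) td(7)]
        compact_L2_test_fun_scaleR[OF L(2) td(5) D(3) td(2) td(6)] compact_L2_test_fun_scaleR[OF L(3) td(5) D(3) td(2) td(6)] | assumption)+
  note R1 = compact_L2_Re[OF L(2)] and R2 = compact_L2_Re[OF L(3)]
  \<comment> \<open>The weak derivatives of \<open>v\<close> are tested against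
    \<open>\<psi> * Mx\<close> in the second direction and \<open>\<psi> * My\<close> in the first,
    \<open>Mx\<close> and \<open>My\<close> being the partial derivatives of the mollified real
    part. Both identities contain the integral of \<open>\<psi> * Mxy * v\<close>, which drops out
    of their difference.\<close>
  have id: "(LINT z|lborel. (\<psi>2 z *\<^sub>R v z) * mconv (moll (n + n0)) ?R1 z) - (LINT z|lborel. (\<psi>1 z *\<^sub>R v z) * mconv (moll (n + n0)) ?R2 z)
     = (LINT z|lborel. (\<psi> z *\<^sub>R V1 z) * mconv (moll (n + n0)) ?R2 z) - (LINT z|lborel. (\<psi> z *\<^sub>R V2 z) * mconv (moll (n + n0)) ?R1 z)" for n
  proof -
    let ?n = "n + n0"
    define Mx My Mxx Mxy Myy where M: "Mx z = Re (- mconv (moll_x ?n) ?h z)" "My z = Re (- mconv (moll_y ?n) ?h z)"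
      "Mxx z = Re (mconv (moll_xx ?n) ?h z)" "Mxy z = Re (mconv (moll_xy ?n) ?h z)" "Myy z = Re (mconv (moll_yy ?n) ?h z)" for z
    have hx: "has_partials Mx Mxx Mxy z" "has_partials My Mxy Myy z" for z
      using has_partials_bounded_linear[OF bounded_linear_Re has_partials_minus[OF has_partials_mconv[OF test_fun_moll(2)[of ?n] ih]], of z]
        has_partials_bounded_linear[OF bounded_linear_Re has_partials_minus[OF has_partials_mconv[OF test_fun_moll(3)[of ?n] ih]], of z]
      unfolding M[abs_def] by simp_all
    have cM: "continuous_on UNIV Mxx" "continuous_on UNIV Mxy" "continuous_on UNIV Myy"
      unfolding M[abs_def]
      using continuous_on_Re[OF continuous_on_mconv[OF test_funD(5,3,7)[OF test_fun_moll(2)[of ?n]] ih, of UNIV]]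
        continuous_on_Re[OF continuous_on_mconv[OF test_funD(5,4,8)[OF test_fun_moll(2)[of ?n]] ih, of UNIV]]
        continuous_on_Re[OF continuous_on_mconv[OF test_funD(5,4,8)[OF test_fun_moll(3)[of ?n]] ih, of UNIV]]
      by simp_all
    have Mc: "continuous_on UNIV Mx" "continuous_on UNIV My"
      by (intro continuous_at_imp_continuous_on ballI has_partials_imp_continuous[OF hx(1)] has_partials_imp_continuous[OF hx(2)])+
    have Tx: "test_fun (\<lambda>z. \<psi> z * Mx z) (\<lambda>z. \<psi>1 z * Mx z + \<psi> z * Mxx z) (\<lambda>z. \<psi>2 z * Mx z + \<psi> z * Mxy z) S"
      by (rule test_fun_mult[OF T hx(1) cM(1,2) td(5)]) auto
    have Ty: "test_fun (\<lambda>z. \<psi> z * My z) (\<lambda>z. \<psi>1 z * My z + \<psi> z * Mxy z) (\<lambda>z. \<psi>2 z * My z + \<psi> z * Myy z) S"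
      by (rule test_fun_mult[OF T hx(2) cM(2,3) td(5)]) auto
    have e1: "(LINT z|lborel. (\<psi>2 z * Mx z + \<psi> z * Mxy z) *\<^sub>R v z) = - (LINT z|lborel. (\<psi> z * Mx z) *\<^sub>R V2 z)"
      by (rule sobolev_weak(2)[OF wp Tx S])
    have e2: "(LINT z|lborel. (\<psi>1 z * My z + \<psi> z * Mxy z) *\<^sub>R v z) = - (LINT z|lborel. (\<psi> z * My z) *\<^sub>R V1 z)"
      by (rule sobolev_weak(1)[OF wp Ty S])
    have iv: "integrable lborel (\<lambda>z. (u z * k z) *\<^sub>R v z)" if "continuous_on UNIV u" "\<And>z. z \<notin> S \<Longrightarrow> u z = 0" "continuous_on UNIV k" for u k :: "complex \<Rightarrow> real"
      by (rule continuous_compact_support_integrable[OF td(5)])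
         (use that cv D(3) in \<open>auto intro!: continuous_intros intro: continuous_on_subset\<close>)
    note i1 = iv[OF td(4) td(8) Mc(1)] iv[OF td(3) td(7) Mc(2)] iv[OF td(2) td(6) cM(2)]
    have "(LINT z|lborel. (\<psi>2 z * Mx z) *\<^sub>R v z) - (LINT z|lborel. (\<psi>1 z * My z) *\<^sub>R v z)
      = (LINT z|lborel. (\<psi> z * My z) *\<^sub>R V1 z) - (LINT z|lborel. (\<psi> z * Mx z) *\<^sub>R V2 z)"
    proof -
      have alg: "a - c = d - b" if "a + x = - b" "c + x = - d" for a b c d x :: complex
      proof -
        have "a - c = (a + x) - (c + x)" by simp
        then show ?thesis by (simp only: that) simp
      qed
      show ?thesis
      proof (rule alg)
        show "(LINT z|lborel. (\<psi>2 z * Mx z) *\<^sub>R v z) + (LINT z|lborel. (\<psi> z * Mxy z) *\<^sub>R v z) = - (LINT z|lborel. (\<psi> z * Mx z) *\<^sub>R V2 z)"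
          unfolding e1[symmetric] scaleR_add_left by (rule Bochner_Integration.integral_add[OF i1(1) i1(3), symmetric])
        show "(LINT z|lborel. (\<psi>1 z * My z) *\<^sub>R v z) + (LINT z|lborel. (\<psi> z * Mxy z) *\<^sub>R v z) = - (LINT z|lborel. (\<psi> z * My z) *\<^sub>R V1 z)"
          unfolding e2[symmetric] scaleR_add_left by (rule Bochner_Integration.integral_add[OF i1(2) i1(3), symmetric])
      qed
    qed
    moreover have "Mx z = Re (mconv (moll ?n) (\<lambda>z. indicator D z *\<^sub>R V1 z) z)" "My z = Re (mconv (moll ?n) (\<lambda>z. indicator D z *\<^sub>R V2 z) z)" if "z \<in> S" for z
    proof -
      have "cball z ((1/2) ^ ?n) \<subseteq> D" using D(5)[OF that] n0[of ?n] subset_cball[of "(1/2)^?n" e z] by auto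
      from mconv_sobolev[OF v D(2) this] show "Mx z = Re (mconv (moll ?n) (\<lambda>z. indicator D z *\<^sub>R V1 z) z)" "My z = Re (mconv (moll ?n) (\<lambda>z. indicator D z *\<^sub>R V2 z) z)"
        unfolding M by simp_all
    qed
    then have "(\<phi> z * Mx z) *\<^sub>R y = (\<phi> z *\<^sub>R y) * mconv (moll ?n) ?R1 z" "(\<phi> z * My z) *\<^sub>R y = (\<phi> z *\<^sub>R y) * mconv (moll ?n) ?R2 z"
      if "\<And>z. z \<notin> S \<Longrightarrow> \<phi> z = 0" for z y and \<phi> :: "complex \<Rightarrow> real"
      using that[of z] mconv_Re[OF compact_L2_integrable[OF L(2)], of ?n z] mconv_Re[OF compact_L2_integrable[OF L(3)], of ?n z]
      by (cases "z \<in> S"; simp add: scaleR_conv_of_real)+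
    note this[of \<psi>, OF td(6)] this[of \<psi>1, OF td(7)] this[of \<psi>2, OF td(8)]
    ultimately show ?thesis by simp
  qed
  have lim: "(\<lambda>n. LINT z|lborel. F z * mconv (moll (n + n0)) h z) \<longlonglongrightarrow> (LINT z|lborel. F z * h z)"
    if "compact_L2 r F" "compact_L2 r h" for F h :: "complex \<Rightarrow> complex"
    by (rule LIMSEQ_ignore_initial_segment[OF mconv_weak_limit[OF that r(1)]])
  have "(LINT z|lborel. (\<psi>2 z *\<^sub>R v z) * ?R1 z) - (LINT z|lborel. (\<psi>1 z *\<^sub>R v z) * ?R2 z)
     = (LINT z|lborel. (\<psi> z *\<^sub>R V1 z) * ?R2 z) - (LINT z|lborel. (\<psi> z *\<^sub>R V2 z) * ?R1 z)"
    using LIMSEQ_unique[OF tendsto_diff[OF lim[OF F(1) R1] lim[OF F(2) R2]]] tendsto_diff[OF lim[OF F(3) R2] lim[OF F(4) R1]]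
    unfolding id by blast
  moreover note i = compact_L2_bilinear_bound(1)[OF F(1) R1 zero_less_one] compact_L2_bilinear_bound(1)[OF F(2) R2 zero_less_one]
    compact_L2_bilinear_bound(1)[OF F(3) R2 zero_less_one] compact_L2_bilinear_bound(1)[OF F(4) R1 zero_less_one]
  ultimately have eq: "(LINT z|lborel. (\<psi>2 z *\<^sub>R v z) * ?R1 z - (\<psi>1 z *\<^sub>R v z) * ?R2 z)
     = (LINT z|lborel. (\<psi> z *\<^sub>R V1 z) * ?R2 z - (\<psi> z *\<^sub>R V2 z) * ?R1 z)"
    by (simp only: Bochner_Integration.integral_diff)
  note j1 = Bochner_Integration.integrable_diff[OF i(1,2)] and j2 = Bochner_Integration.integrable_diff[OF i(3,4)]
  \<comment> \<open>The limit identity pairs the complex \<open>v\<close> with the real parts of its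
    derivatives; its imaginary part is the identity for the Jacobian.\<close>
  have p1: "Im ((\<psi>2 z *\<^sub>R v z) * ?R1 z - (\<psi>1 z *\<^sub>R v z) * ?R2 z) = Im (v z) * (\<psi>2 z * Re (V1 z) - \<psi>1 z * Re (V2 z))" for z
    using td(7,8)[of z] subsetD[OF D(3), of z] by (cases "z \<in> S") (auto simp: algebra_simps)
  have p2: "Im ((\<psi> z *\<^sub>R V1 z) * ?R2 z - (\<psi> z *\<^sub>R V2 z) * ?R1 z) = - (\<psi> z * (Re (V1 z) * Im (V2 z) - Re (V2 z) * Im (V1 z)))" for z
    using td(6)[of z] subsetD[OF D(3), of z] by (cases "z \<in> S") (auto simp: algebra_simps)
  have q1: "(LINT z|lborel. Im (v z) * (\<psi>2 z * Re (V1 z) - \<psi>1 z * Re (V2 z))) = Im (LINT z|lborel. (\<psi>2 z *\<^sub>R v z) * ?R1 z - (\<psi>1 z *\<^sub>R v z) * ?R2 z)"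
    unfolding p1[symmetric] by (rule integral_bounded_linear[OF bounded_linear_Im j1])
  have q2: "(LINT z|lborel. - (\<psi> z * (Re (V1 z) * Im (V2 z) - Re (V2 z) * Im (V1 z)))) = Im (LINT z|lborel. (\<psi> z *\<^sub>R V1 z) * ?R2 z - (\<psi> z *\<^sub>R V2 z) * ?R1 z)"
    unfolding p2[symmetric] by (rule integral_bounded_linear[OF bounded_linear_Im j2])
  show "integrable lborel (\<lambda>z. Im (v z) * (\<psi>2 z * Re (V1 z) - \<psi>1 z * Re (V2 z)))"
    unfolding p1[symmetric] by (rule integrable_bounded_linear[OF bounded_linear_Im j1])
  have jn: "integrable lborel (\<lambda>z. - (\<psi> z * (Re (V1 z) * Im (V2 z) - Re (V2 z) * Im (V1 z))))"
    unfolding p2[symmetric] by (rule integrable_bounded_linear[OF bounded_linear_Im j2])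
  show "integrable lborel (\<lambda>z. \<psi> z * (Re (V1 z) * Im (V2 z) - Re (V2 z) * Im (V1 z)))"
    using Bochner_Integration.integrable_minus[OF jn] by (simp only: minus_minus)
  show "(LINT z|lborel. \<psi> z * (Re (V1 z) * Im (V2 z) - Re (V2 z) * Im (V1 z))) =
     - (LINT z|lborel. Im (v z) * (\<psi>2 z * Re (V1 z) - \<psi>1 z * Re (V2 z)))"
    using q1 q2 eq by simp
qed

lemma integral_indicator_cball_le:
  fixes a :: complex assumes "\<rho> \<ge> 0"
  shows "(LINT z|lborel. indicator (cball a \<rho>) z :: real) \<le> 4 * \<rho>\<^sup>2"
proof -
  have "(LINT z|lborel. indicator (cball a \<rho>) z :: real) = measure lborel (cball a \<rho>)" by simp
  also have "\<dots> = pi * \<rho>\<^sup>2"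
    using content_cball[OF assms, of a] unit_ball_vol_2 by simp
  also have "\<dots> \<le> 4 * \<rho>\<^sup>2" using pi_less_4 by (intro mult_right_mono) auto
  finally show ?thesis .
qed

text \<open>Fubini: a point \<open>\<zeta>\<close> lies in \<open>cball z \<rho>\<close> for a set
  of centres \<open>z\<close> of area \<open>pi * \<rho>^2\<close>.\<close>

lemma disk_average_integral:
  fixes q :: "complex \<Rightarrow> real"
  assumes q: "integrable lborel q" and r: "\<rho> \<ge> 0"
  shows "integrable lborel (\<lambda>z. LINT \<zeta>|lborel. indicator (cball z \<rho>) \<zeta> * q \<zeta>)"
    "(LINT z|lborel. LINT \<zeta>|lborel. indicator (cball z \<rho>) \<zeta> * q \<zeta>) = pi * \<rho>\<^sup>2 * (LINT z|lborel. q z)"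
proof -
  let ?f = "\<lambda>(\<zeta>, z). (if cmod (\<zeta> - z) \<le> \<rho> then 1 else 0) * q \<zeta>"
  have [measurable]: "q \<in> borel_measurable borel" using q by auto
  have ie: "indicator (cball z \<rho>) \<zeta> = (if cmod (\<zeta> - z) \<le> \<rho> then 1 else 0 :: real)" for z \<zeta>
    by (auto simp: indicator_def dist_norm norm_minus_commute)
  have ie': "(if cmod (\<zeta> - z) \<le> \<rho> then 1 else 0 :: real) = indicator (cball \<zeta> \<rho>) z" for z \<zeta>
    by (auto simp: indicator_def dist_norm)
  have mi: "integrable lborel (\<lambda>z. if cmod (\<zeta> - z) \<le> \<rho> then 1 else 0 :: real)"
      "(LINT z|lborel. (if cmod (\<zeta> - z) \<le> \<rho> then 1 else 0 :: real)) = pi * \<rho>\<^sup>2" for \<zeta>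
    unfolding ie' using integrable_indicator_cball[of \<zeta> \<rho>] content_cball[OF r, of \<zeta>] unit_ball_vol_2 by simp_all
  have int: "integrable (lborel \<Otimes>\<^sub>M lborel) ?f"
  proof (rule lborel_pair.Fubini_integrable)
    have "(LINT z|lborel. norm (?f (\<zeta>, z))) = pi * \<rho>\<^sup>2 * norm (q \<zeta>)" for \<zeta>
    proof -
      have "norm (?f (\<zeta>, z)) = (if cmod (\<zeta> - z) \<le> \<rho> then 1 else 0) * norm (q \<zeta>)" for z by simp
      then have "(LINT z|lborel. norm (?f (\<zeta>, z))) = (LINT z|lborel. (if cmod (\<zeta> - z) \<le> \<rho> then 1 else 0) * norm (q \<zeta>))" by presburger
      also have "\<dots> = (LINT z|lborel. (if cmod (\<zeta> - z) \<le> \<rho> then 1 else 0)) * norm (q \<zeta>)" by (rule integral_mult_left_zero)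
      finally show ?thesis unfolding mi .
    qed
    then show "integrable lborel (\<lambda>\<zeta>. LINT z|lborel. norm (?f (\<zeta>, z)))" using q by (simp only: integrable_mult_right integrable_norm)
    show "AE \<zeta> in lborel. integrable lborel (\<lambda>z. ?f (\<zeta>, z))"
      using mi by (intro AE_I2) (simp only: prod.case integrable_mult_left)
  qed measurable
  show "integrable lborel (\<lambda>z. LINT \<zeta>|lborel. indicator (cball z \<rho>) \<zeta> * q \<zeta>)"
    unfolding ie using lborel_pair.integrable_snd[OF int] by simp
  have "(LINT z|lborel. LINT \<zeta>|lborel. (if cmod (\<zeta> - z) \<le> \<rho> then 1 else 0) * q \<zeta>) = (LINT \<zeta>|lborel. LINT z|lborel. (if cmod (\<zeta> - z) \<le> \<rho> then 1 else 0) * q \<zeta>)"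
    using lborel_pair.Fubini_integral[OF int] by simp
  also have "\<dots> = (LINT \<zeta>|lborel. pi * \<rho>\<^sup>2 * q \<zeta>)" by (simp only: integral_mult_left_zero mi)
  finally show "(LINT z|lborel. LINT \<zeta>|lborel. indicator (cball z \<rho>) \<zeta> * q \<zeta>) = pi * \<rho>\<^sup>2 * (LINT z|lborel. q z)"
    unfolding ie by simp
qed

section \<open>Energy and dyadic averages of a quasiregular map on the disk\<close>

locale qr_disk =
  fixes K :: real and v V1 V2 :: "complex \<Rightarrow> complex"
  assumes K: "K \<ge> 1" and sob: "sobolev_12_loc (ball 0 1) v V1 V2"
    and qr: "AE z in lborel. z \<in> ball 0 1 \<longrightarrow>
      (cmod (V1 z))\<^sup>2 + (cmod (V2 z))\<^sup>2 \<le> 2 * K * (Re (V1 z) * Im (V2 z) - Re (V2 z) * Im (V1 z))"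
begin

text \<open>The squared Hilbert-Schmidt norm of the weak differential, so \<open>En\<close> is the
  Dirichlet energy; \<open>Sn\<close> integrates the first power of that norm, and
  \<open>A n\<close> averages \<open>v\<close> at scale \<open>(1/2) ^ n\<close>.\<close>

definition e :: "complex \<Rightarrow> real" where "e z = (cmod (V1 z))\<^sup>2 + (cmod (V2 z))\<^sup>2"
definition s :: "complex \<Rightarrow> real" where "s z = sqrt (e z)"
definition En :: "complex set \<Rightarrow> real" where "En A = (LINT z|lborel. indicator A z * e z)"
definition Sn :: "complex set \<Rightarrow> real" where "Sn A = (LINT z|lborel. indicator A z * s z)"
definition A :: "nat \<Rightarrow> complex \<Rightarrow> complex" where "A n = mconv (moll n) v"

lemma e_nonneg: "e z \<ge> 0" and s_nonneg: "s z \<ge> 0" and s_sq: "(s z)\<^sup>2 = e z"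
  by (auto simp: e_def s_def)

lemma V_le_s: "cmod (V1 z) \<le> s z" "cmod (V2 z) \<le> s z"
  unfolding s_def e_def by (auto intro!: real_le_rsqrt)

lemma en_int:
  assumes B: "B \<in> sets borel" "B \<subseteq> cball 0 r" "r < 1"
  shows "integrable lborel (\<lambda>z. indicator B z * e z)" "integrable lborel (\<lambda>z. indicator B z * s z)"
proof -
  let ?D = "cball (0::complex) r"
  have "?D \<subseteq> ball 0 1" using B(3) by auto
  from sobolev_restrict[OF sob compact_cball this order_refl]
  have L: "compact_L2 r (\<lambda>z. indicator ?D z *\<^sub>R V1 z)" "compact_L2 r (\<lambda>z. indicator ?D z *\<^sub>R V2 z)" by auto
  have "integrable lborel (\<lambda>z. (cmod (indicator ?D z *\<^sub>R V1 z))\<^sup>2 + (cmod (indicator ?D z *\<^sub>R V2 z))\<^sup>2)"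
    using L by (intro Bochner_Integration.integrable_add) (auto simp only: compact_L2_def)
  moreover have "(cmod (indicator ?D z *\<^sub>R V1 z))\<^sup>2 + (cmod (indicator ?D z *\<^sub>R V2 z))\<^sup>2 = indicator ?D z * e z" for z
    by (auto simp: indicator_def e_def)
  ultimately have De: "integrable lborel (\<lambda>z. indicator ?D z * e z)" by (simp only:)
  then have [measurable]: "(\<lambda>z. indicator ?D z * e z) \<in> borel_measurable borel" by auto
  note [measurable] = B(1)
  have BD: "indicator B z * (indicator ?D z * e z) = indicator B z * e z" for z
    using B(2) by (auto simp: indicator_def)
  have BD': "indicator B z * sqrt (indicator ?D z * e z) = indicator B z * s z" for z
    using B(2) by (auto simp: indicator_def s_def)
  have m: "(\<lambda>z. indicator B z * (indicator ?D z * e z)) \<in> borel_measurable borel" "(\<lambda>z. indicator B z * sqrt (indicator ?D z * e z)) \<in> borel_measurable borel"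
    by measurable
  show "integrable lborel (\<lambda>z. indicator B z * e z)"
  proof (rule Bochner_Integration.integrable_bound[OF De])
    show "(\<lambda>z. indicator B z * e z) \<in> borel_measurable lborel" using m(1) unfolding BD by simp
    show "AE z in lborel. norm (indicator B z * e z) \<le> norm (indicator ?D z * e z)"
      using B(2) e_nonneg by (intro AE_I2) (auto simp: indicator_def)
  qed
  show "integrable lborel (\<lambda>z. indicator B z * s z)"
  proof (rule Bochner_Integration.integrable_bound[where f = "\<lambda>z. indicator ?D z + indicator ?D z * e z"])
    show "integrable lborel (\<lambda>z. indicator ?D z + indicator ?D z * e z)"
      by (intro Bochner_Integration.integrable_add De integrable_indicator_cball)
    show "(\<lambda>z. indicator B z * s z) \<in> borel_measurable lborel" using m(2) unfolding BD' by simp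
    show "AE z in lborel. norm (indicator B z * s z) \<le> norm (indicator ?D z + indicator ?D z * e z)"
    proof (rule AE_I2)
      fix z
      have "s z \<le> 1 + e z"
        using zero_le_power2[of "s z - 1"] s_nonneg[of z] s_sq[of z] unfolding power2_diff power_one mult_1_right by linarith
      then show "norm (indicator B z * s z) \<le> norm (indicator ?D z + indicator ?D z * e z)"
        using B(2) e_nonneg[of z] s_nonneg[of z] by (auto simp: indicator_def)
    qed
  qed
qed

lemma En_nonneg: "En B \<ge> 0" and Sn_nonneg: "Sn B \<ge> 0"
  unfolding En_def Sn_def by (auto intro!: integral_nonneg_AE simp: e_nonneg s_nonneg)

lemma En_mono:
  assumes "B \<in> sets borel" "C \<in> sets borel" "B \<subseteq> C" "C \<subseteq> cball 0 r" "r < 1"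
  shows "En B \<le> En C" "Sn B \<le> Sn C"
proof -
  have B: "B \<subseteq> cball 0 r" using assms by auto
  have le: "indicator B z * x \<le> indicator C z * x" if "x \<ge> 0" for z and x :: real
    using assms(3) that by (auto simp: indicator_def)
  show "En B \<le> En C" "Sn B \<le> Sn C" unfolding En_def Sn_def
    by (rule integral_mono[OF en_int(1)[OF assms(1) B assms(5)] en_int(1)[OF assms(2,4,5)] le[OF e_nonneg]],
        rule integral_mono[OF en_int(2)[OF assms(1) B assms(5)] en_int(2)[OF assms(2,4,5)] le[OF s_nonneg]])
qed

lemma Sn_le:
  assumes "cball a \<rho> \<subseteq> cball 0 r" "r < 1" "\<rho> \<ge> 0" "l > 0"
  shows "Sn (cball a \<rho>) \<le> 2 * l * \<rho>\<^sup>2 + En (cball a \<rho>) / (2 * l)"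
proof -
  note i = en_int[OF _ assms(1,2)]
  have "Sn (cball a \<rho>) \<le> (LINT z|lborel. (l / 2) * indicator (cball a \<rho>) z + (indicator (cball a \<rho>) z * e z) / (2 * l))"
    unfolding Sn_def
  proof (rule integral_mono)
    fix z
    have "0 \<le> (l - s z)\<^sup>2 / (2 * l)" using assms(4) by simp
    also have "\<dots> = l / 2 + e z / (2 * l) - s z" using assms(4) s_sq[of z]
      by (simp add: power2_diff field_simps power2_eq_square)
    finally show "indicator (cball a \<rho>) z * s z \<le> (l / 2) * indicator (cball a \<rho>) z + (indicator (cball a \<rho>) z * e z) / (2 * l)"
      by (auto simp: indicator_def)
  qed (auto intro!: i integrable_indicator_cball integrable_mult_right integrable_divide Bochner_Integration.integrable_add
      simp del: times_divide_eq_left)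
  also have "\<dots> = l / 2 * (LINT z|lborel. indicator (cball a \<rho>) z) + En (cball a \<rho>) / (2 * l)"
    unfolding En_def using i(1) integrable_indicator_cball[of a \<rho>] by simp
  also have "\<dots> \<le> l / 2 * (4 * \<rho>\<^sup>2) + En (cball a \<rho>) / (2 * l)"
    using assms integral_indicator_cball_le[of \<rho> a] by (intro add_right_mono mult_left_mono) auto
  finally show ?thesis by simp
qed

text \<open>The left side is the double integral of \<open>s z * s \<zeta>\<close> over
  \<open>z \<in> B\<close> and \<open>cmod (z - \<zeta>) \<le> \<rho>\<close>; Young's inequality
  and the area bound \<open>4 * \<rho>^2\<close> of the disks give a Schur test. In hole filling
  \<open>B\<close> is an annulus and \<open>C\<close> the large disk: a large \<open>l\<close> puts
  a small factor on the energy of \<open>C\<close>.\<close>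

lemma schur:
  assumes B: "B \<in> sets borel" "C \<in> sets borel" "C \<subseteq> cball 0 r" "r < 1" and BC: "\<And>z. z \<in> B \<Longrightarrow> cball z \<rho> \<subseteq> C"
    and r: "\<rho> \<ge> 0" and l: "l > 0"
  shows "integrable lborel (\<lambda>z. indicator B z * s z * Sn (cball z \<rho>))"
    "(LINT z|lborel. indicator B z * s z * Sn (cball z \<rho>)) \<le> 2 * \<rho>\<^sup>2 * (l * En B + En C / l)"
proof -
  have BC': "B \<subseteq> C" using BC r by fastforce
  then have B': "B \<subseteq> cball 0 r" using B by auto
  note iB = en_int[OF B(1) B' B(4)] and iC = en_int[OF B(2-4)]
  let ?q = "\<lambda>\<zeta>. indicator C \<zeta> * e \<zeta>" and ?p = "\<lambda>\<zeta>. indicator C \<zeta> * s \<zeta>"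
  define P where "P z = (LINT \<zeta>|lborel. indicator (cball z \<rho>) \<zeta> * ?p \<zeta>)" for z
  define Q where "Q z = (LINT \<zeta>|lborel. indicator (cball z \<rho>) \<zeta> * ?q \<zeta>)" for z
  note iP = disk_average_integral[OF iC(2) r, folded P_def] and iQ = disk_average_integral[OF iC(1) r, folded Q_def]
  have SP: "Sn (cball z \<rho>) = P z" if "z \<in> B" for z
  proof -
    have "indicator (cball z \<rho>) \<zeta> * ?p \<zeta> = indicator (cball z \<rho>) \<zeta> * s \<zeta>" for \<zeta>
      using BC[OF that] by (auto simp: indicator_def subset_iff)
    then show ?thesis by (simp only: P_def Sn_def)
  qed
  have Q0: "Q z \<ge> 0" for z unfolding Q_def by (auto intro!: integral_nonneg_AE simp: e_nonneg)
  have mb: "integrable lborel (\<lambda>\<zeta>. indicator (cball z \<rho>) \<zeta> * ?q \<zeta>)" "integrable lborel (\<lambda>\<zeta>. indicator (cball z \<rho>) \<zeta> * ?p \<zeta>)" for z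
  proof -
    have "integrable lborel (\<lambda>\<zeta>. indicator (cball z \<rho>) \<zeta> *\<^sub>R ?q \<zeta>)" "integrable lborel (\<lambda>\<zeta>. indicator (cball z \<rho>) \<zeta> *\<^sub>R ?p \<zeta>)"
      by (rule integrable_bounded_scaleR[where B=1]; use iC in \<open>auto simp: indicator_def\<close>)+
    then show "integrable lborel (\<lambda>\<zeta>. indicator (cball z \<rho>) \<zeta> * ?q \<zeta>)" "integrable lborel (\<lambda>\<zeta>. indicator (cball z \<rho>) \<zeta> * ?p \<zeta>)" by simp_all
  qed
  let ?b = "\<lambda>z. 2 * \<rho>\<^sup>2 * l * (indicator B z * e z) + Q z / (2 * l)"
  have pw: "indicator B z * s z * Sn (cball z \<rho>) \<le> ?b z" for z
  proof (cases "z \<in> B")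
    case True
    have "s z * P z = (LINT \<zeta>|lborel. s z * (indicator (cball z \<rho>) \<zeta> * ?p \<zeta>))" by (simp add: P_def)
    also have "\<dots> \<le> (LINT \<zeta>|lborel. l / 2 * e z * indicator (cball z \<rho>) \<zeta> + (indicator (cball z \<rho>) \<zeta> * ?q \<zeta>) / (2 * l))"
    proof (rule integral_mono)
      fix \<zeta>
      have "0 \<le> (l * s z - s \<zeta>)\<^sup>2 / (2 * l)" using l by simp
      also have "\<dots> = l / 2 * e z + e \<zeta> / (2 * l) - s z * s \<zeta>" using l
        by (simp add: power2_diff power_mult_distrib s_sq field_simps power2_eq_square[of l])
      finally show "s z * (indicator (cball z \<rho>) \<zeta> * ?p \<zeta>) \<le> l / 2 * e z * indicator (cball z \<rho>) \<zeta> + (indicator (cball z \<rho>) \<zeta> * ?q \<zeta>) / (2 * l)"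
        using l e_nonneg[of z] by (auto simp: indicator_def)
    qed (use mb[of z] in \<open>auto intro!: integrable_indicator_cball Bochner_Integration.integrable_add\<close>)
    also have "\<dots> = l / 2 * e z * (LINT \<zeta>|lborel. indicator (cball z \<rho>) \<zeta>) + Q z / (2 * l)"
      unfolding Q_def using mb(1)[of z] integrable_indicator_cball[of z \<rho>] by simp
    also have "\<dots> \<le> l / 2 * e z * (4 * \<rho>\<^sup>2) + Q z / (2 * l)"
      using l e_nonneg[of z] integral_indicator_cball_le[OF r, of z] by (intro add_right_mono mult_left_mono) auto
    finally show ?thesis using SP[OF True] True by (simp add: algebra_simps)
  next
    case False then show ?thesis using Q0[of z] l by simp
  qed
  have ib: "integrable lborel ?b" using iB(1) iQ(1) by (intro Bochner_Integration.integrable_add) auto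
  have [measurable]: "(\<lambda>z. indicator B z * s z) \<in> borel_measurable borel" "P \<in> borel_measurable borel"
    using iB(2) iP(1) by auto
  have eqP: "indicator B z * s z * Sn (cball z \<rho>) = indicator B z * s z * P z" for z using SP[of z] by (cases "z \<in> B") auto
  have nn: "indicator B z * s z * Sn (cball z \<rho>) \<ge> 0" for z by (simp add: s_nonneg Sn_nonneg)
  show i: "integrable lborel (\<lambda>z. indicator B z * s z * Sn (cball z \<rho>))"
  proof (rule Bochner_Integration.integrable_bound[OF ib])
    show "(\<lambda>z. indicator B z * s z * Sn (cball z \<rho>)) \<in> borel_measurable lborel" unfolding eqP by measurable
    show "AE z in lborel. norm (indicator B z * s z * Sn (cball z \<rho>)) \<le> norm (?b z)"
      using pw nn by (intro AE_I2) (smt (verit) real_norm_def)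
  qed
  have "(LINT z|lborel. indicator B z * s z * Sn (cball z \<rho>)) \<le> (LINT z|lborel. ?b z)"
    by (rule integral_mono[OF i ib pw])
  also have "\<dots> = 2 * \<rho>\<^sup>2 * l * En B + pi * \<rho>\<^sup>2 * En C / (2 * l)"
    using iB(1) iQ unfolding En_def by simp
  also have "\<dots> \<le> 2 * \<rho>\<^sup>2 * l * En B + 4 * \<rho>\<^sup>2 * En C / (2 * l)"
    using pi_less_4 l En_nonneg[of C] by (intro add_left_mono divide_right_mono mult_right_mono) auto
  also have "\<dots> = 2 * \<rho>\<^sup>2 * (l * En B + En C / l)" using l by (simp add: field_simps)
  finally show "(LINT z|lborel. indicator B z * s z * Sn (cball z \<rho>)) \<le> 2 * \<rho>\<^sup>2 * (l * En B + En C / l)" .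
qed

lemma test_fun_scaleR_V_bound:
  fixes X :: "complex \<Rightarrow> real"
  assumes T: "test_fun X X1 X2 (cball z \<rho>)" and z: "cball z \<rho> \<subseteq> cball 0 r" "r < 1" and M: "\<And>w. \<bar>X w\<bar> \<le> M"
  shows "cmod (LINT \<zeta>|lborel. X \<zeta> *\<^sub>R V1 \<zeta>) \<le> M * Sn (cball z \<rho>)" "cmod (LINT \<zeta>|lborel. X \<zeta> *\<^sub>R V2 \<zeta>) \<le> M * Sn (cball z \<rho>)"
proof -
  have zb: "cball z \<rho> \<subseteq> ball 0 1" using z by (auto simp: subset_iff)
  note L = sobolev_restrict[OF sob compact_cball zb z(1)]
  have M0: "M \<ge> 0" using M[of 0] by linarith
  have *: "cmod (LINT \<zeta>|lborel. X \<zeta> *\<^sub>R V \<zeta>) \<le> M * Sn (cball z \<rho>)"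
    if V: "compact_L2 r (\<lambda>\<zeta>. indicator (cball z \<rho>) \<zeta> *\<^sub>R V \<zeta>)" "\<And>\<zeta>. cmod (V \<zeta>) \<le> s \<zeta>" for V
  proof -
    have "cmod (LINT \<zeta>|lborel. X \<zeta> *\<^sub>R V \<zeta>) \<le> (LINT \<zeta>|lborel. cmod (X \<zeta> *\<^sub>R V \<zeta>))" by (rule integral_norm_bound)
    also have "\<dots> \<le> (LINT \<zeta>|lborel. M * (indicator (cball z \<rho>) \<zeta> * s \<zeta>))"
    proof (rule integral_mono)
      show "integrable lborel (\<lambda>\<zeta>. cmod (X \<zeta> *\<^sub>R V \<zeta>))"
        by (rule integrable_norm[OF compact_L2_bounded_scaleR_integrable[OF T V(1)]])
      show "integrable lborel (\<lambda>\<zeta>. M * (indicator (cball z \<rho>) \<zeta> * s \<zeta>))" using en_int(2)[OF _ z] by simp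
      fix \<zeta>
      have "\<bar>X \<zeta>\<bar> * cmod (V \<zeta>) \<le> M * s \<zeta>" by (intro mult_mono M V M0) auto
      then show "cmod (X \<zeta> *\<^sub>R V \<zeta>) \<le> M * (indicator (cball z \<rho>) \<zeta> * s \<zeta>)"
        using test_funD(6)[OF T, of \<zeta>] by (cases "\<zeta> \<in> cball z \<rho>") auto
    qed
    also have "\<dots> = M * Sn (cball z \<rho>)" by (simp add: Sn_def)
    finally show ?thesis .
  qed
  show "cmod (LINT \<zeta>|lborel. X \<zeta> *\<^sub>R V1 \<zeta>) \<le> M * Sn (cball z \<rho>)" "cmod (LINT \<zeta>|lborel. X \<zeta> *\<^sub>R V2 \<zeta>) \<le> M * Sn (cball z \<rho>)"
    by (rule *[OF L(2) V_le_s(1)], rule *[OF L(3) V_le_s(2)])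
qed

text \<open>By \<open>moll_telescope\<close> the change of average is an integral of
  \<open>v\<close> against a divergence; moving the derivatives onto \<open>v\<close> leaves
  \<open>V1\<close> and \<open>V2\<close> against fields of size
  \<open>8 * 2 ^ n / bump_mass\<close> carried by the disk of radius
  \<open>(1/2) ^ n\<close>.\<close>

lemma A_telescope:
  assumes z: "cball z ((1/2) ^ n) \<subseteq> cball 0 r" "r < 1"
  shows "cmod (A (Suc n) z - A n z) \<le> 16 / bump_mass * 2 ^ n * Sn (cball z ((1/2) ^ n))"
proof -
  obtain X X1 X2 Y Y1 Y2 where X:
    "test_fun X X1 X2 (cball 0 ((1/2) ^ n))" "test_fun Y Y1 Y2 (cball 0 ((1/2) ^ n))"
    "\<And>w. moll (Suc n) w - moll n w = X1 w + Y2 w"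
    "\<And>w. \<bar>X w\<bar> \<le> 8 * 2 ^ n / bump_mass" "\<And>w. \<bar>Y w\<bar> \<le> 8 * 2 ^ n / bump_mass"
    by (rule moll_telescope) blast
  note TX = test_fun_translate[OF X(1), of z] and TY = test_fun_translate[OF X(2), of z]
  have zb: "cball z ((1/2) ^ n) \<subseteq> ball 0 1" using z by (auto simp: subset_iff)
  have wp: "weak_partials (ball 0 1) v V1 V2" and cv: "continuous_on (ball 0 1) v" using sob by (auto simp: sobolev_12_loc_def)
  have iv: "integrable lborel (\<lambda>\<zeta>. u \<zeta> *\<^sub>R v \<zeta>)" if "continuous_on UNIV u" "\<And>\<zeta>. \<zeta> \<notin> cball z ((1/2) ^ n) \<Longrightarrow> u \<zeta> = 0" for u :: "complex \<Rightarrow> real"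
    by (rule continuous_compact_support_integrable[of "cball z ((1/2) ^ n)"])
       (use that zb cv in \<open>auto intro!: continuous_intros intro: continuous_on_subset\<close>)
  have i1: "integrable lborel (\<lambda>\<zeta>. moll n (\<zeta> - z) *\<^sub>R v \<zeta>)" "integrable lborel (\<lambda>\<zeta>. X1 (\<zeta> - z) *\<^sub>R v \<zeta>)" "integrable lborel (\<lambda>\<zeta>. Y2 (\<zeta> - z) *\<^sub>R v \<zeta>)"
    by (rule iv[OF test_funD(2,6)[OF test_fun_translate[OF test_fun_moll(1)]]] iv[OF test_funD(3,7)[OF TX]] iv[OF test_funD(4,8)[OF TY]] | assumption)+
  have "moll (Suc n) (\<zeta> - z) *\<^sub>R v \<zeta> = moll n (\<zeta> - z) *\<^sub>R v \<zeta> + (X1 (\<zeta> - z) *\<^sub>R v \<zeta> + Y2 (\<zeta> - z) *\<^sub>R v \<zeta>)" for \<zeta>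
  proof -
    have "moll (Suc n) (\<zeta> - z) = moll n (\<zeta> - z) + (X1 (\<zeta> - z) + Y2 (\<zeta> - z))" using X(3)[of "\<zeta> - z"] by simp
    then show ?thesis by (simp only: scaleR_add_left)
  qed
  then have "A (Suc n) z = A n z + ((LINT \<zeta>|lborel. X1 (\<zeta> - z) *\<^sub>R v \<zeta>) + (LINT \<zeta>|lborel. Y2 (\<zeta> - z) *\<^sub>R v \<zeta>))"
    unfolding A_def mconv_def using i1 by simp
  then have "A (Suc n) z - A n z = - (LINT \<zeta>|lborel. X (\<zeta> - z) *\<^sub>R V1 \<zeta>) - (LINT \<zeta>|lborel. Y (\<zeta> - z) *\<^sub>R V2 \<zeta>)"
    using sobolev_weak(1)[OF wp TX zb] sobolev_weak(2)[OF wp TY zb] by simp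
  then have "cmod (A (Suc n) z - A n z) \<le> cmod (LINT \<zeta>|lborel. X (\<zeta> - z) *\<^sub>R V1 \<zeta>) + cmod (LINT \<zeta>|lborel. Y (\<zeta> - z) *\<^sub>R V2 \<zeta>)"
    using norm_triangle_ineq4[of "- (LINT \<zeta>|lborel. X (\<zeta> - z) *\<^sub>R V1 \<zeta>)" "LINT \<zeta>|lborel. Y (\<zeta> - z) *\<^sub>R V2 \<zeta>"] by simp
  also have "\<dots> \<le> 8 * 2 ^ n / bump_mass * Sn (cball z ((1/2) ^ n)) + 8 * 2 ^ n / bump_mass * Sn (cball z ((1/2) ^ n))"
    by (intro add_mono test_fun_scaleR_V_bound(1)[OF TX z] test_fun_scaleR_V_bound(2)[OF TY z] X)
  finally show ?thesis by simp
qed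

text \<open>The gradient of an average is the average of the weak gradient, hence bounded by the
  maximum of the kernel times \<open>Sn\<close>; the \<open>8\<close> is twice the \<open>4\<close>
  in \<open>moll_le\<close>, once for each partial derivative.\<close>

lemma A_lipschitz:
  assumes W: "convex W" "\<And>z. z \<in> W \<Longrightarrow> cball z ((1/2) ^ n) \<subseteq> cball 0 r" "r < 1"
    and B: "\<And>z. z \<in> W \<Longrightarrow> Sn (cball z ((1/2) ^ n)) \<le> B" and xy: "x \<in> W" "y \<in> W"
  shows "cmod (A n x - A n y) \<le> 8 * 4 ^ n / bump_mass * B * cmod (x - y)"
proof -
  let ?D = "cball (0::complex) r"
  have D: "?D \<subseteq> ball 0 1" using W(3) by auto
  note L = sobolev_restrict[OF sob compact_cball D order_refl]
  let ?F = "mconv (moll n) (\<lambda>\<zeta>. indicator ?D \<zeta> *\<^sub>R v \<zeta>)"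
  let ?P1 = "mconv (moll n) (\<lambda>\<zeta>. indicator ?D \<zeta> *\<^sub>R V1 \<zeta>)" and ?P2 = "mconv (moll n) (\<lambda>\<zeta>. indicator ?D \<zeta> *\<^sub>R V2 \<zeta>)"
  have AF: "A n z = ?F z" if "z \<in> W" for z
    unfolding A_def mconv_def test_fun_indicator(1)[OF test_fun_translate[OF test_fun_moll(1)] W(2)[OF that]] ..
  have hp: "(?F has_derivative (\<lambda>h. Re h *\<^sub>R ?P1 z + Im h *\<^sub>R ?P2 z)) (at z)" if "z \<in> W" for z
    using has_partials_mconv[OF test_fun_moll(1) compact_L2_integrable[OF L(1)], of n z]
    unfolding has_partials_def mconv_sobolev[OF sob D W(2)[OF that]] .
  have bd: "cmod (?P1 z) \<le> 4 * 4 ^ n / bump_mass * B" "cmod (?P2 z) \<le> 4 * 4 ^ n / bump_mass * B" if "z \<in> W" for z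
  proof -
    note T = test_fun_translate[OF test_fun_moll(1)[of n], of z]
    have m: "\<bar>moll n (w - z)\<bar> \<le> 4 * 4 ^ n / bump_mass" for w using moll_le[of n "w - z"] moll_nonneg[of n "w - z"] by simp
    have c: "4 * 4 ^ n / bump_mass * Sn (cball z ((1/2) ^ n)) \<le> 4 * 4 ^ n / bump_mass * B"
      using bump_mass_pos by (intro mult_left_mono B that) auto
    show "cmod (?P1 z) \<le> 4 * 4 ^ n / bump_mass * B" "cmod (?P2 z) \<le> 4 * 4 ^ n / bump_mass * B"
      unfolding mconv_def test_fun_indicator(1)[OF T W(2)[OF that]]
      by (rule order_trans[OF test_fun_scaleR_V_bound(1)[OF T W(2)[OF that] W(3) m] c] order_trans[OF test_fun_scaleR_V_bound(2)[OF T W(2)[OF that] W(3) m] c])+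
  qed
  have "norm (?F x - ?F y) \<le> (8 * 4 ^ n / bump_mass * B) * norm (x - y)"
  proof (rule differentiable_bound[OF W(1) has_derivative_at_withinI[OF hp] _ xy])
    fix z assume z: "z \<in> W"
    show "onorm (\<lambda>h. Re h *\<^sub>R ?P1 z + Im h *\<^sub>R ?P2 z) \<le> 8 * 4 ^ n / bump_mass * B"
    proof (rule onorm_bound)
      fix h
      have "norm (Re h *\<^sub>R ?P1 z + Im h *\<^sub>R ?P2 z) \<le> \<bar>Re h\<bar> * norm (?P1 z) + \<bar>Im h\<bar> * norm (?P2 z)"
        using norm_triangle_ineq[of "Re h *\<^sub>R ?P1 z" "Im h *\<^sub>R ?P2 z"] by (simp only: norm_scaleR)
      also have "\<dots> \<le> cmod h * (4 * 4 ^ n / bump_mass * B) + cmod h * (4 * 4 ^ n / bump_mass * B)"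
        by (intro add_mono mult_mono abs_Re_le_cmod abs_Im_le_cmod bd z) auto
      finally show "norm (Re h *\<^sub>R ?P1 z + Im h *\<^sub>R ?P2 z) \<le> 8 * 4 ^ n / bump_mass * B * norm h" by (simp add: mult.commute mult.left_commute)
      show "0 \<le> 8 * 4 ^ n / bump_mass * B" using order_trans[OF norm_ge_zero bd(1)[OF z]] by simp
    qed
  qed assumption
  then show ?thesis using AF xy by simp
qed

lemma A_uniform_limit:
  assumes "r < 1" shows "uniform_limit (cball 0 r) A v sequentially"
proof -
  define t where "t = (1 - r) / 2"
  let ?D = "cball (0::complex) (r + t)"
  have t: "t > 0" "r + t < 1" using assms by (auto simp: t_def field_simps)
  have cv: "continuous_on (ball 0 1) v" using sob by (auto simp: sobolev_12_loc_def)
  have sub: "cball z t \<subseteq> ?D" if "z \<in> cball 0 r" for z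
  proof
    fix w assume "w \<in> cball z t"
    then show "w \<in> ?D" using that norm_triangle_ineq2[of w z] by (auto simp: dist_norm norm_minus_commute)
  qed
  have ul: "uniform_limit (cball 0 r) (\<lambda>n. mconv (moll n) (\<lambda>\<zeta>. indicator ?D \<zeta> *\<^sub>R v \<zeta>)) v sequentially"
    by (rule mconv_moll_uniform_limit[OF compact_cball _ t(1) sub]) (use t in \<open>auto intro!: continuous_on_subset[OF cv]\<close>)
  have "\<forall>\<^sub>F n in sequentially. (1/2::real) ^ n < t"
    using t(1) by (intro order_tendstoD(2)[OF LIMSEQ_power_zero]) auto
  then have "\<forall>\<^sub>F n in sequentially. \<forall>z\<in>cball 0 r. mconv (moll n) (\<lambda>\<zeta>. indicator ?D \<zeta> *\<^sub>R v \<zeta>) z = A n z"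
  proof eventually_elim
    case (elim n)
    show ?case
    proof
      fix z :: complex assume "z \<in> cball 0 r"
      then have zD: "cball z ((1/2) ^ n) \<subseteq> ?D" using sub[of z] elim subset_cball[of "(1/2) ^ n" t z] by auto
      show "mconv (moll n) (\<lambda>\<zeta>. indicator ?D \<zeta> *\<^sub>R v \<zeta>) z = A n z"
        unfolding A_def mconv_def test_fun_indicator(1)[OF test_fun_translate[OF test_fun_moll(1)] zD] ..
    qed
  qed
  from uniform_limit_cong[OF this, of v v] ul show ?thesis by simp
qed

lemma A_pointwise:
  assumes z: "cball z ((1/2) ^ n) \<subseteq> cball 0 r" "r < 1"
  shows "cmod (v z - A n z) \<le> (\<Sum>k<m. 16 / bump_mass * 2 ^ (n + k) * Sn (cball z ((1/2) ^ (n + k)))) + cmod (v z - A (n + m) z)"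
proof (induction m)
  case (Suc m)
  have "cball z ((1/2) ^ (n + m)) \<subseteq> cball z ((1/2) ^ n)" by (intro subset_cball power_decreasing) auto
  then have "cball z ((1/2) ^ (n + m)) \<subseteq> cball 0 r" using z by auto
  note A_telescope[OF this z(2)]
  moreover have "cmod (v z - A (n + m) z) \<le> cmod (v z - A (Suc (n + m)) z) + cmod (A (Suc (n + m)) z - A (n + m) z)"
    using norm_triangle_ineq[of "v z - A (Suc (n + m)) z" "A (Suc (n + m)) z - A (n + m) z"] by simp
  ultimately show ?case using Suc by simp
qed simp

end

section \<open>Caccioppoli inequality, hole filling and energy decay\<close>

context qr_disk begin

lemma s_continuous_int:
  assumes B: "B \<in> sets borel" "B \<subseteq> cball 0 r" "r < 1" and g: "continuous_on (cball 0 r) (g :: complex \<Rightarrow> real)"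
  shows "integrable lborel (\<lambda>z. indicator B z * g z * s z)"
proof -
  have "bounded (g ` cball 0 r)" using g by (intro compact_imp_bounded compact_continuous_image) auto
  then obtain M where M: "\<And>z. z \<in> cball 0 r \<Longrightarrow> \<bar>g z\<bar> \<le> M"
    unfolding bounded_iff real_norm_def by blast
  let ?g = "\<lambda>z. indicator (cball 0 r) z *\<^sub>R g z"
  have gm: "?g \<in> borel_measurable borel"
    using g by (intro borel_measurable_continuous_on_indicator) auto
  have "integrable lborel (\<lambda>z. ?g z *\<^sub>R (indicator B z * s z))"
  proof (rule integrable_bounded_scaleR[where B = "\<bar>M\<bar>"])
    show "\<bar>?g z\<bar> \<le> \<bar>M\<bar>" for z using M[of z] by (cases "z \<in> cball 0 r") auto
  qed (rule gm, rule en_int(2)[OF B])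
  moreover have "?g z *\<^sub>R (indicator B z * s z) = indicator B z * g z * s z" for z
    using B(2) by (auto simp: indicator_def)
  ultimately show ?thesis by (simp only:)
qed

text \<open>Quasiregularity bounds the energy density by the Jacobian, and the Jacobian of
  \<open>v - c\<close> integrates by parts onto the cutoff. What remains is the gradient of
  \<open>\<psi>\<close> and the oscillation of \<open>v\<close> about the free constant
  \<open>c\<close>.\<close>

lemma energy_cutoff:
  fixes \<psi> :: "complex \<Rightarrow> real"
  assumes T: "test_fun \<psi> \<psi>1 \<psi>2 S" and S: "S \<subseteq> cball 0 r" "r < 1" and p: "\<And>z. \<psi> z \<ge> 0"
  shows "integrable lborel (\<lambda>z. \<psi> z * e z)"
    "(LINT z|lborel. \<psi> z * e z) \<le> 2 * K * (LINT z|lborel. \<bar>Im (v z - c)\<bar> * ((\<bar>\<psi>1 z\<bar> + \<bar>\<psi>2 z\<bar>) * s z))"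
proof -
  note td = test_funD[OF T]
  have S': "S \<subseteq> ball 0 1" using S by auto
  have Sb: "S \<in> sets borel" using td(5) by (simp add: borel_closed compact_imp_closed)
  obtain M where M: "\<And>z. norm (\<psi> z) \<le> M"
    using continuous_compact_support_bounded[OF td(5) td(2) td(6)] by blast
  have "integrable lborel (\<lambda>z. \<psi> z *\<^sub>R (indicator S z * e z))"
    using td(2)[of UNIV] M en_int(1)[OF Sb S]
    by (intro integrable_bounded_scaleR[where B=M]) (auto intro: borel_measurable_continuous_onI)
  moreover have "\<psi> z *\<^sub>R (indicator S z * e z) = \<psi> z * e z" for z using td(6)[of z] by (cases "z \<in> S") auto
  ultimately show i: "integrable lborel (\<lambda>z. \<psi> z * e z)" by (simp only:)
  note J = jacobian_by_parts[OF sobolev_diff_const[OF sob open_ball, of c] open_ball T S']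
  let ?J = "\<lambda>z. Re (V1 z) * Im (V2 z) - Re (V2 z) * Im (V1 z)"
  have "(LINT z|lborel. \<psi> z * e z) \<le> (LINT z|lborel. 2 * K * (\<psi> z * ?J z))"
  proof (rule integral_mono_AE[OF i])
    show "integrable lborel (\<lambda>z. 2 * K * (\<psi> z * ?J z))" using J(1) by (rule integrable_mult_right)
    show "AE z in lborel. \<psi> z * e z \<le> 2 * K * (\<psi> z * ?J z)"
      using qr
    proof eventually_elim
      case (elim z)
      show ?case
      proof (cases "z \<in> S")
        case True
        then have "e z \<le> 2 * K * ?J z" using elim S' by (auto simp: e_def)
        then have "\<psi> z * e z \<le> \<psi> z * (2 * K * ?J z)" by (rule mult_left_mono[OF _ p])
        then show ?thesis by (simp only: mult.left_commute mult.assoc)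
      qed (use td(6) in simp)
    qed
  qed
  also have "\<dots> = 2 * K * - (LINT z|lborel. Im (v z - c) * (\<psi>2 z * Re (V1 z) - \<psi>1 z * Re (V2 z)))"
    using J(3) by simp
  also have "\<dots> \<le> 2 * K * (LINT z|lborel. \<bar>Im (v z - c)\<bar> * ((\<bar>\<psi>1 z\<bar> + \<bar>\<psi>2 z\<bar>) * s z))"
  proof (rule mult_left_mono)
    have cv: "continuous_on (cball 0 r) v" using sob S by (auto simp: sobolev_12_loc_def intro!: continuous_on_subset[of "ball 0 1"])
    have i3: "integrable lborel (\<lambda>z. \<bar>Im (v z - c)\<bar> * ((\<bar>\<psi>1 z\<bar> + \<bar>\<psi>2 z\<bar>) * s z))"
    proof -
      have "integrable lborel (\<lambda>z. indicator S z * (\<bar>Im (v z - c)\<bar> * (\<bar>\<psi>1 z\<bar> + \<bar>\<psi>2 z\<bar>)) * s z)"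
        by (rule s_continuous_int[OF Sb S]) (intro continuous_intros cv td)
      moreover have "indicator S z * (\<bar>Im (v z - c)\<bar> * (\<bar>\<psi>1 z\<bar> + \<bar>\<psi>2 z\<bar>)) * s z = \<bar>Im (v z - c)\<bar> * ((\<bar>\<psi>1 z\<bar> + \<bar>\<psi>2 z\<bar>) * s z)" for z
        using td(7,8)[of z] by (cases "z \<in> S") auto
      ultimately show ?thesis by (simp only:)
    qed
    have "- (LINT z|lborel. Im (v z - c) * (\<psi>2 z * Re (V1 z) - \<psi>1 z * Re (V2 z))) \<le> \<bar>LINT z|lborel. Im (v z - c) * (\<psi>2 z * Re (V1 z) - \<psi>1 z * Re (V2 z))\<bar>" by simp
    also have "\<dots> \<le> (LINT z|lborel. \<bar>Im (v z - c) * (\<psi>2 z * Re (V1 z) - \<psi>1 z * Re (V2 z))\<bar>)" by (rule integral_abs_bound)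
    also have "\<dots> \<le> (LINT z|lborel. \<bar>Im (v z - c)\<bar> * ((\<bar>\<psi>1 z\<bar> + \<bar>\<psi>2 z\<bar>) * s z))"
    proof (rule integral_mono[OF integrable_abs[OF J(2)] i3])
      fix z
      have "\<bar>\<psi>2 z * Re (V1 z) - \<psi>1 z * Re (V2 z)\<bar> \<le> \<bar>\<psi>2 z\<bar> * \<bar>Re (V1 z)\<bar> + \<bar>\<psi>1 z\<bar> * \<bar>Re (V2 z)\<bar>"
        using abs_triangle_ineq4[of "\<psi>2 z * Re (V1 z)" "\<psi>1 z * Re (V2 z)"] by (simp only: abs_mult)
      also have "\<dots> \<le> \<bar>\<psi>2 z\<bar> * s z + \<bar>\<psi>1 z\<bar> * s z"
        by (intro add_mono mult_left_mono order_trans[OF abs_Re_le_cmod] V_le_s) auto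
      finally have "\<bar>\<psi>2 z * Re (V1 z) - \<psi>1 z * Re (V2 z)\<bar> \<le> (\<bar>\<psi>1 z\<bar> + \<bar>\<psi>2 z\<bar>) * s z" by (simp add: algebra_simps)
      then show "\<bar>Im (v z - c) * (\<psi>2 z * Re (V1 z) - \<psi>1 z * Re (V2 z))\<bar> \<le> \<bar>Im (v z - c)\<bar> * ((\<bar>\<psi>1 z\<bar> + \<bar>\<psi>2 z\<bar>) * s z)"
        unfolding abs_mult by (intro mult_left_mono) auto
    qed
    finally show "- (LINT z|lborel. Im (v z - c) * (\<psi>2 z * Re (V1 z) - \<psi>1 z * Re (V2 z))) \<le> (LINT z|lborel. \<bar>Im (v z - c)\<bar> * ((\<bar>\<psi>1 z\<bar> + \<bar>\<psi>2 z\<bar>) * s z))" .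
  qed (use K in simp)
  finally show "(LINT z|lborel. \<psi> z * e z) \<le> 2 * K * (LINT z|lborel. \<bar>Im (v z - c)\<bar> * ((\<bar>\<psi>1 z\<bar> + \<bar>\<psi>2 z\<bar>) * s z))" .
qed

text \<open>With \<open>c = 0\<close> only the imaginary part of \<open>v\<close> enters, so the
  strip bound suffices although the real part may be unbounded. The factor
  \<open>sqrt (\<psi> z)\<close> in the gradient bound lets half of the energy be absorbed on the
  left, and the result does not depend on \<open>R\<close>.\<close>

lemma caccioppoli:
  assumes R: "R > 0" "cball a (2 * R) \<subseteq> cball 0 r" "r < 1" and b: "\<And>z. z \<in> ball 0 1 \<Longrightarrow> \<bar>Im (v z)\<bar> \<le> 2"
  shows "En (cball a R) \<le> 16 * (128 * K)\<^sup>2"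
proof -
  obtain \<psi> \<psi>1 \<psi>2 where \<psi>: "test_fun \<psi> \<psi>1 \<psi>2 (cball a (2 * R))" "\<And>z. 0 \<le> \<psi> z" "\<And>z. \<psi> z \<le> (1::real)"
    "\<And>z. z \<in> cball a R \<Longrightarrow> \<psi> z = 1" "\<And>z. \<bar>\<psi>1 z\<bar> \<le> 16 / R * sqrt (\<psi> z)" "\<And>z. \<bar>\<psi>2 z\<bar> \<le> 16 / R * sqrt (\<psi> z)"
    by (rule cutoff_exists[OF R(1), of a]) blast
  note td = test_funD[OF \<psi>(1)]
  note ec = energy_cutoff[OF \<psi>(1) R(2,3) \<psi>(2)]
  have RR: "cball a R \<subseteq> cball a (2 * R)" using R(1) by (intro subset_cball) auto
  let ?X = "LINT z|lborel. \<psi> z * e z"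
  have "En (cball a R) \<le> ?X"
    unfolding En_def
  proof (rule integral_mono[OF en_int(1) ec(1)])
    show "indicator (cball a R) z * e z \<le> \<psi> z * e z" for z
      using \<psi>(2)[of z] \<psi>(4)[of z] e_nonneg[of z] by (auto simp: indicator_def)
  qed (use RR R in auto)
  have "?X \<le> 2 * K * (LINT z|lborel. \<bar>Im (v z - 0)\<bar> * ((\<bar>\<psi>1 z\<bar> + \<bar>\<psi>2 z\<bar>) * s z))" by (rule ec(2))
  also have "\<dots> \<le> 2 * K * (LINT z|lborel. \<psi> z * e z / (4 * K) + (64\<^sup>2 * K / R\<^sup>2) * indicator (cball a (2 * R)) z)"
  proof (intro mult_left_mono integral_mono')
    show "integrable lborel (\<lambda>z. \<psi> z * e z / (4 * K) + (64\<^sup>2 * K / R\<^sup>2) * indicator (cball a (2 * R)) z)"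
      by (intro Bochner_Integration.integrable_add integrable_divide ec(1) integrable_mult_right integrable_indicator_cball)
    fix z
    show "\<bar>Im (v z - 0)\<bar> * ((\<bar>\<psi>1 z\<bar> + \<bar>\<psi>2 z\<bar>) * s z) \<le> \<psi> z * e z / (4 * K) + (64\<^sup>2 * K / R\<^sup>2) * indicator (cball a (2 * R)) z"
    proof (cases "z \<in> cball a (2 * R)")
      case True
      then have "z \<in> ball 0 1" using R(2,3) by auto
      define x y where "x = sqrt (\<psi> z) * s z" and "y = 64 / R"
      have x2: "x\<^sup>2 = \<psi> z * e z" using \<psi>(2)[of z] by (simp add: x_def power_mult_distrib s_sq)
      have "\<bar>Im (v z - 0)\<bar> * ((\<bar>\<psi>1 z\<bar> + \<bar>\<psi>2 z\<bar>) * s z) \<le> 2 * ((16 / R * sqrt (\<psi> z) + 16 / R * sqrt (\<psi> z)) * s z)"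
        using b[OF \<open>z \<in> ball 0 1\<close>] s_nonneg[of z] R(1) \<psi>(2)[of z] by (intro mult_mono add_mono \<psi>) auto
      also have "\<dots> = x * y" by (simp add: x_def y_def)
      \<comment> \<open>The weight is chosen so that the first term, multiplied by the outer
        \<open>2 * K\<close>, becomes exactly half of \<open>?X\<close>.\<close>
      also have "\<dots> \<le> x\<^sup>2 / (4 * K) + K * y\<^sup>2"
      proof -
        have "0 \<le> (x - 2 * K * y)\<^sup>2 / (4 * K)" using K by simp
        also have "\<dots> = x\<^sup>2 / (4 * K) + K * y\<^sup>2 - x * y" using K by (simp add: power2_diff field_simps power2_eq_square)
        finally show ?thesis by simp
      qed
      finally show ?thesis using True by (simp add: x2 y_def power_divide mult.commute)
    next
      case False
      then show ?thesis using td(6-8)[of z] by simp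
    qed
    show "0 \<le> \<psi> z * e z / (4 * K) + (64\<^sup>2 * K / R\<^sup>2) * indicator (cball a (2 * R)) z"
      using \<psi>(2)[of z] e_nonneg[of z] K by (intro add_nonneg_nonneg divide_nonneg_nonneg mult_nonneg_nonneg) auto
  qed (use K in auto)
  also have "\<dots> = 2 * K * (?X / (4 * K) + (64\<^sup>2 * K / R\<^sup>2) * (LINT z|lborel. indicator (cball a (2 * R)) z))"
    by (subst Bochner_Integration.integral_add)
       (use ec(1) in \<open>auto intro!: integrable_indicator_cball integrable_mult_right simp del: times_divide_eq_left\<close>)
  also have "\<dots> \<le> 2 * K * (?X / (4 * K) + (64\<^sup>2 * K / R\<^sup>2) * (4 * (2 * R)\<^sup>2))"
    using K R integral_indicator_cball_le[of "2 * R" a] by (intro mult_left_mono add_left_mono) auto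
  also have "\<dots> = ?X / 2 + 8 * (128 * K)\<^sup>2" using K R by (simp add: field_simps power2_eq_square)
  finally show ?thesis using \<open>En (cball a R) \<le> ?X\<close> by linarith
qed

text \<open>The gradient of the cutoff lives on the annulus \<open>N\<close>, so one factor of the
  energy estimate is integrated over \<open>N\<close> only. There \<open>v - c\<close> is bounded by
  a dyadic sum of local integrals of \<open>s\<close>; integrating this against \<open>s\<close> by
  \<open>schur\<close> gives terms quadratic in \<open>s\<close>, in which the weight
  \<open>l\<close> goes to the annulus and \<open>1 / l\<close> to the large disk.\<close>

lemma hole_filling:
  fixes n :: nat
  defines "R \<equiv> (1/2) ^ n"
  assumes a: "cball a (8 * R) \<subseteq> cball 0 r" "r < 1" and l: "l > 0"
  shows "En (cball a R) \<le> 64 * K * (864 / bump_mass) * (l * (En (cball a (8 * R)) - En (cball a R)) + En (cball a (8 * R)) / l)"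
proof -
  have R: "R > 0" by (simp add: R_def)
  have sub: "cball b t \<subseteq> cball a (8 * R)" if "dist a b + t \<le> 8 * R" for b t
  proof
    fix w assume "w \<in> cball b t"
    then show "w \<in> cball a (8 * R)" using that dist_triangle[of a w b] by auto
  qed
  have sub0: "cball b t \<subseteq> cball 0 r" if "dist a b + t \<le> 8 * R" for b t using sub[OF that] a by blast
  obtain \<psi> \<psi>1 \<psi>2 where \<psi>: "test_fun \<psi> \<psi>1 \<psi>2 (cball a (2 * R))" "\<And>z. 0 \<le> \<psi> z" "\<And>z. \<psi> z \<le> (1::real)"
    "\<And>z. z \<in> cball a R \<Longrightarrow> \<psi> z = 1" "\<And>z. z \<in> cball a R \<Longrightarrow> \<psi>1 z = 0" "\<And>z. z \<in> cball a R \<Longrightarrow> \<psi>2 z = 0"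
    "\<And>z. \<bar>\<psi>1 z\<bar> \<le> 16 / R * sqrt (\<psi> z)" "\<And>z. \<bar>\<psi>2 z\<bar> \<le> 16 / R * sqrt (\<psi> z)"
    by (rule cutoff_exists[OF R, of a]) blast
  note td = test_funD[OF \<psi>(1)]
  have s2: "cball a (2 * R) \<subseteq> cball 0 r" using R by (intro sub0) auto
  note ec = energy_cutoff[OF \<psi>(1) s2 a(2) \<psi>(2)]
  define N where "N = cball a (2 * R) - cball a R"
  have Nb: "N \<in> sets borel" "N \<subseteq> cball a (2 * R)" "N \<subseteq> cball 0 r" using s2 by (auto simp: N_def)
  \<comment> \<open>The average at scale \<open>R\<close> around the centre plays the part of the
    mean in a Poincare inequality.\<close>
  define c where "c = A n a"
  have cv: "continuous_on (cball 0 r) v" using sob a(2) by (auto simp: sobolev_12_loc_def intro!: continuous_on_subset[of "ball 0 1"])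
  have ivc: "integrable lborel (\<lambda>z. indicator N z * cmod (v z - c) * s z)"
    by (rule s_continuous_int[OF Nb(1,3) a(2)]) (intro continuous_intros cv)
  have 1: "En (cball a R) \<le> 64 * K / R * (LINT z|lborel. indicator N z * cmod (v z - c) * s z)"
  proof -
    have "En (cball a R) \<le> (LINT z|lborel. \<psi> z * e z)"
      unfolding En_def
    proof (rule integral_mono[OF en_int(1) ec(1)])
      show "indicator (cball a R) z * e z \<le> \<psi> z * e z" for z
        using \<psi>(2)[of z] \<psi>(4)[of z] e_nonneg[of z] by (auto simp: indicator_def)
      show "cball a R \<subseteq> cball 0 r" using R by (intro sub0) auto
    qed (use a in auto)
    also have "\<dots> \<le> 2 * K * (LINT z|lborel. \<bar>Im (v z - c)\<bar> * ((\<bar>\<psi>1 z\<bar> + \<bar>\<psi>2 z\<bar>) * s z))" by (rule ec(2))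
    also have "\<dots> \<le> 2 * K * (LINT z|lborel. 32 / R * (indicator N z * cmod (v z - c) * s z))"
    proof (intro mult_left_mono integral_mono')
      show "integrable lborel (\<lambda>z. 32 / R * (indicator N z * cmod (v z - c) * s z))" using ivc by (rule integrable_mult_right)
      fix z
      show "\<bar>Im (v z - c)\<bar> * ((\<bar>\<psi>1 z\<bar> + \<bar>\<psi>2 z\<bar>) * s z) \<le> 32 / R * (indicator N z * cmod (v z - c) * s z)"
      proof (cases "z \<in> N")
        case True
        have "16 / R * sqrt (\<psi> z) \<le> 16 / R * 1" using \<psi>(3)[of z] R by (intro mult_left_mono) auto
        then have "\<bar>\<psi>1 z\<bar> + \<bar>\<psi>2 z\<bar> \<le> 32 / R" using \<psi>(7,8)[of z] by simp
        then have "\<bar>Im (v z - c)\<bar> * ((\<bar>\<psi>1 z\<bar> + \<bar>\<psi>2 z\<bar>) * s z) \<le> cmod (v z - c) * (32 / R * s z)"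
          using s_nonneg[of z] R by (intro mult_mono abs_Im_le_cmod) auto
        then show ?thesis using True by (simp add: mult.commute mult.left_commute)
      next
        case False
        then have "\<psi>1 z = 0" "\<psi>2 z = 0" using td(7,8)[of z] \<psi>(5,6)[of z] unfolding N_def by blast+
        then show ?thesis using False by simp
      qed
      show "0 \<le> 32 / R * (indicator N z * cmod (v z - c) * s z)" using R s_nonneg[of z] by simp
    qed (use K in auto)
    finally show ?thesis by simp
  qed
  define M where "M = l * En N + En (cball a (8 * R)) / l"
  have M0: "M \<ge> 0" using l En_nonneg by (simp add: M_def)
  have sch: "integrable lborel (\<lambda>z. indicator N z * s z * Sn (cball z \<rho>))"
    "(LINT z|lborel. indicator N z * s z * Sn (cball z \<rho>)) \<le> 2 * \<rho>\<^sup>2 * M" if "0 \<le> \<rho>" "\<rho> \<le> 6 * R" for \<rho>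
  proof -
    have "cball z \<rho> \<subseteq> cball a (8 * R)" if "z \<in> N" for z
      using that Nb(2) \<open>\<rho> \<le> 6 * R\<close> by (intro sub) (auto simp: subset_iff)
    from schur[OF Nb(1) _ a this that(1) l]
    show "integrable lborel (\<lambda>z. indicator N z * s z * Sn (cball z \<rho>))"
      "(LINT z|lborel. indicator N z * s z * Sn (cball z \<rho>)) \<le> 2 * \<rho>\<^sup>2 * M" by (simp_all add: M_def)
  qed
  have 2: "(LINT z|lborel. indicator N z * cmod (v z - c) * s z) \<le> 864 / bump_mass * R * M + \<epsilon> * Sn N" if ep: "\<epsilon> > 0" for \<epsilon>
  proof -
    obtain m0 where "\<And>m z. m \<ge> m0 \<Longrightarrow> z \<in> cball 0 r \<Longrightarrow> dist (A m z) (v z) < \<epsilon>"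
      using uniform_limitD[OF A_uniform_limit[OF a(2)] ep] unfolding eventually_sequentially by blast
    then obtain m where m: "\<And>z. z \<in> cball 0 r \<Longrightarrow> dist (A (n + m) z) (v z) < \<epsilon>" by (meson le_add2)
    let ?t = "\<lambda>k. (1/2) ^ (n + k) :: real"
    \<comment> \<open>From \<open>v z\<close> one passes through the averages at \<open>z\<close>,
      starting at a scale so fine that the error is below \<open>\<epsilon>\<close>, and then from
      \<open>A n z\<close> to \<open>A n a\<close> by the Lipschitz bound on
      \<open>cball a (2 * R)\<close>. The disks used there have centres within \<open>4 * R\<close>
      of \<open>z\<close> and radius \<open>R\<close>, hence lie in
      \<open>cball z (5 * R)\<close>.\<close>
    have pw: "cmod (v z - c) \<le> (\<Sum>k<m. 16 / bump_mass * 2 ^ (n + k) * Sn (cball z (?t k))) + 16 / (R * bump_mass) * Sn (cball z (5 * R)) + \<epsilon>"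
      if z: "z \<in> N" for z
    proof -
      have za: "dist a z \<le> 2 * R" using z Nb(2) by auto
      have zr: "cball z R \<subseteq> cball 0 r" using za R by (intro sub0) auto
      have "cmod (A n z - A n a) \<le> 8 * 4 ^ n / bump_mass * Sn (cball z (5 * R)) * cmod (z - a)"
      proof (rule A_lipschitz[OF convex_cball _ a(2), of a "2 * R"])
        fix w assume w: "w \<in> cball a (2 * R)"
        show "cball w ((1/2) ^ n) \<subseteq> cball 0 r" using w R unfolding R_def[symmetric] by (intro sub0) auto
        have "cball w R \<subseteq> cball z (5 * R)"
        proof
          fix u assume "u \<in> cball w R"
          then show "u \<in> cball z (5 * R)" using w za dist_triangle[of z u w] dist_triangle[of z w a] by (auto simp: dist_commute)
        qed
        then show "Sn (cball w ((1/2) ^ n)) \<le> Sn (cball z (5 * R))"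
          unfolding R_def[symmetric] using za R by (intro En_mono(2)[OF _ _ _ _ a(2)] sub0) auto
      qed (use za R in \<open>auto simp: dist_commute\<close>)
      also have "\<dots> \<le> 8 * 4 ^ n / bump_mass * Sn (cball z (5 * R)) * (2 * R)"
        using za bump_mass_pos Sn_nonneg[of "cball z (5 * R)"] by (intro mult_left_mono) (auto simp: dist_norm norm_minus_commute)
      also have "4 ^ n = 1 / R\<^sup>2" by (simp add: R_def power_divide power2_eq_square power_mult_distrib[symmetric])
      also have "8 * (1 / R\<^sup>2) / bump_mass * Sn (cball z (5 * R)) * (2 * R) = 16 / (R * bump_mass) * Sn (cball z (5 * R))"
        using R bump_mass_pos by (simp add: field_simps power2_eq_square)
      finally have a1: "cmod (A n z - A n a) \<le> 16 / (R * bump_mass) * Sn (cball z (5 * R))" .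
      have a2: "cmod (v z - A n z) \<le> (\<Sum>k<m. 16 / bump_mass * 2 ^ (n + k) * Sn (cball z (?t k))) + cmod (v z - A (n + m) z)"
        by (rule A_pointwise[OF zr[unfolded R_def] a(2)])
      have "z \<in> cball 0 r" using subsetD[OF zr, of z] R by simp
      then have a3: "cmod (v z - A (n + m) z) < \<epsilon>" using m[of z] by (simp add: dist_norm norm_minus_commute)
      have "cmod (v z - c) \<le> cmod (v z - A n z) + cmod (A n z - A n a)"
        unfolding c_def using norm_triangle_ineq[of "v z - A n z" "A n z - A n a"] by simp
      then show ?thesis using a1 a2 a3 by linarith
    qed
    let ?b = "\<lambda>z. (\<Sum>k<m. 16 / bump_mass * 2 ^ (n + k) * (indicator N z * s z * Sn (cball z (?t k)))) + 16 / (R * bump_mass) * (indicator N z * s z * Sn (cball z (5 * R))) + \<epsilon> * (indicator N z * s z)"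
    have tk: "0 \<le> ?t k" "?t k \<le> 6 * R" for k
      unfolding R_def power_add using order_trans[OF power_le_one[of "1/2::real" k], of 6] by auto
    have R5: "0 \<le> 5 * R" "5 * R \<le> 6 * R" using R by auto
    note isN = en_int(2)[OF Nb(1,3) a(2)]
    have "(LINT z|lborel. indicator N z * cmod (v z - c) * s z) \<le> (LINT z|lborel. ?b z)"
    proof (rule integral_mono[OF ivc])
      show "integrable lborel ?b"
        by (intro Bochner_Integration.integrable_add Bochner_Integration.integrable_sum integrable_mult_right sch tk R5 isN)
      fix z
      show "indicator N z * cmod (v z - c) * s z \<le> ?b z"
      proof (cases "z \<in> N")
        case True
        have "cmod (v z - c) * s z \<le> ((\<Sum>k<m. 16 / bump_mass * 2 ^ (n + k) * Sn (cball z (?t k))) + 16 / (R * bump_mass) * Sn (cball z (5 * R)) + \<epsilon>) * s z"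
          by (rule mult_right_mono[OF pw[OF True] s_nonneg])
        also have "\<dots> = ?b z"
          unfolding distrib_right sum_distrib_right using True by (simp add: mult_ac)
        finally show ?thesis using True by simp
      qed simp
    qed
    also have "\<dots> = (\<Sum>k<m. 16 / bump_mass * 2 ^ (n + k) * (LINT z|lborel. indicator N z * s z * Sn (cball z (?t k)))) + 16 / (R * bump_mass) * (LINT z|lborel. indicator N z * s z * Sn (cball z (5 * R))) + \<epsilon> * Sn N"
      unfolding Sn_def[of N] using sch(1)[OF tk] sch(1)[OF R5] isN
      by (simp only: Bochner_Integration.integral_add Bochner_Integration.integral_sum integral_mult_right_zero
          Bochner_Integration.integrable_add Bochner_Integration.integrable_sum integrable_mult_right)
    also have "\<dots> \<le> (\<Sum>k<m. 16 / bump_mass * 2 ^ (n + k) * (2 * (?t k)\<^sup>2 * M)) + 16 / (R * bump_mass) * (2 * (5 * R)\<^sup>2 * M) + \<epsilon> * Sn N"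
      using bump_mass_pos R by (intro add_mono sum_mono mult_left_mono sch tk R5 order_refl) auto
    also have "(\<Sum>k<m. 16 / bump_mass * 2 ^ (n + k) * (2 * (?t k)\<^sup>2 * M)) = 32 / bump_mass * R * M * (\<Sum>k<m. (1/2) ^ k)"
    proof -
      have "16 / bump_mass * 2 ^ (n + k) * (2 * (?t k)\<^sup>2 * M) = 32 / bump_mass * R * M * (1/2) ^ k" for k
      proof -
        have "2 ^ (n + k) * (?t k) = (1::real)" by (simp add: power_mult_distrib[symmetric])
        then have "2 ^ (n + k) * (?t k)\<^sup>2 = ?t k" by (simp add: power2_eq_square mult.assoc[symmetric])
        also have "?t k = R * (1/2) ^ k" by (simp add: R_def power_add)
        finally have *: "2 ^ (n + k) * (?t k)\<^sup>2 = R * (1/2) ^ k" .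
        have "16 / bump_mass * 2 ^ (n + k) * (2 * (?t k)\<^sup>2 * M) = 32 / bump_mass * M * (2 ^ (n + k) * (?t k)\<^sup>2)" by simp
        then show ?thesis unfolding * by simp
      qed
      then show ?thesis by (simp only: sum_distrib_left)
    qed
    also have "32 / bump_mass * R * M * (\<Sum>k<m. (1/2) ^ k) \<le> 32 / bump_mass * R * M * 2"
    proof (rule mult_left_mono)
      show "(\<Sum>k<m. (1/2) ^ k) \<le> (2::real)" by (subst sum_gp_strict) auto
      show "0 \<le> 32 / bump_mass * R * M" using bump_mass_pos R M0 by simp
    qed
    \<comment> \<open>\<open>864 = 64 + 800\<close>: the geometric sum contributes
      \<open>32 * 2\<close> and the Lipschitz part \<open>16 * 2 * 25\<close>.\<close>
    also have "32 / bump_mass * R * M * 2 + 16 / (R * bump_mass) * (2 * (5 * R)\<^sup>2 * M) + \<epsilon> * Sn N = 864 / bump_mass * R * M + \<epsilon> * Sn N"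
      using R bump_mass_pos by (simp add: field_simps power2_eq_square)
    finally show ?thesis by simp
  qed
  have "(LINT z|lborel. indicator N z * cmod (v z - c) * s z) \<le> 864 / bump_mass * R * M"
  proof (rule field_le_epsilon)
    fix \<delta> :: real assume d: "\<delta> > 0"
    have "\<delta> / (Sn N + 1) > 0" using d Sn_nonneg[of N] by simp
    from 2[OF this] have "(LINT z|lborel. indicator N z * cmod (v z - c) * s z) \<le> 864 / bump_mass * R * M + \<delta> * (Sn N / (Sn N + 1))" by simp
    also have "\<dots> \<le> 864 / bump_mass * R * M + \<delta> * 1" using d Sn_nonneg[of N] by (intro add_left_mono mult_left_mono) auto
    finally show "(LINT z|lborel. indicator N z * cmod (v z - c) * s z) \<le> 864 / bump_mass * R * M + \<delta>" by simp
  qed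
  then have "En (cball a R) \<le> 64 * K / R * (864 / bump_mass * R * M)"
    using order_trans[OF 1 mult_left_mono] K R by (meson divide_nonneg_pos mult_nonneg_nonneg order.trans zero_le_numeral zero_le_one)
  also have "\<dots> = 64 * K * (864 / bump_mass) * M" using R by simp
  also have "\<dots> \<le> 64 * K * (864 / bump_mass) * (l * (En (cball a (8 * R)) - En (cball a R)) + En (cball a (8 * R)) / l)"
  proof -
    \<comment> \<open>The annulus and the small disk are disjoint parts of the large disk; this
      produces the difference of energies from which the hole is filled.\<close>
    have "En N + En (cball a R) \<le> En (cball a (8 * R))"
    proof -
      have sR: "cball a R \<subseteq> cball 0 r" using R by (intro sub0) auto
      have i: "integrable lborel (\<lambda>z. indicator N z * e z)" "integrable lborel (\<lambda>z. indicator (cball a R) z * e z)" "integrable lborel (\<lambda>z. indicator (cball a (8 * R)) z * e z)"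
        by (rule en_int(1)[OF Nb(1,3) a(2)], rule en_int(1)[OF _ sR a(2)], simp, rule en_int(1)[OF _ a], simp)
      have "En N + En (cball a R) = (LINT z|lborel. indicator N z * e z + indicator (cball a R) z * e z)"
        unfolding En_def using i by simp
      also have "\<dots> \<le> En (cball a (8 * R))"
        unfolding En_def
      proof (rule integral_mono)
        show "indicator N z * e z + indicator (cball a R) z * e z \<le> indicator (cball a (8 * R)) z * e z" for z
          using e_nonneg[of z] R by (auto simp: N_def indicator_def)
      qed (use i in auto)
      finally show ?thesis .
    qed
    then show ?thesis unfolding M_def using K bump_mass_pos l by (intro mult_left_mono add_right_mono) auto
  qed
  finally show ?thesis .
qed

end

context qr_disk begin

text \<open>The choice \<open>l = 4 * C\<close> makes the last term of \<open>hole_filling\<close> a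
  quarter of the outer energy; adding \<open>4 * C^2\<close> times the inner energy to both sides
  fills the hole and leaves a factor below \<open>1\<close>. Three dyadic steps match the ratio
  \<open>8\<close> of the radii.\<close>

lemma energy_decay:
  fixes n :: nat
  defines "C \<equiv> 64 * K * (864 / bump_mass)"
  assumes a: "cball a ((1/2) ^ n) \<subseteq> cball 0 r" "r < 1"
  shows "En (cball a ((1/2) ^ (n + 3))) \<le> (4 * C\<^sup>2 + 1/4) / (4 * C\<^sup>2 + 1) * En (cball a ((1/2) ^ n))"
proof -
  have C: "C > 0" using K bump_mass_pos by (simp add: C_def)
  have 8: "8 * (1/2) ^ (n + 3) = ((1/2) ^ n :: real)" by (simp add: power_add power3_eq_cube)
  let ?E = "En (cball a ((1/2) ^ (n + 3)))" and ?E8 = "En (cball a ((1/2) ^ n))"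
  have "?E \<le> C * (4 * C * (?E8 - ?E) + ?E8 / (4 * C))"
    using hole_filling[of a "n + 3" r "4 * C"] a C unfolding 8 C_def[symmetric] by simp
  also have "\<dots> = 4 * C\<^sup>2 * (?E8 - ?E) + ?E8 / 4" using C by (simp add: field_simps power2_eq_square)
  finally have "?E * (4 * C\<^sup>2 + 1) \<le> (4 * C\<^sup>2 + 1/4) * ?E8" by (simp add: algebra_simps)
  moreover have "4 * C\<^sup>2 + 1 > 0" by (simp add: add_nonneg_pos)
  ultimately show ?thesis by (simp add: pos_le_divide_eq)
qed

text \<open>Energy decaying like \<open>t ^ (2 * k)\<close> makes the term with index
  \<open>k\<close> of the dyadic sum decay like \<open>t ^ k\<close>, so the sum is bounded by a
  geometric series.\<close>

lemma morrey:
  fixes n :: nat and t M :: real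
  assumes z: "cball z ((1/2) ^ n) \<subseteq> cball 0 r" "r < 1" and t: "0 < t" "t < 1"
    and E: "\<And>k. En (cball z ((1/2) ^ (n + k))) \<le> M * t ^ (2 * k)"
  shows "cmod (v z - A n z) \<le> 16 / bump_mass * (2 + M / 2) / (1 - t)"
proof (rule field_le_epsilon)
  fix \<epsilon> :: real assume ep: "\<epsilon> > 0"
  have "M \<ge> 0" using E[of 0] En_nonneg[of "cball z ((1/2)^n)"] by simp
  define D where "D = 16 / bump_mass * (2 + M / 2)"
  have D: "D \<ge> 0" using bump_mass_pos \<open>M \<ge> 0\<close> by (simp add: D_def)
  have "z \<in> cball 0 r" using subsetD[OF z(1), of z] by simp
  then have "(\<lambda>m. A m z) \<longlonglongrightarrow> v z" using A_uniform_limit[OF z(2)] by (auto intro: tendsto_uniform_limitI)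
  then have "\<forall>\<^sub>F m in sequentially. dist (A m z) (v z) < \<epsilon>" using ep by (rule tendstoD)
  then obtain m0 where "\<And>m. m \<ge> m0 \<Longrightarrow> dist (A m z) (v z) < \<epsilon>" unfolding eventually_sequentially by blast
  then obtain m where m: "dist (A (n + m) z) (v z) < \<epsilon>" by (meson le_add2)
  have tm: "16 / bump_mass * 2 ^ (n + k) * Sn (cball z ((1/2) ^ (n + k))) \<le> D * t ^ k" for k
  proof -
    \<comment> \<open>The weight \<open>?l\<close> balances the two terms of \<open>Sn_le\<close>:
      after multiplication by \<open>2 ^ (n + k)\<close> both are constant multiples of
      \<open>t ^ k\<close>.\<close>
    let ?r = "(1/2) ^ (n + k) :: real" and ?l = "2 ^ (n + k) * t ^ k"
    have sub: "cball z ?r \<subseteq> cball 0 r" using z(1) subset_cball[of ?r "(1/2) ^ n" z] power_decreasing[of n "n + k" "1/2::real"] by auto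
    have "Sn (cball z ?r) \<le> 2 * ?l * ?r\<^sup>2 + En (cball z ?r) / (2 * ?l)"
      by (rule Sn_le[OF sub z(2)]) (use t in auto)
    also have "\<dots> \<le> 2 * ?l * ?r\<^sup>2 + M * t ^ (2 * k) / (2 * ?l)"
      using t by (intro add_left_mono divide_right_mono E) auto
    finally have "2 ^ (n + k) * Sn (cball z ?r) \<le> 2 ^ (n + k) * (2 * ?l * ?r\<^sup>2 + M * t ^ (2 * k) / (2 * ?l))"
      by (intro mult_left_mono) auto
    also have "\<dots> = 2 * (2 ^ (n + k) * ?r)\<^sup>2 * t ^ k + M / 2 * t ^ k"
    proof -
      have alg: "p * (2 * (p * T) * q\<^sup>2 + M * T\<^sup>2 / (2 * (p * T))) = 2 * (p * q)\<^sup>2 * T + M / 2 * T"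
        if "p > 0" "T > 0" for p T q :: real
        using that by (simp add: field_simps power2_eq_square)
      have "t ^ (2 * k) = (t ^ k)\<^sup>2" by (simp add: power_mult[symmetric] mult.commute)
      then show ?thesis using alg[of "2 ^ (n + k)" "t ^ k" ?r] t by (simp only: zero_less_power zero_less_numeral)
    qed
    also have "2 ^ (n + k) * ?r = 1" by (simp add: power_mult_distrib[symmetric])
    finally have "2 ^ (n + k) * Sn (cball z ?r) \<le> (2 + M / 2) * t ^ k" by (simp add: algebra_simps)
    then have "16 / bump_mass * (2 ^ (n + k) * Sn (cball z ?r)) \<le> 16 / bump_mass * ((2 + M / 2) * t ^ k)"
      using bump_mass_pos by (intro mult_left_mono) auto
    then show ?thesis unfolding D_def by (simp only: mult.assoc)
  qed
  have "cmod (v z - A n z) \<le> (\<Sum>k<m. 16 / bump_mass * 2 ^ (n + k) * Sn (cball z ((1/2) ^ (n + k)))) + cmod (v z - A (n + m) z)"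
    by (rule A_pointwise[OF z])
  also have "\<dots> \<le> (\<Sum>k<m. D * t ^ k) + \<epsilon>"
    using m by (intro add_mono sum_mono tm) (auto simp: dist_norm norm_minus_commute)
  also have "(\<Sum>k<m. D * t ^ k) = D * (\<Sum>k<m. t ^ k)" by (simp add: sum_distrib_left)
  also have "\<dots> \<le> D * (1 / (1 - t))"
  proof (intro mult_left_mono D)
    show "(\<Sum>k<m. t ^ k) \<le> 1 / (1 - t)" using t by (subst sum_gp_strict) (auto simp: divide_right_mono)
  qed
  finally show "cmod (v z - A n z) \<le> 16 / bump_mass * (2 + M / 2) / (1 - t) + \<epsilon>" by (simp add: D_def)
qed

end

text \<open>One constant serves all maps into the strip, since the initial energy, the decay rate
  and the Lipschitz bound depend only on \<open>K\<close> and \<open>\<rho>\<close>. This uniformity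
  is what the maximisation over lifts consumes.\<close>

lemma qr_disk_oscillation:
  fixes K \<rho> :: real
  assumes K: "K \<ge> 1" and \<rho>: "\<rho> < 1"
  shows "\<exists>C. \<forall>v V1 V2. qr_disk K v V1 V2 \<longrightarrow> (\<forall>z\<in>ball 0 1. \<bar>Im (v z)\<bar> \<le> 2) \<longrightarrow>
     (\<forall>x\<in>cball 0 \<rho>. \<forall>y\<in>cball 0 \<rho>. cmod (v x - v y) \<le> C)"
proof -
  define r where "r = \<rho> + (1 - \<rho>) / 2"
  have r: "r < 1" using \<rho> by (simp add: r_def field_simps)
  have "(\<lambda>n. (1/2::real) ^ n) \<longlonglongrightarrow> 0" by (intro LIMSEQ_power_zero) auto
  then have "\<forall>\<^sub>F n in sequentially. (1/2::real) ^ n < (1 - \<rho>) / 4" using \<rho> by (intro order_tendstoD) auto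
  then obtain n where n: "(1/2::real) ^ n < (1 - \<rho>) / 4" using eventually_happens'[OF sequentially_bot] by blast
  have sub: "cball z (2 * (1/2) ^ n) \<subseteq> cball 0 r" if "z \<in> cball 0 \<rho>" for z :: complex
  proof
    fix w assume "w \<in> cball z (2 * (1/2) ^ n)"
    then have "cmod (w - z) \<le> 2 * (1/2) ^ n" by (simp only: mem_cball dist_norm norm_minus_commute)
    moreover have "cmod z \<le> \<rho>" using that by simp
    ultimately have "cmod w \<le> r" unfolding r_def using n norm_triangle_ineq2[of w z] by linarith
    then show "w \<in> cball 0 r" by simp
  qed
  have sub1: "cball z ((1/2) ^ n) \<subseteq> cball 0 r" if "z \<in> cball 0 \<rho>" for z :: complex
    using sub[OF that] subset_cball[of "(1/2) ^ n" "2 * (1/2) ^ n" z] by auto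
  define C where "C = 64 * K * (864 / bump_mass)"
  define q where "q = (4 * C\<^sup>2 + 1/4) / (4 * C\<^sup>2 + 1)"
  have d: "4 * C\<^sup>2 + 1 > 0" by (simp add: add_nonneg_pos)
  have q: "0 < q" "q < 1" using d by (auto simp: q_def add_nonneg_pos divide_less_eq)
  \<comment> \<open>Three dyadic steps cost a factor \<open>q = t ^ 6\<close>, so one step costs
    \<open>t^2\<close>, the rate that \<open>morrey\<close> expects.\<close>
  define t where "t = root 6 q"
  have t: "0 < t" "t < 1" "t ^ 6 = q" using q by (auto simp: t_def real_root_lt_1_iff)
  define M0 where "M0 = 16 * (128 * K)\<^sup>2"
  have M0: "M0 \<ge> 0" by (simp add: M0_def)
  \<comment> \<open>Dividing by \<open>t ^ 4\<close> covers the start \<open>k < 3\<close> of the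
    induction, before \<open>energy_decay\<close> applies.\<close>
  define M where "M = M0 / t ^ 4"
  define X where "X = 16 / bump_mass * (2 + M / 2) / (1 - t)"
  define Y where "Y = 8 * 4 ^ n / bump_mass * (2 * ((1/2) ^ n)\<^sup>2 + M0 / 2)"
  have Y: "Y \<ge> 0" unfolding Y_def using bump_mass_pos M0 by simp
  show ?thesis
  proof (intro exI[of _ "2 * X + Y * 2"] allI impI ballI)
    fix v V1 V2 :: "complex \<Rightarrow> complex" and x y :: complex
    assume qd: "qr_disk K v V1 V2" and im: "\<forall>z\<in>ball 0 1. \<bar>Im (v z)\<bar> \<le> 2" and x: "x \<in> cball 0 \<rho>" and y: "y \<in> cball 0 \<rho>"
    interpret qr_disk K v V1 V2 by fact
    have E0: "En (cball z ((1/2) ^ n)) \<le> M0" if "z \<in> cball 0 \<rho>" for z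
      unfolding M0_def by (rule caccioppoli[OF _ sub[OF that] r]) (use im in auto)
    have Ek: "En (cball z ((1/2) ^ (n + k))) \<le> M * t ^ (2 * k)" if z: "z \<in> cball 0 \<rho>" for z k
    proof (induction k rule: less_induct)
      case (less k)
      have sk: "cball z ((1/2) ^ (n + j)) \<subseteq> cball z ((1/2) ^ n)" for j
        by (intro subset_cball power_decreasing) auto
      show ?case
      proof (cases "k < 3")
        case True
        have "En (cball z ((1/2) ^ (n + k))) \<le> En (cball z ((1/2) ^ n))"
          by (rule En_mono(1)[OF _ _ sk sub1[OF z] r]) auto
        also have "\<dots> \<le> M0" by (rule E0[OF z])
        also have "\<dots> = M0 / t ^ 4 * t ^ 4" using t by simp
        also have "\<dots> \<le> M0 / t ^ 4 * t ^ (2 * k)"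
          using t M0 True by (intro mult_left_mono power_decreasing) auto
        finally show ?thesis by (simp add: M_def)
      next
        case False
        then obtain j where j: "k = j + 3" by (metis add.commute le_Suc_ex not_less)
        have "En (cball z ((1/2) ^ (n + j + 3))) \<le> q * En (cball z ((1/2) ^ (n + j)))"
          unfolding q_def C_def by (rule energy_decay[OF _ r]) (use sk[of j] sub1[OF z] in auto)
        also have "\<dots> \<le> q * (M * t ^ (2 * j))" using q by (intro mult_left_mono less) (auto simp: j)
        also have "\<dots> = M * t ^ (2 * k)" unfolding t(3)[symmetric] j by (simp add: power_add algebra_simps)
        finally show ?thesis by (simp add: j add.assoc)
      qed
    qed
    have vA: "cmod (v z - A n z) \<le> X" if "z \<in> cball 0 \<rho>" for z
      unfolding X_def by (rule morrey[OF sub1[OF that] r t(1,2) Ek[OF that]])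
    have "cmod (A n x - A n y) \<le> 8 * 4 ^ n / bump_mass * (2 * ((1/2) ^ n)\<^sup>2 + M0 / 2) * cmod (x - y)"
    proof (rule A_lipschitz[OF convex_cball sub1 r _ x y])
      fix z :: complex assume z: "z \<in> cball 0 \<rho>"
      have "Sn (cball z ((1/2) ^ n)) \<le> 2 * 1 * ((1/2) ^ n)\<^sup>2 + En (cball z ((1/2) ^ n)) / (2 * 1)"
        by (rule Sn_le[OF sub1[OF z] r]) auto
      then show "Sn (cball z ((1/2) ^ n)) \<le> 2 * ((1/2) ^ n)\<^sup>2 + M0 / 2" using E0[OF z] by simp
    qed
    also have "\<dots> \<le> Y * 2"
    proof -
      have "cmod (x - y) \<le> 2" using x y \<rho> norm_triangle_ineq4[of x y] by auto
      then show ?thesis unfolding Y_def[symmetric] using Y by (intro mult_left_mono)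
    qed
    finally have "cmod (A n x - A n y) \<le> Y * 2" .
    moreover have "cmod (v x - v y) \<le> cmod (v x - A n x) + cmod (A n x - A n y) + cmod (v y - A n y)"
      using norm_triangle_ineq[of "v x - A n x" "(A n x - A n y) + (A n y - v y)"] norm_triangle_ineq[of "A n x - A n y" "A n y - v y"]
      by (simp add: norm_minus_commute)
    ultimately show "cmod (v x - v y) \<le> 2 * X + Y * 2" using vA[OF x] vA[OF y] by linarith
  qed
qed

text \<open>The two partial derivatives are images of unit vectors, so each is at most the operator
  norm; the passage to the Hilbert-Schmidt norm costs the factor \<open>2\<close>.\<close>

lemma quasiregular_imp_qr_disk:
  assumes "quasiregular K (ball 0 1) v"
  obtains V1 V2 where "qr_disk K v V1 V2"
proof -
  obtain V1 V2 where V: "sobolev_12_loc (ball 0 1) v V1 V2" and K: "K \<ge> 1" and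
    AE: "AE z in lborel. z \<in> ball 0 1 \<longrightarrow> (onorm (\<lambda>h. Re h *\<^sub>R V1 z + Im h *\<^sub>R V2 z))\<^sup>2
             \<le> K * (Re (V1 z) * Im (V2 z) - Re (V2 z) * Im (V1 z))"
    using assms by (auto simp: quasiregular_def)
  from AE have "AE z in lborel. z \<in> ball 0 1 \<longrightarrow>
      (cmod (V1 z))\<^sup>2 + (cmod (V2 z))\<^sup>2 \<le> 2 * K * (Re (V1 z) * Im (V2 z) - Re (V2 z) * Im (V1 z))"
  proof eventually_elim
    case (elim z)
    let ?L = "\<lambda>h. Re h *\<^sub>R V1 z + Im h *\<^sub>R V2 z"
    have "cmod (V1 z) \<le> onorm ?L" "cmod (V2 z) \<le> onorm ?L"
      using onorm[OF partials_bounded_linear[of "V1 z" "V2 z"], of 1] onorm[OF partials_bounded_linear[of "V1 z" "V2 z"], of \<i>] by auto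
    then have "(cmod (V1 z))\<^sup>2 \<le> (onorm ?L)\<^sup>2" "(cmod (V2 z))\<^sup>2 \<le> (onorm ?L)\<^sup>2" by (auto intro: power_mono)
    then show ?case using elim by auto
  qed
  then show ?thesis using that V K by (auto simp: qr_disk_def)
qed

section \<open>From the disk to a strip by a Cayley transform and a logarithm\<close>

lemma Re_pos_exp_strip: "\<bar>Im w\<bar> < pi / 2 \<Longrightarrow> Re (exp w) > 0"
  by (simp add: Re_exp cos_gt_zero_pi abs_less_iff)

lemma Re_cayley: "Re ((1 + u) / (1 - u)) = (1 - (cmod u)\<^sup>2) / (cmod (1 - u))\<^sup>2"
  unfolding Re_divide cmod_power2
  by (simp add: power2_eq_square algebra_simps add_divide_distrib[symmetric] diff_divide_distrib[symmetric])

lemma cayley_inverse: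
  fixes u :: complex
  assumes "1 - u \<noteq> 0"
  shows "((1 + u) / (1 - u) - 1) / ((1 + u) / (1 - u) + 1) = u"
proof -
  have "(1 + u) / (1 - u) - 1 = 2 * u / (1 - u)" "(1 + u) / (1 - u) + 1 = 2 / (1 - u)"
    using assms by (simp_all add: field_simps)
  then show ?thesis using assms by simp
qed

text \<open>Composing \<open>g\<close> with a conformal map of the disk onto a strip of width
  \<open>pi\<close> turns approach to the circle into growth of the real part. The inverse
  \<open>\<Phi> w\<close> is \<open>\<xi> * tanh (w / 2)\<close> written with exponentials, so the
  strip-valued map is again \<open>K\<close>-quasiregular by
  \<open>quasiregular_lift\<close>.\<close>

lemma quasiregular_disk_bound:
  fixes K \<rho> :: real
  assumes K: "K \<ge> 1" and \<rho>: "\<rho> < 1"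
  obtains \<tau> where "\<tau> < 1" "\<And>(g :: complex \<Rightarrow> complex) x z. quasiregular K (ball 0 1) g \<Longrightarrow> g ` ball 0 1 \<subseteq> ball 0 1 \<Longrightarrow> x \<in> cball 0 \<rho> \<Longrightarrow> g x = 0 \<Longrightarrow>
     z \<in> cball 0 \<rho> \<Longrightarrow> cmod (g z) \<le> \<tau>"
proof -
  obtain C where C: "\<And>v V1 V2 x y. qr_disk K v V1 V2 \<Longrightarrow> (\<And>z. z\<in>ball 0 1 \<Longrightarrow> \<bar>Im (v z)\<bar> \<le> 2) \<Longrightarrow>
     x\<in>cball 0 \<rho> \<Longrightarrow> y\<in>cball 0 \<rho> \<Longrightarrow> cmod (v x - v y) \<le> C"
    using qr_disk_oscillation[OF assms] by metis
  \<comment> \<open>This is \<open>tanh (\<bar>C\<bar> / 2)\<close>, the solution \<open>a\<close>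
    of \<open>ln ((1 + a) / (1 - a)) = \<bar>C\<bar>\<close>.\<close>
  define \<tau> where "\<tau> = (exp \<bar>C\<bar> - 1) / (exp \<bar>C\<bar> + 1)"
  have ec: "exp \<bar>C\<bar> + 1 > 0" by (simp add: add_pos_pos)
  have t1: "\<tau> < 1" using ec by (simp add: \<tau>_def divide_less_eq)
  have t0: "\<tau> \<ge> 0" using ec by (simp add: \<tau>_def)
  show ?thesis
  proof (rule that[OF t1])
    fix g and x z :: complex assume g: "quasiregular K (ball 0 1) g" "g ` ball 0 1 \<subseteq> ball 0 1" and x: "x \<in> cball 0 \<rho>" "g x = 0" and z: "z \<in> cball 0 \<rho>"
    show "cmod (g z) \<le> \<tau>"
    proof (cases "g z = 0")
      case False
      \<comment> \<open>The rotation puts \<open>g z / \<xi>\<close> on the positive real axis; then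
        \<open>v z\<close> is real and equals the hyperbolic distance of \<open>g z\<close> from
        \<open>0\<close>.\<close>
      define \<xi> where "\<xi> = g z / of_real (cmod (g z))"
      have xi: "cmod \<xi> = 1" using False by (simp add: \<xi>_def norm_divide)
      then have xi0: "\<xi> \<noteq> 0" by auto
      define m where "m w = (1 + g w / \<xi>) / (1 - g w / \<xi>)" for w
      have u: "cmod (g w / \<xi>) < 1" if "w \<in> ball 0 1" for w
        using subsetD[OF g(2) imageI[OF that]] xi by (simp add: norm_divide)
      have u1: "1 - g w / \<xi> \<noteq> 0" if "w \<in> ball 0 1" for w using u[OF that] by auto
      have Rm: "Re (m w) > 0" if "w \<in> ball 0 1" for w
      proof -
        let ?u = "g w / \<xi>"
        have "Re (m w) = (1 - (cmod ?u)\<^sup>2) / (cmod (1 - ?u))\<^sup>2"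
          unfolding m_def by (rule Re_cayley)
        moreover have "(cmod ?u)\<^sup>2 < 1" using u[OF that] by (simp add: abs_square_less_1)
        ultimately show ?thesis using u1[OF that] by simp
      qed
      define v where "v w = Ln (m w)" for w
      define \<Phi> where "\<Phi> w = \<xi> * ((exp w - 1) / (exp w + 1))" for w
      define U where "U = {w. \<bar>Im w\<bar> < pi / 2}"
      have oU: "open U" unfolding U_def by (intro open_Collect_less continuous_intros)
      have e1: "exp w + 1 \<noteq> 0" if "w \<in> U" for w
        using Re_pos_exp_strip[of w] that by (auto simp: U_def complex_eq_iff)
      have dPhi: "(\<Phi> has_field_derivative \<xi> * (2 * exp w / (exp w + 1)\<^sup>2)) (at w)" if "w \<in> U" for w
        unfolding \<Phi>_def using e1[OF that]
        by (auto intro!: derivative_eq_intros simp: field_simps power2_eq_square)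
      have m0: "m w \<noteq> 0" if "w \<in> ball 0 1" for w using Rm[OF that] by auto
      have vU: "v w \<in> U" if "w \<in> ball 0 1" for w
        using Rm[OF that] m0[OF that] Re_Ln_pos_lt[of "m w"] by (simp add: U_def v_def)
      have gv: "g w = \<Phi> (v w)" if "w \<in> ball 0 1" for w
      proof -
        have "exp (v w) = m w" using m0[OF that] by (simp add: v_def)
        moreover have "(m w - 1) / (m w + 1) = g w / \<xi>" using cayley_inverse[OF u1[OF that]] by (simp only: m_def)
        ultimately show ?thesis using xi0 by (simp add: \<Phi>_def)
      qed
      have cg: "continuous_on (ball 0 1) g" using g(1) by (auto simp: quasiregular_def sobolev_12_loc_def)
      have "continuous_on (ball 0 1) m" unfolding m_def using xi0 u1 by (intro continuous_intros cg) auto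
      then have cv: "continuous_on (ball 0 1) v"
        unfolding v_def using Rm by (intro continuous_on_Ln') (force simp: complex_nonpos_Reals_iff)+
      have "quasiregular K (ball 0 1) v"
      proof (rule quasiregular_lift[OF g(1) cv oU _ _ _ gv])
        show "\<Phi> holomorphic_on U" using dPhi oU by (auto simp: holomorphic_on_open)
        show "deriv \<Phi> (v w) \<noteq> 0" if "w \<in> ball 0 1" for w
          using DERIV_imp_deriv[OF dPhi[OF vU[OF that]]] xi0 e1[OF vU[OF that]] by simp
      qed (use vU in auto)
      then obtain V1 V2 where "qr_disk K v V1 V2" by (rule quasiregular_imp_qr_disk)
      then have "cmod (v z - v x) \<le> C"
      proof (rule C[OF _ _ z x(1)])
        show "\<bar>Im (v w)\<bar> \<le> 2" if "w \<in> ball 0 1" for w using vU[OF that] pi_less_4 by (simp add: U_def)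
      qed
      moreover have "v x = 0" using x by (simp add: v_def m_def)
      moreover define a where "a = cmod (g z)"
      have zb: "z \<in> ball 0 1" using z \<rho> by auto
      have a: "0 \<le> a" "a < 1" using subsetD[OF g(2) imageI[OF zb]] by (auto simp: a_def)
      have "g z / \<xi> = of_real a" using False by (simp add: \<xi>_def a_def)
      then have "m z = of_real ((1 + a) / (1 - a))" by (simp add: m_def)
      then have "v z = of_real (ln ((1 + a) / (1 - a)))"
        unfolding v_def using a by (simp only: Ln_of_real divide_pos_pos add_pos_nonneg zero_less_one diff_gt_0_iff_gt)
      ultimately have "ln ((1 + a) / (1 - a)) \<le> \<bar>C\<bar>" by auto
      then have "(1 + a) / (1 - a) \<le> exp \<bar>C\<bar>" 
        using exp_le_cancel_iff[of "ln ((1 + a) / (1 - a))" "\<bar>C\<bar>"] a by simp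
      then have "1 + a \<le> exp \<bar>C\<bar> * (1 - a)" using a by (simp add: pos_divide_le_eq)
      then have "a * (exp \<bar>C\<bar> + 1) \<le> exp \<bar>C\<bar> - 1" by (simp add: algebra_simps)
      then show ?thesis using ec by (simp add: \<tau>_def a_def pos_le_divide_eq)
    qed (use t0 in simp)
  qed
qed

section \<open>Factorisation through holomorphic self-maps of the disk\<close>

definition self_map :: "(complex \<Rightarrow> complex) \<Rightarrow> bool" where
  "self_map P \<longleftrightarrow> P holomorphic_on ball 0 1 \<and> P ` ball 0 1 \<subseteq> ball 0 1 \<and> P 0 = 0"

text \<open>A preorder in which larger means lifted further. The normalisation
  \<open>P 0 = 0\<close> lets Schwarz's lemma compare norms along it, and the condition on
  \<open>deriv P\<close> at the values of \<open>g'\<close> keeps the local invertibility required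
  by \<open>quasiregular_lift\<close>.\<close>

definition factors :: "(complex \<Rightarrow> complex) \<Rightarrow> (complex \<Rightarrow> complex) \<Rightarrow> bool" where
  "factors g g' \<longleftrightarrow> (\<exists>P. self_map P \<and> (\<forall>z\<in>ball 0 1. g z = P (g' z) \<and> deriv P (g' z) \<noteq> 0))"

lemma self_mapD:
  assumes "self_map P"
  shows "P holomorphic_on ball 0 1" "P 0 = 0" "cmod w < 1 \<Longrightarrow> cmod (P w) < 1"
  using assms by (auto simp: self_map_def image_subset_iff)

lemma self_map_comp: "self_map P \<Longrightarrow> self_map Q \<Longrightarrow> self_map (P \<circ> Q)"
  unfolding self_map_def by (auto intro!: holomorphic_on_compose_gen[of Q _ P])

lemma self_map_deriv_comp:
  assumes "self_map P" "self_map Q" "cmod w < 1"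
  shows "deriv (P \<circ> Q) w = deriv P (Q w) * deriv Q w"
proof (rule deriv_chain)
  show "Q field_differentiable at w" "P field_differentiable at (Q w)"
    using self_mapD[OF assms(1)] self_mapD[OF assms(2)] assms(3)
    by (auto intro!: holomorphic_on_imp_differentiable_at[of _ "ball 0 1"])
qed

lemma factors_trans:
  assumes "factors f g" "factors g h" "h ` ball 0 1 \<subseteq> ball 0 1"
  shows "factors f h"
proof -
  obtain P where P: "self_map P" "\<And>z. z \<in> ball 0 1 \<Longrightarrow> f z = P (g z) \<and> deriv P (g z) \<noteq> 0"
    using assms(1) by (auto simp: factors_def)
  obtain Q where Q: "self_map Q" "\<And>z. z \<in> ball 0 1 \<Longrightarrow> g z = Q (h z) \<and> deriv Q (h z) \<noteq> 0"
    using assms(2) by (auto simp: factors_def)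
  have "f z = (P \<circ> Q) (h z) \<and> deriv (P \<circ> Q) (h z) \<noteq> 0" if "z \<in> ball 0 1" for z
  proof -
    have "cmod (h z) < 1" using subsetD[OF assms(3) imageI[OF that]] by simp
    then show ?thesis using P(2)[OF that] Q(2)[OF that] self_map_deriv_comp[OF P(1) Q(1), of "h z"] by auto
  qed
  then show ?thesis unfolding factors_def using self_map_comp[OF P(1) Q(1)] by blast
qed

lemma factors_norm_le:
  assumes "factors g g'" "g' ` ball 0 1 \<subseteq> ball 0 1" "z \<in> ball 0 1"
  shows "cmod (g z) \<le> cmod (g' z)"
proof -
  obtain P where P: "self_map P" "g z = P (g' z)" using assms(1,3) by (auto simp: factors_def)
  have "cmod (g' z) < 1" using subsetD[OF assms(2) imageI[OF assms(3)]] by simp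
  then show ?thesis using Schwarz_Lemma(1)[of P "g' z"] self_mapD[OF P(1)] P(2) by auto
qed

text \<open>Besides giving reflexivity at \<open>c = 1\<close>, this allows the value at
  \<open>y\<close> to be made real and positive, so that the factor in \<open>near_identity\<close>
  is real.\<close>

lemma factors_rotate:
  assumes "cmod c = 1" shows "factors g (\<lambda>z. c * g z)"
proof -
  have c0: "c \<noteq> 0" using assms by auto
  have d: "deriv (\<lambda>w. w / c) w = 1 / c" for w
    using c0 by (intro DERIV_imp_deriv) (auto intro!: derivative_eq_intros)
  have "self_map (\<lambda>w. w / c)" unfolding self_map_def using assms c0
    by (auto intro!: holomorphic_intros simp: norm_divide)
  then show ?thesis unfolding factors_def using c0 by (intro exI[of _ "\<lambda>w. w / c"]) (auto simp: d)
qed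

section \<open>Moebius transformations, Schwarz-Pick and quantitative rigidity\<close>

lemma Moebius_norm_identity:
  assumes "cmod a < 1" "cmod w < 1"
  shows "1 - cnj a * w \<noteq> 0"
    "1 - (cmod (Moebius_function 0 a w))\<^sup>2 = (1 - (cmod a)\<^sup>2) * (1 - (cmod w)\<^sup>2) / (cmod (1 - cnj a * w))\<^sup>2"
proof -
  have "cmod (cnj a * w) < 1" using norm_mult_less[of "cnj a" 1 w 1] assms by simp
  then show nz: "1 - cnj a * w \<noteq> 0" by auto
  have id: "(cmod (1 - cnj a * w))\<^sup>2 - (cmod (w - a))\<^sup>2 = (1 - (cmod a)\<^sup>2) * (1 - (cmod w)\<^sup>2)"
    unfolding cmod_power2 by (simp add: power2_eq_square algebra_simps)
  have "(cmod (Moebius_function 0 a w))\<^sup>2 = (cmod (w - a))\<^sup>2 / (cmod (1 - cnj a * w))\<^sup>2"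
    by (simp add: Moebius_function_simple norm_divide power_divide)
  then show "1 - (cmod (Moebius_function 0 a w))\<^sup>2 = (1 - (cmod a)\<^sup>2) * (1 - (cmod w)\<^sup>2) / (cmod (1 - cnj a * w))\<^sup>2"
    using nz by (simp add: id[symmetric] diff_divide_distrib)
qed

text \<open>Conjugating \<open>Q\<close> by the Moebius maps that send \<open>a\<close> and
  \<open>Q a\<close> to \<open>0\<close> reduces the claim to Schwarz's lemma at the origin.\<close>

lemma Schwarz_Pick:
  assumes Q: "Q holomorphic_on ball 0 1" "\<And>w. cmod w < 1 \<Longrightarrow> cmod (Q w) < 1" and ab: "cmod a < 1" "cmod w < 1"
  shows "cmod (Moebius_function 0 (Q a) (Q w)) \<le> cmod (Moebius_function 0 a w)"
proof -
  let ?F = "Moebius_function 0 (Q a) \<circ> Q \<circ> Moebius_function 0 (- a)"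
  have m1: "cmod (Moebius_function 0 (- a) u) < 1" if "cmod u < 1" for u
    using Moebius_function_norm_lt_1[of "-a" u] ab that by simp
  have h: "?F holomorphic_on ball 0 1"
  proof (rule holomorphic_on_compose_gen[of _ _ _ "ball 0 1"])
    show "Moebius_function 0 (- a) holomorphic_on ball 0 1" using ab by (intro Moebius_function_holomorphic) simp
    show "Moebius_function 0 (Q a) \<circ> Q holomorphic_on ball 0 1"
    proof (rule holomorphic_on_compose_gen[OF Q(1) Moebius_function_holomorphic])
      show "cmod (Q a) < 1" by (rule Q(2)[OF ab(1)])
      show "Q ` ball 0 1 \<subseteq> ball 0 1" using Q(2) by (simp add: image_subset_iff)
    qed
  qed (use m1 in auto)
  have z: "?F 0 = 0" by (simp add: Moebius_function_of_zero Moebius_function_eq_zero)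
  have l: "cmod (?F u) < 1" if "cmod u < 1" for u
    using m1[OF that] Q(2) ab by (auto intro!: Moebius_function_norm_lt_1)
  have "cmod (?F (Moebius_function 0 a w)) \<le> cmod (Moebius_function 0 a w)"
    using Schwarz_Lemma(1)[OF h z l] Moebius_function_norm_lt_1[OF ab] by blast
  then show ?thesis using Moebius_function_compose[of "-a" a w] ab by simp
qed

text \<open>A quantitative form of rigidity in Schwarz's lemma. Write \<open>P z = z * Q z\<close>;
  then \<open>Q w0 = \<kappa>\<close>, which is close to the boundary point \<open>1\<close> when
  \<open>\<kappa>\<close> is. By Schwarz-Pick \<open>Q w\<close> stays within pseudo-hyperbolic
  distance \<open>\<delta>\<close> of \<open>\<kappa>\<close>, and such a disk around
  \<open>\<kappa>\<close> has Euclidean size of order \<open>1 - \<kappa>\<close>.\<close>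

lemma near_identity:
  assumes P: "self_map P" and t: "\<tau> < 1" and w0: "cmod w0 \<le> \<tau>" "w0 \<noteq> 0" and k: "P w0 = of_real \<kappa> * w0" "0 < \<kappa>" "\<kappa> \<le> 1"
    and w: "cmod w \<le> \<tau>"
  defines "\<delta> \<equiv> sqrt (1 - (1 - \<tau>\<^sup>2)\<^sup>2 / 4)"
  shows "cmod (P w - w) \<le> (2 * \<delta> / (1 - \<delta>) + 1) * (1 - \<kappa>)"
proof -
  have t0: "0 \<le> \<tau>" using w by (meson norm_ge_zero order_trans)
  have t2: "\<tau>\<^sup>2 < 1" using t t0 by (simp add: abs_square_less_1)
  have d: "0 \<le> \<delta>" "\<delta> < 1"
  proof -
    have "(1 - \<tau>\<^sup>2)\<^sup>2 \<le> 1" using t2 by (intro power_le_one) auto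
    then show "0 \<le> \<delta>" by (simp add: \<delta>_def)
    show "\<delta> < 1" using t2 by (simp add: \<delta>_def)
  qed
  have K0: "(2 * \<delta> / (1 - \<delta>) + 1) * (1 - \<kappa>) \<ge> 0" using d k by simp
  note sm = self_mapD[OF P]
  have S: "cmod (P z) \<le> cmod z" if "cmod z < 1" for z using Schwarz_Lemma(1)[of P z] sm that by auto
  \<comment> \<open>If \<open>Q\<close> reaches modulus \<open>1\<close>, then \<open>P\<close> is a
    rotation and its value at \<open>w0\<close> forces \<open>\<alpha> = \<kappa> = 1\<close>;
    otherwise \<open>Q\<close> maps into the open disk.\<close>
  show ?thesis
  proof (cases "(\<exists>z. cmod z < 1 \<and> z \<noteq> 0 \<and> cmod (P z) = cmod z) \<or> cmod (deriv P 0) = 1")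
    case True
    then obtain \<alpha> where al: "\<And>z. cmod z < 1 \<Longrightarrow> P z = \<alpha> * z" "cmod \<alpha> = 1"
      using Schwarz_Lemma(3)[of P 0] sm by auto
    have "\<alpha> = of_real \<kappa>" using al(1)[of w0] k(1) w0 t by auto
    then have "\<alpha> = 1" using al(2) k by auto
    then show ?thesis using al(1)[of w] w t K0 by simp
  next
    case False
    obtain Q where Q: "Q holomorphic_on ball 0 1" "\<And>z. cmod z < 1 \<Longrightarrow> P z = z * Q z" "deriv P 0 = Q 0"
      using Schwarz3[OF sm(1,2)] by blast
    have Q1: "cmod (Q z) < 1" if "cmod z < 1" for z
    proof (cases "z = 0")
      case True
      then show ?thesis using False Q(3) Schwarz_Lemma(2)[of P 0] sm by auto
    next
      case z: False
      have "cmod (P z) < cmod z" using S[OF that] False that z by force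
      then show ?thesis using Q(2)[OF that] z by (simp add: norm_mult)
    qed
    have w1: "cmod w < 1" "cmod w0 < 1" using w w0 t by auto
    have Qk: "Q w0 = of_real \<kappa>" using Q(2)[OF w1(2)] k(1) w0 by simp
    \<comment> \<open>\<open>\<delta>\<close> bounds the pseudo-hyperbolic distance of any two
      points of the disk of radius \<open>\<tau>\<close>: in \<open>Moebius_norm_identity\<close>
      the numerator is at least \<open>(1 - \<tau>^2)^2\<close> and the denominator at most
      \<open>4\<close>.\<close>
    have "cmod (Moebius_function 0 w0 w) \<le> \<delta>"
    proof -
      have "(1 - (cmod w0)\<^sup>2) * (1 - (cmod w)\<^sup>2) \<ge> (1 - \<tau>\<^sup>2) * (1 - \<tau>\<^sup>2)"
        using w w0 t2 power_mono[of "cmod w0" \<tau> 2] power_mono[of "cmod w" \<tau> 2] by (intro mult_mono) auto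
      moreover have "cmod (1 - cnj w0 * w) \<le> 2"
      proof -
        have "cmod (1 - cnj w0 * w) \<le> 1 + cmod w0 * cmod w" using norm_triangle_ineq4[of 1 "cnj w0 * w"] by (simp add: norm_mult)
        also have "\<dots> \<le> 1 + 1 * 1" using w1 by (intro add_left_mono mult_mono) auto
        finally show ?thesis by simp
      qed
      then have "(cmod (1 - cnj w0 * w))\<^sup>2 \<le> 4" using power_mono[of "cmod (1 - cnj w0 * w)" 2 2] by simp
      ultimately have "(1 - \<tau>\<^sup>2) * (1 - \<tau>\<^sup>2) / 4 \<le> (1 - (cmod w0)\<^sup>2) * (1 - (cmod w)\<^sup>2) / (cmod (1 - cnj w0 * w))\<^sup>2"
        using Moebius_norm_identity(1)[OF w1(2,1)] t2 w1 by (intro frac_le mult_nonneg_nonneg) (auto simp: power_le_one)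
      then have "(cmod (Moebius_function 0 w0 w))\<^sup>2 \<le> 1 - (1 - \<tau>\<^sup>2)\<^sup>2 / 4"
        using Moebius_norm_identity(2)[OF w1(2,1)] unfolding power2_eq_square[of "1 - \<tau>\<^sup>2"] by linarith
      then show ?thesis unfolding \<delta>_def by (rule real_le_rsqrt)
    qed
    then have m: "cmod (Moebius_function 0 (Q w0) (Q w)) \<le> \<delta>" using Schwarz_Pick[OF Q(1) Q1 w1(2,1)] by linarith
    let ?u = "Q w"
    have "cmod (?u - of_real \<kappa>) / cmod (1 - of_real \<kappa> * ?u) \<le> \<delta>" using m by (simp add: Qk Moebius_function_simple norm_divide)
    moreover have nz: "1 - of_real \<kappa> * ?u \<noteq> 0" using Moebius_norm_identity(1)[OF Q1[OF w1(2)] Q1[OF w1(1)]] by (simp add: Qk)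
    ultimately have "cmod (?u - of_real \<kappa>) \<le> \<delta> * cmod (1 - of_real \<kappa> * ?u)" by (simp add: pos_divide_le_eq)
    \<comment> \<open>Expressing the right side through \<open>?u - of_real \<kappa>\<close> gives
      an inequality that can be solved for the modulus of this difference, as
      \<open>\<delta> < 1\<close>.\<close>
    also have "1 - of_real \<kappa> * ?u = of_real (1 - \<kappa>\<^sup>2) - of_real \<kappa> * (?u - of_real \<kappa>)" by (simp add: algebra_simps power2_eq_square)
    also have "cmod \<dots> \<le> (1 - \<kappa>\<^sup>2) + \<kappa> * cmod (?u - of_real \<kappa>)"
    proof -
      have "\<kappa>\<^sup>2 \<le> 1" using k by (intro power_le_one) auto
      then have c: "cmod (of_real (1 - \<kappa>\<^sup>2)) = 1 - \<kappa>\<^sup>2" unfolding norm_of_real by simp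
      show ?thesis
        using norm_triangle_ineq4[of "of_real (1 - \<kappa>\<^sup>2)" "of_real \<kappa> * (?u - of_real \<kappa>)"] k unfolding c norm_mult by simp
    qed
    also have "\<dots> \<le> 2 * (1 - \<kappa>) + cmod (?u - of_real \<kappa>)"
    proof -
      have "1 - \<kappa>\<^sup>2 = (1 + \<kappa>) * (1 - \<kappa>)" by (simp add: algebra_simps power2_eq_square)
      also have "\<dots> \<le> 2 * (1 - \<kappa>)" using k by (intro mult_right_mono) auto
      finally show ?thesis using k mult_right_mono[of \<kappa> 1 "cmod (?u - of_real \<kappa>)"] by simp
    qed
    finally have "cmod (?u - of_real \<kappa>) \<le> \<delta> * (2 * (1 - \<kappa>) + cmod (?u - of_real \<kappa>))" using d by (simp add: mult_left_mono)
    then have "cmod (?u - of_real \<kappa>) * (1 - \<delta>) \<le> 2 * \<delta> * (1 - \<kappa>)" by (simp add: algebra_simps)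
    then have "cmod (?u - of_real \<kappa>) \<le> 2 * \<delta> * (1 - \<kappa>) / (1 - \<delta>)" using d by (simp add: pos_le_divide_eq)
    moreover have "cmod (?u - 1) \<le> cmod (?u - of_real \<kappa>) + (1 - \<kappa>)"
    proof -
      have "cmod (of_real (\<kappa> - 1)) = 1 - \<kappa>" unfolding norm_of_real using k by simp
      then show ?thesis using norm_triangle_ineq[of "?u - of_real \<kappa>" "of_real (\<kappa> - 1)"] by simp
    qed
    ultimately have "cmod (?u - 1) \<le> (2 * \<delta> / (1 - \<delta>) + 1) * (1 - \<kappa>)" by (simp add: algebra_simps)
    moreover have "cmod (P w - w) \<le> cmod (?u - 1)"
    proof -
      have "P w - w = w * (?u - 1)" using Q(2)[OF w1(1)] by (simp add: algebra_simps)
      then have "cmod (P w - w) = cmod w * cmod (?u - 1)" by (simp add: norm_mult)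
      also have "\<dots> \<le> 1 * cmod (?u - 1)" using w1 by (intro mult_right_mono) auto
      finally show ?thesis by simp
    qed
    ultimately show ?thesis by simp
  qed
qed

section \<open>Koebe's square root and the maximal lift\<close>

lemma Moebius_deriv:
  assumes "cmod a < 1" "cmod w < 1"
  shows "(Moebius_function 0 a has_field_derivative (1 - (cmod a)\<^sup>2) / (1 - cnj a * w)\<^sup>2) (at w)"
    "of_real (1 - (cmod a)\<^sup>2) / (1 - cnj a * w)\<^sup>2 \<noteq> 0"
proof -
  note nz = Moebius_norm_identity(1)[OF assms]
  have "(cmod a)\<^sup>2 < 1" using assms(1) by (simp add: abs_square_less_1)
  then show "of_real (1 - (cmod a)\<^sup>2) / (1 - cnj a * w)\<^sup>2 \<noteq> (0::complex)" using nz unfolding divide_eq_0_iff of_real_eq_0_iff by simp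
  have "((\<lambda>z. (z - a) / (1 - cnj a * z)) has_field_derivative (1 - (cmod a)\<^sup>2) / (1 - cnj a * w)\<^sup>2) (at w)"
  proof -
    have "complex_of_real (1 - (cmod a)\<^sup>2) = 1 - a * cnj a"
      unfolding of_real_diff complex_norm_square by simp
    then show ?thesis using nz
      by (auto intro!: derivative_eq_intros simp: power2_eq_square algebra_simps)
  qed
  then show "(Moebius_function 0 a has_field_derivative (1 - (cmod a)\<^sup>2) / (1 - cnj a * w)\<^sup>2) (at w)"
    by (simp add: Moebius_function_simple[abs_def])
qed

text \<open>Koebe's trick: after a Moebius transformation the omitted value \<open>a\<close> is \<open>0\<close>, so a square root exists.\<close>

lemma factors_strictly:
  assumes g: "continuous_on (ball 0 1) g" "g ` ball 0 1 \<subseteq> ball 0 1" and x: "x \<in> ball 0 1" "g x = 0"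
    and y: "y \<in> ball 0 1" "g y \<noteq> 0" and a: "a \<in> ball 0 1" "a \<notin> g ` ball 0 1"
  obtains g' where "continuous_on (ball 0 1) g'" "g' ` ball 0 1 \<subseteq> ball 0 1" "g' x = 0" "factors g g'"
    "cmod (g y) < cmod (g' y)"
proof -
  have a1: "cmod a < 1" "cmod (-a) < 1" using a by auto
  have gl: "cmod (g z) < 1" if "z \<in> ball 0 1" for z using subsetD[OF g(2) imageI[OF that]] by simp
  let ?m = "Moebius_function 0"
  define h where "h z = ?m a (g z)" for z
  have ch: "continuous_on (ball 0 1) h"
    unfolding h_def using continuous_on_compose2[OF holomorphic_on_imp_continuous_on[OF Moebius_function_holomorphic[OF a1(1)]] g] by blast
  have h1: "cmod (h z) < 1" if "z \<in> ball 0 1" for z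
    unfolding h_def by (rule Moebius_function_norm_lt_1[OF a1(1) gl[OF that]])
  have h0: "h z \<noteq> 0" if "z \<in> ball 0 1" for z
  proof
    assume "h z = 0"
    then have "g z = a" using Moebius_norm_identity(1)[OF a1(1) gl[OF that]] by (simp add: h_def Moebius_function_simple)
    then show False using a(2) that by blast
  qed
  have "contractible (ball (0::complex) 1)" by (intro convex_imp_contractible convex_ball)
  \<comment> \<open>\<open>h\<close> is merely continuous, so the root comes from contractibility of
    the disk; only the map \<open>P\<close> back to \<open>g\<close> has to be holomorphic.\<close>
  then obtain s where s: "continuous_on (ball 0 1) s" "\<And>z. z \<in> ball 0 1 \<Longrightarrow> h z = (s z)\<^sup>2"
    using continuous_sqrt_on_contractible[OF ch] h0 by metis
  have s1: "cmod (s z) < 1" "s z \<noteq> 0" if "z \<in> ball 0 1" for z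
  proof -
    have "(cmod (s z))\<^sup>2 < 1" using h1[OF that] s(2)[OF that] by (simp add: norm_power)
    then show "cmod (s z) < 1" by (simp add: abs_square_less_1)
    show "s z \<noteq> 0" using h0[OF that] s(2)[OF that] by auto
  qed
  define b where "b = s x"
  have b1: "cmod b < 1" "cmod (-b) < 1" "b \<noteq> 0" using s1[OF x(1)] by (auto simp: b_def)
  define g' where "g' z = ?m b (s z)" for z
  define P where "P w = ?m (-a) ((?m (-b) w)\<^sup>2)" for w
  have g'1: "cmod (g' z) < 1" if "z \<in> ball 0 1" for z
    unfolding g'_def by (rule Moebius_function_norm_lt_1[OF b1(1) s1(1)[OF that]])
  have mb: "cmod (?m (-b) w) < 1" "cmod ((?m (-b) w)\<^sup>2) < 1" if "cmod w < 1" for w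
    using Moebius_function_norm_lt_1[OF b1(2) that] by (auto simp: norm_power abs_square_less_1)
  have dP: "(P has_field_derivative (of_real (1 - (cmod (-a))\<^sup>2) / (1 - cnj (-a) * (?m (-b) w)\<^sup>2)\<^sup>2) *
     (2 * ?m (-b) w * (of_real (1 - (cmod (-b))\<^sup>2) / (1 - cnj (-b) * w)\<^sup>2))) (at w)" if "cmod w < 1" for w
  proof -
    have 1: "((\<lambda>w. (?m (-b) w)\<^sup>2) has_field_derivative 2 * ?m (-b) w * (of_real (1 - (cmod (-b))\<^sup>2) / (1 - cnj (-b) * w)\<^sup>2)) (at w)"
      using DERIV_power[OF Moebius_deriv(1)[OF b1(2) that], of 2] by (simp add: mult_ac)
    show ?thesis unfolding P_def
      using DERIV_chain2[OF Moebius_deriv(1)[OF a1(2) mb(2)[OF that]] 1] .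
  qed
  have Ph: "P holomorphic_on ball 0 1" unfolding holomorphic_on_open[OF open_ball]
    by (intro ballI exI) (rule dP, simp)
  have Pg: "P (g' z) = g z" if "z \<in> ball 0 1" for z
  proof -
    have "?m (-b) (g' z) = s z" unfolding g'_def using Moebius_function_compose[of "-b" b "s z"] b1 s1[OF that] by simp
    then have "P (g' z) = ?m (-a) (h z)" using s(2)[OF that] by (simp add: P_def)
    also have "\<dots> = g z" unfolding h_def using Moebius_function_compose[of "-a" a "g z"] a1 gl[OF that] by simp
    finally show ?thesis .
  qed
  have g'x: "g' x = 0" by (simp add: g'_def b_def Moebius_function_eq_zero)
  have P0: "P 0 = 0" using Pg[OF x(1)] g'x x(2) by simp
  have sm: "self_map P" unfolding self_map_def
    using Ph P0 Moebius_function_norm_lt_1[OF a1(2)] mb(2) by (auto simp: P_def)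
  have dn: "deriv P (g' z) \<noteq> 0" if "z \<in> ball 0 1" for z
  proof -
    have "?m (-b) (g' z) = s z" unfolding g'_def using Moebius_function_compose[of "-b" b "s z"] b1 s1[OF that] by simp
    then show ?thesis
      unfolding DERIV_imp_deriv[OF dP[OF g'1[OF that]]]
      using Moebius_deriv(2)[OF a1(2) mb(2)[OF g'1[OF that]]] Moebius_deriv(2)[OF b1(2) g'1[OF that]] s1(2)[OF that] by simp
  qed
  have "factors g g'" unfolding factors_def using sm Pg dn by (intro exI[of _ P]) auto
  moreover have "continuous_on (ball 0 1) g'"
    unfolding g'_def by (rule continuous_on_compose2[OF holomorphic_on_imp_continuous_on[OF Moebius_function_holomorphic[OF b1(1)]] s(1)])
      (use s1 in auto)
  moreover have "cmod (g y) < cmod (g' y)"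
  proof (rule ccontr)
    assume "\<not> cmod (g y) < cmod (g' y)"
    moreover have "cmod (P (g' y)) \<le> cmod (g' y)" using Schwarz_Lemma(1)[of P "g' y"] self_mapD[OF sm] g'1[OF y(1)] by auto
    ultimately have "cmod (P (g' y)) = cmod (g' y)" using Pg[OF y(1)] by simp
    moreover have "g' y \<noteq> 0" using Pg[OF y(1)] P0 y(2) by auto
    ultimately obtain \<alpha> where al: "\<And>z. cmod z < 1 \<Longrightarrow> P z = \<alpha> * z" "cmod \<alpha> = 1"
      using Schwarz_Lemma(3)[of P 0] self_mapD[OF sm] g'1[OF y(1)] by auto
    \<comment> \<open>The squaring makes \<open>P\<close> critical at \<open>-b\<close>, so
      \<open>P\<close> is not a rotation and Schwarz's lemma is strict at \<open>g' y\<close>. The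
      values of \<open>g'\<close> avoid this critical point because \<open>s\<close> has no
      zero.\<close>
    have mbb: "?m (-b) (-b) = 0" by (simp add: Moebius_function_eq_zero)
    have "deriv P (-b) = 0" using DERIV_imp_deriv[OF dP[OF b1(2)]] mbb by simp
    moreover have "(P has_field_derivative \<alpha>) (at (-b))"
    proof (rule has_field_derivative_transform_within_open[of "\<lambda>z. \<alpha> * z" _ _ "ball 0 1"])
      show "((*) \<alpha> has_field_derivative \<alpha>) (at (- b))" by (auto intro!: derivative_eq_intros)
    qed (use al b1 in auto)
    ultimately show False using DERIV_imp_deriv al(2) by force
  qed
  moreover have "g' ` ball 0 1 \<subseteq> ball 0 1" using g'1 by auto
  ultimately show ?thesis using that[of g'] g'x by blast
qed

text \<open>Uniform convergence allows evaluation at points that move with the index, as in the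
  relation between \<open>G k z\<close> and the connecting map at
  \<open>G (k + j) z\<close>.\<close>

lemma limit_of_moving_values:
  fixes F :: "nat \<Rightarrow> complex \<Rightarrow> complex"
  assumes F: "uniform_limit (cball 0 t) F \<Theta> sequentially" and \<Theta>: "continuous_on (cball 0 t) \<Theta>"
    and u: "\<And>j. u j \<in> cball 0 t" "u \<longlonglongrightarrow> u0" and c: "\<forall>\<^sub>F j in sequentially. F j (u j) = c"
  shows "\<Theta> u0 = c"
proof -
  have u0: "u0 \<in> cball 0 t" by (rule closed_sequentially[OF closed_cball u])
  have "(\<lambda>j. F j (u j) - \<Theta> (u j)) \<longlonglongrightarrow> 0"
  proof (rule tendstoI)
    fix e :: real assume "e > 0"
    from uniform_limitD[OF F this] show "\<forall>\<^sub>F j in sequentially. dist (F j (u j) - \<Theta> (u j)) 0 < e"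
      by eventually_elim (use u(1) in \<open>simp add: dist_norm\<close>)
  qed
  moreover have "(\<lambda>j. \<Theta> (u j)) \<longlonglongrightarrow> \<Theta> u0"
    using continuous_on_tendsto_compose[OF \<Theta> u(2) u0] u(1) by simp
  ultimately have "(\<lambda>j. F j (u j)) \<longlonglongrightarrow> \<Theta> u0" using tendsto_add by fastforce
  moreover have "(\<lambda>j. F j (u j)) \<longlonglongrightarrow> c" using c by (rule tendsto_eventually)
  ultimately show ?thesis by (rule LIMSEQ_unique)
qed

text \<open>Schwarz's bound \<open>cmod (F j w) \<le> cmod w\<close> survives the limit and keeps
  \<open>\<Theta>\<close> inside the open disk; Montel's theorem alone would allow values on the
  circle.\<close>

lemma Montel_self_maps:
  assumes F: "\<And>j. self_map (F j)"
  obtains \<Theta> and r :: "nat \<Rightarrow> nat" where "self_map \<Theta>" "strict_mono r" "\<And>w. w \<in> ball 0 1 \<Longrightarrow> (\<lambda>j. F (r j) w) \<longlonglongrightarrow> \<Theta> w"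
    "\<And>t. t < 1 \<Longrightarrow> uniform_limit (cball 0 t) (\<lambda>j. F (r j)) \<Theta> sequentially"
proof -
  obtain \<Theta> and r :: "nat \<Rightarrow> nat" where T: "\<Theta> holomorphic_on ball 0 1" "strict_mono r"
    "\<And>w. w \<in> ball 0 1 \<Longrightarrow> (\<lambda>j. F (r j) w) \<longlonglongrightarrow> \<Theta> w"
    "\<And>K. compact K \<Longrightarrow> K \<subseteq> ball 0 1 \<Longrightarrow> uniform_limit K (F \<circ> r) \<Theta> sequentially"
  proof (rule Montel[OF open_ball, of "Collect self_map" 0 1 F])
    show "\<exists>B. \<forall>h\<in>Collect self_map. \<forall>z\<in>K. cmod (h z) \<le> B" if "compact K" "K \<subseteq> ball 0 1" for K
      by (rule exI[of _ 1]) (use that(2) self_mapD(3) in \<open>force intro: less_imp_le\<close>)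
  qed (use F self_mapD(1) in auto)
  have le: "cmod (\<Theta> w) \<le> cmod w" if w: "cmod w < 1" for w
  proof (rule Lim_norm_ubound[OF _ T(3)])
    show "\<forall>\<^sub>F j in sequentially. cmod (F (r j) w) \<le> cmod w"
      using Schwarz_Lemma(1)[of "F (r _)" w] self_mapD[OF F] w by (auto intro!: always_eventually)
  qed (use w in auto)
  then have "self_map \<Theta>" unfolding self_map_def using T(1) le[of 0] by (force intro: le_less_trans)
  moreover have "uniform_limit (cball 0 t) (\<lambda>j. F (r j)) \<Theta> sequentially" if "t < 1" for t
  proof -
    have "cball (0::complex) t \<subseteq> ball 0 1" using that by auto
    from T(4)[OF compact_cball this] show ?thesis by (simp add: o_def)
  qed
  ultimately show ?thesis using that T by blast
qed

text \<open>A maximising chain of factorisations converges because, by \<open>near_identity\<close>, its connecting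
  maps tend to the identity; the limit is maximal, hence onto by \<open>factors_strictly\<close>.\<close>

lemma factors_onto:
  fixes x y :: complex
  assumes x: "x \<in> ball 0 1" and y: "y \<in> ball 0 1"
    and g0: "continuous_on (ball 0 1) g0" "g0 ` ball 0 1 \<subseteq> ball 0 1" "g0 x = 0" "g0 y \<noteq> 0"
    and bd: "\<And>\<rho>. \<rho> < 1 \<Longrightarrow> \<exists>\<tau><1. \<forall>g. continuous_on (ball 0 1) g \<longrightarrow> g ` ball 0 1 \<subseteq> ball 0 1 \<longrightarrow> g x = 0 \<longrightarrow>
      factors g0 g \<longrightarrow> (\<forall>z\<in>cball 0 \<rho>. cmod (g z) \<le> \<tau>)"
  obtains g where "continuous_on (ball 0 1) g" "g ` ball 0 1 = ball 0 1" "factors g0 g"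
proof -
  define adm where "adm g \<longleftrightarrow> continuous_on (ball 0 1) g \<and> g ` ball 0 1 \<subseteq> ball 0 1 \<and> g x = 0 \<and> factors g0 g" for g
  have refl: "factors g g" for g using factors_rotate[of 1 g] by simp
  have adm0: "adm g0" using g0 refl by (simp add: adm_def)
  have admf: "adm g'" if "adm g" "factors g g'" "continuous_on (ball 0 1) g'" "g' ` ball 0 1 \<subseteq> ball 0 1" "g' x = 0" for g g'
    using that factors_trans[of g0 g g'] by (auto simp: adm_def)
  have ny: "0 < cmod (g y)" if "adm g" for g
  proof -
    have "cmod (g0 y) \<le> cmod (g y)" using factors_norm_le[of g0 g y] that y by (auto simp: adm_def)
    then show ?thesis using g0(4) by auto
  qed
  have n1: "cmod (g z) < 1" if "adm g" "z \<in> ball 0 1" for g z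
    using subsetD[OF _ imageI[OF that(2)], of g "ball 0 1"] that(1) by (auto simp: adm_def)
  \<comment> \<open>Since \<open>factors\<close> is transitive, \<open>S\<close> shrinks along a
    chain; choosing each member within \<open>(1/2) ^ n\<close> of the current supremum therefore
    makes the limit maximal.\<close>
  define S where "S h = {cmod (g y) | g. adm g \<and> factors h g}" for h
  have Sb: "bdd_above (S h)" for h unfolding S_def bdd_above_def using n1[OF _ y] by (intro exI[of _ 1]) (auto intro: less_imp_le)
  have norm: "\<exists>g'. adm g' \<and> factors g g' \<and> cmod (g' y) = cmod (g y) \<and> g' y = of_real (cmod (g' y))" if a: "adm g" for g
  proof -
    define c where "c = cnj (g y) / of_real (cmod (g y))"
    have c: "cmod c = 1" using ny[OF a] by (simp add: c_def norm_divide)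
    let ?g = "\<lambda>z. c * g z"
    have "adm ?g"
      by (rule admf[OF a factors_rotate[OF c]]) (use a c in \<open>auto simp: adm_def norm_mult intro!: continuous_intros\<close>)
    moreover have "?g y = of_real (cmod (g y))"
      using ny[OF a] by (simp add: c_def field_simps complex_norm_square[symmetric] power2_eq_square)
    ultimately show ?thesis using factors_rotate[OF c, of g] c by (intro exI[of _ ?g]) (auto simp: norm_mult)
  qed
  have step: "\<exists>g. (adm g \<and> g y = of_real (cmod (g y))) \<and> factors h g \<and> Sup (S h) - (1/2) ^ n \<le> cmod (g y)" if a: "adm h" for h and n :: nat
  proof -
    have "cmod (h y) \<in> S h" using a refl by (auto simp: S_def)
    then have "S h \<noteq> {}" by auto
    moreover have "Sup (S h) - (1/2) ^ n < Sup (S h)" by simp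
    ultimately obtain s where "s \<in> S h" "Sup (S h) - (1/2) ^ n < s" using less_cSupD by blast
    then obtain g where g: "adm g" "factors h g" "Sup (S h) - (1/2) ^ n < cmod (g y)" by (auto simp: S_def)
    obtain g' where g': "adm g'" "factors g g'" "cmod (g' y) = cmod (g y)" "g' y = of_real (cmod (g' y))" using norm[OF g(1)] by blast
    then show ?thesis using g factors_trans[OF g(2) g'(2)] by (intro exI[of _ g']) (auto simp: adm_def)
  qed
  obtain G where G: "\<And>n. adm (G n)" "\<And>n. G n y = of_real (cmod (G n y))"
    and Gs: "\<And>n. factors (G n) (G (Suc n))" "\<And>n. Sup (S (G n)) - (1/2) ^ n \<le> cmod (G (Suc n) y)"
    and G0: "factors g0 (G 0)"
  proof -
    have 0: "\<exists>g. adm g \<and> g y = of_real (cmod (g y))" using norm[OF adm0] by blast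
    have "\<exists>G. \<forall>n. (adm (G n) \<and> G n y = of_real (cmod (G n y))) \<and> (factors (G n) (G (Suc n)) \<and> Sup (S (G n)) - (1/2) ^ n \<le> cmod (G (Suc n) y))"
      by (rule dependent_nat_choice[of "\<lambda>n g. adm g \<and> g y = of_real (cmod (g y))" "\<lambda>n g g'. factors g g' \<and> Sup (S g) - (1/2) ^ n \<le> cmod (g' y)"])
         (use 0 step in auto)
    then obtain G where "\<forall>n. (adm (G n) \<and> G n y = of_real (cmod (G n y))) \<and> (factors (G n) (G (Suc n)) \<and> Sup (S (G n)) - (1/2) ^ n \<le> cmod (G (Suc n) y))" ..
    then show ?thesis using that[of G] by (auto simp: adm_def)
  qed
  define b where "b n = cmod (G n y)" for n
  have b0: "b n > 0" for n using ny[OF G(1)] by (simp add: b_def)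
  have Gim: "G n ` ball 0 1 \<subseteq> ball 0 1" for n using G(1)[of n] by (simp add: adm_def)
  have "incseq b" unfolding b_def by (rule incseq_SucI) (rule factors_norm_le[OF Gs(1) Gim y])
  have "b n \<le> 1" for n using n1[OF G(1) y, of n] by (simp add: b_def)
  then obtain bl where bl: "b \<longlonglongrightarrow> bl" "\<And>n. b n \<le> bl" using incseq_convergent[OF \<open>incseq b\<close>, of 1] by blast
  have bl0: "bl > 0" using b0[of 0] bl(2)[of 0] by linarith
  define \<eta> where "\<eta> k = 1 - b k / bl" for k
  have eta: "\<eta> \<longlonglongrightarrow> 0"
  proof -
    have "\<eta> \<longlonglongrightarrow> 1 - bl / bl" unfolding \<eta>_def by (intro tendsto_intros bl(1)) (use bl0 in simp)
    then show ?thesis using bl0 by simp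
  qed
  obtain p where p: "\<And>n. self_map (p n)" "\<And>n z. z \<in> ball 0 1 \<Longrightarrow> G n z = p n (G (Suc n) z)"
    "\<And>n z. z \<in> ball 0 1 \<Longrightarrow> deriv (p n) (G (Suc n) z) \<noteq> 0"
    using Gs(1) unfolding factors_def by metis
  \<comment> \<open>\<open>PP k j\<close> composes \<open>p k\<close> up to
    \<open>p (k + j - 1)\<close>, so that it carries \<open>G (k + j)\<close> to
    \<open>G k\<close>.\<close>
  define PP where "PP k j = rec_nat id (\<lambda>i F. F \<circ> p (k + i)) j" for k j
  have PP0: "PP k 0 = id" and PPS: "PP k (Suc j) = PP k j \<circ> p (k + j)" for k j by (auto simp: PP_def)
  have idm: "self_map id" by (auto simp: self_map_def id_def)
  have PPm: "self_map (PP k j)" for k j by (induction j) (simp_all only: PP0 PPS idm p self_map_comp)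
  have PPG: "G k z = PP k j (G (k + j) z) \<and> deriv (PP k j) (G (k + j) z) \<noteq> 0" if z: "z \<in> ball 0 1" for k j z
  proof (induction j)
    case 0 then show ?case by (simp add: PP0 id_def)
  next
    case (Suc j)
    have "deriv (PP k (Suc j)) (G (Suc (k + j)) z) = deriv (PP k j) (G (k + j) z) * deriv (p (k + j)) (G (Suc (k + j)) z)"
      unfolding PPS self_map_deriv_comp[OF PPm p(1) n1[OF G(1) z]] p(2)[OF z, of "k + j", symmetric] ..
    moreover have "PP k (Suc j) (G (Suc (k + j)) z) = PP k j (G (k + j) z)"
      unfolding PPS o_apply p(2)[OF z, of "k + j", symmetric] ..
    ultimately show ?case using Suc p(3)[OF z, of "k + j"] by simp
  qed
  have PPadd: "PP k (i + j) = PP k i \<circ> PP (k + i) j" for k i j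
    by (induction j) (auto simp: PP0 PPS add.assoc comp_assoc)
  define cc where "cc t = 2 * sqrt (1 - (1 - t\<^sup>2)\<^sup>2 / 4) / (1 - sqrt (1 - (1 - t\<^sup>2)\<^sup>2 / 4)) + 1" for t :: real
  \<comment> \<open>At \<open>G (k + j) y\<close> the connecting map multiplies by
    \<open>b k / b (k + j)\<close>; since \<open>b\<close> increases to \<open>bl\<close>, the
    defect of this factor from \<open>1\<close> is at most \<open>\<eta> k\<close>, uniformly in
    \<open>j\<close>.\<close>
  have near: "cmod (PP k j w - w) \<le> cc t * \<eta> k" if t: "t < 1" "\<And>n. cmod (G n y) \<le> t" and w: "cmod w \<le> t" for k j w t
  proof -
    let ?w0 = "G (k + j) y" and ?\<kappa> = "b k / b (k + j)"
    have bb: "b k \<le> b (k + j)" using \<open>incseq b\<close> by (auto simp: incseq_def)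
    have "PP k j ?w0 = G k y" using PPG[OF y] by simp
    also have "\<dots> = of_real ?\<kappa> * ?w0" using G(2)[of k] G(2)[of "k + j"] b0[of "k + j"] by (simp add: b_def)
    finally have 1: "PP k j ?w0 = of_real ?\<kappa> * ?w0" .
    have "0 \<le> t" using w norm_ge_zero order_trans by blast
    have t2: "t\<^sup>2 < 1" using t(1) \<open>0 \<le> t\<close> by (simp add: abs_square_less_1)
    have "(1 - t\<^sup>2)\<^sup>2 \<le> 1" using t2 by (intro power_le_one) auto
    then have c0: "cc t \<ge> 0" unfolding cc_def using t2 by (intro add_nonneg_nonneg divide_nonneg_nonneg mult_nonneg_nonneg) auto
    have "cmod (PP k j w - w) \<le> cc t * (1 - ?\<kappa>)"
      unfolding cc_def by (rule near_identity[OF PPm t(1) t(2) _ 1 _ _ w]) (use b0[of k] b0[of "k + j"] bb in \<open>auto simp: b_def\<close>)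
    also have "\<dots> \<le> cc t * \<eta> k"
    proof (rule mult_left_mono[OF _ c0])
      have "b k / bl \<le> b k / b (k + j)" using bl(2)[of "k + j"] b0[of "k+j"] b0[of k] bl0 by (intro divide_left_mono) auto
      then show "1 - ?\<kappa> \<le> \<eta> k" by (simp add: \<eta>_def)
    qed
    finally show ?thesis .
  qed
  \<comment> \<open>Here the uniform bound \<open>bd\<close> enters. Including \<open>cmod y\<close>
    in the radius yields one \<open>t\<close> both for the smaller disk and for the point
    \<open>y\<close>.\<close>
  have tau: "\<exists>t<1. (\<forall>n. cmod (G n y) \<le> t) \<and> (\<forall>n. \<forall>z\<in>cball 0 \<rho>. cmod (G n z) \<le> t)" if "\<rho> < 1" for \<rho>
  proof -
    have "max \<rho> (cmod y) < 1" using that y by simp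
    from bd[OF this] obtain t where "t < 1" "\<And>g z. adm g \<Longrightarrow> z \<in> cball 0 (max \<rho> (cmod y)) \<Longrightarrow> cmod (g z) \<le> t"
      unfolding adm_def by blast
    then show ?thesis using G(1) by (intro exI[of _ t]) auto
  qed
  have dif: "cmod (G k z - G (k + j) z) \<le> cc t * \<eta> k" if "t < 1" "\<And>n. cmod (G n y) \<le> t" "\<And>n. cmod (G n z) \<le> t" "z \<in> ball 0 1" for k j z t
    using near[OF that(1,2,3), of k j] PPG[OF that(4), of k j] by simp
  have etac: "(\<lambda>k. c * \<eta> k) \<longlonglongrightarrow> 0" for c using tendsto_mult_left[OF eta, of c] by simp
  have conv: "convergent (\<lambda>n. G n z)" if z: "z \<in> ball 0 1" for z
  proof -
    obtain t where t: "t < 1" "\<And>n. cmod (G n y) \<le> t" "\<And>n. cmod (G n z) \<le> t" using tau[of "cmod z"] z by auto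
    have "Cauchy (\<lambda>n. G n z)"
    proof (rule CauchyI')
      fix e :: real assume "e > 0"
      from order_tendstoD(2)[OF etac[of "cc t"] this] obtain M where M: "\<And>k. k \<ge> M \<Longrightarrow> cc t * \<eta> k < e"
        unfolding eventually_sequentially by blast
      show "\<exists>M. \<forall>m\<ge>M. \<forall>n>m. dist (G m z) (G n z) < e"
      proof (intro exI[of _ M] allI impI)
        fix m n assume "M \<le> m" "m < n"
        then show "dist (G m z) (G n z) < e" using dif[OF t z, of m "n - m"] M[of m] by (simp add: dist_norm)
      qed
    qed
    then show ?thesis by (simp add: Cauchy_convergent_iff)
  qed
  define gl where "gl z = lim (\<lambda>n. G n z)" for z
  have gl: "(\<lambda>n. G n z) \<longlonglongrightarrow> gl z" if "z \<in> ball 0 1" for z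
    unfolding gl_def using conv[OF that] by (simp add: convergent_LIMSEQ_iff)
  have glb: "cmod (gl z) \<le> t" if "z \<in> ball 0 1" "\<And>n. cmod (G n z) \<le> t" for z t
    by (rule Lim_norm_ubound[OF _ gl[OF that(1)]]) (use that in auto)
  have glim: "gl ` ball 0 1 \<subseteq> ball 0 1"
  proof (intro image_subsetI)
    fix z :: complex assume z: "z \<in> ball 0 1"
    obtain t where "t < 1" "\<And>n. cmod (G n z) \<le> t" using tau[of "cmod z"] z by auto
    then show "gl z \<in> ball 0 1" using glb[OF z] by (metis le_less_trans mem_ball_0)
  qed
  have glx: "gl x = 0"
    using LIMSEQ_unique[OF gl[OF x], of 0] G(1) by (simp add: adm_def)
  have gly: "gl y = of_real bl"
  proof (rule LIMSEQ_unique[OF gl[OF y]])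
    have "(\<lambda>n. of_real (b n)) \<longlonglongrightarrow> complex_of_real bl" by (intro tendsto_intros bl(1))
    then show "(\<lambda>n. G n y) \<longlonglongrightarrow> of_real bl" unfolding b_def G(2)[symmetric] .
  qed
  have ulG: "uniform_limit (cball 0 \<rho>) G gl sequentially" if r: "\<rho> < 1" for \<rho>
  proof (rule uniform_limitI)
    fix e :: real assume "e > 0"
    obtain t where t: "t < 1" "\<And>n. cmod (G n y) \<le> t" "\<And>n z. z \<in> cball 0 \<rho> \<Longrightarrow> cmod (G n z) \<le> t" using tau[OF r] by blast
    from order_tendstoD(2)[OF etac[of "cc t"] \<open>e > 0\<close>]
    show "\<forall>\<^sub>F k in sequentially. \<forall>z\<in>cball 0 \<rho>. dist (G k z) (gl z) < e"
    proof eventually_elim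
      case (elim k)
      show ?case
      proof
        fix z :: complex assume z: "z \<in> cball 0 \<rho>"
        then have zb: "z \<in> ball 0 1" using r by auto
        have "(\<lambda>j. G k z - G (j + k) z) \<longlonglongrightarrow> G k z - gl z"
          by (intro tendsto_intros LIMSEQ_ignore_initial_segment gl zb)
        moreover have "\<forall>\<^sub>F j in sequentially. cmod (G k z - G (j + k) z) \<le> cc t * \<eta> k"
          using dif[OF t(1,2) t(3)[OF z] zb, of k] by (auto simp: add.commute)
        ultimately have "cmod (G k z - gl z) \<le> cc t * \<eta> k" by (intro Lim_norm_ubound[of sequentially]) auto
        then show "dist (G k z) (gl z) < e" using elim by (simp add: dist_norm)
      qed
    qed
  qed
  have "continuous_on (cball 0 \<rho>) gl" if "\<rho> < 1" for \<rho>
    by (rule uniform_limit_theorem[OF _ ulG[OF that]])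
       (use that G(1) in \<open>auto simp: adm_def intro!: always_eventually intro: continuous_on_subset[of "ball 0 1"]\<close>)
  then have "isCont gl z" if "z \<in> ball 0 1" for z
    using that by (intro continuous_on_interior[of "cball 0 ((1 + cmod z) / 2)"]) auto
  then have glc: "continuous_on (ball 0 1) gl" by (intro continuous_at_imp_continuous_on) auto
  \<comment> \<open>\<open>\<Psi>\<close> is a limit of connecting maps, and its derivative might
    vanish although theirs do not. To exclude this a fixed number \<open>i\<close> of steps is split
    off: \<open>\<Psi> = PP k i \<circ> \<Theta>\<close> on the disk, with \<open>\<Theta>\<close>
    so close to the identity that Cauchy's estimate keeps its derivative away from
    \<open>0\<close>.\<close>
  have glf: "factors (G k) gl" for k
  proof -
    obtain \<Psi> r where \<Psi>: "self_map \<Psi>" "strict_mono r" "\<And>w. w \<in> ball 0 1 \<Longrightarrow> (\<lambda>j. PP k (r j) w) \<longlonglongrightarrow> \<Psi> w"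
      "\<And>t. t < 1 \<Longrightarrow> uniform_limit (cball 0 t) (\<lambda>j. PP k (r j)) \<Psi> sequentially"
      using Montel_self_maps[of "PP k"] PPm by blast
    have rj: "r j \<ge> j" for j using seq_suble[OF \<Psi>(2)] .
    have sub: "(\<lambda>j. G (k + s j) z) \<longlonglongrightarrow> gl z" if "strict_mono s" "z \<in> ball 0 1" for z and s :: "nat \<Rightarrow> nat"
    proof -
      have "strict_mono (\<lambda>j. k + s j)" using that(1) by (auto simp: strict_mono_def)
      from LIMSEQ_subseq_LIMSEQ[OF gl[OF that(2)] this] show ?thesis by (simp add: o_def)
    qed
    have smc: "continuous_on (cball 0 t) \<Theta>" if "self_map \<Theta>" "t < 1" for \<Theta> t
      using holomorphic_on_imp_continuous_on[OF self_mapD(1)[OF that(1)]] that(2) by (auto intro: continuous_on_subset)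
    have "G k z = \<Psi> (gl z) \<and> deriv \<Psi> (gl z) \<noteq> 0" if z: "z \<in> ball 0 1" for z
    proof
      obtain t where t: "t < 1" "\<And>n. cmod (G n y) \<le> t" "\<And>n. cmod (G n z) \<le> t" using tau[of "cmod z"] z by auto
      have "\<Psi> (gl z) = G k z"
        by (rule limit_of_moving_values[OF \<Psi>(4)[OF t(1)] smc[OF \<Psi>(1) t(1)] _ sub[OF \<Psi>(2) z]])
           (use t PPG[OF z, of k] in auto)
      then show "G k z = \<Psi> (gl z)" ..
      \<comment> \<open>The values at \<open>z\<close> stay in the disk of radius \<open>t\<close>;
        the margin \<open>s\<close> up to \<open>t2\<close> is the radius used in Cauchy's
        estimate.\<close>
      define t2 where "t2 = (1 + t) / 2"
      define s where "s = t2 - t"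
      have t2: "t2 < 1" "t < t2" "s > 0" using t(1) by (auto simp: t2_def s_def field_simps)
      have ty: "cmod (G n y) \<le> t2" for n using t(2)[of n] t2 by linarith
      obtain N where N: "\<And>i. i \<ge> N \<Longrightarrow> cc t2 * \<eta> i < s"
        using order_tendstoD(2)[OF etac[of "cc t2"] t2(3)] unfolding eventually_sequentially by blast
      obtain i where i: "cc t2 * \<eta> (k + i) < s" using N[of "k + N"] by auto
      \<comment> \<open>The maps are indexed by the subsequence \<open>r\<close>, so after passing
        to \<open>r'\<close> both \<open>\<Psi>\<close> and \<open>\<Theta>\<close> are limits along
        the same indices. The natural subtraction is genuine only once
        \<open>r (r' j) \<ge> i\<close>, hence the eventual statement \<open>big\<close>.\<close>
      obtain \<Theta> r' where \<Theta>: "self_map \<Theta>" "strict_mono r'" "\<And>w. w \<in> ball 0 1 \<Longrightarrow> (\<lambda>j. PP (k + i) (r (r' j) - i) w) \<longlonglongrightarrow> \<Theta> w"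
        "\<And>t. t < 1 \<Longrightarrow> uniform_limit (cball 0 t) (\<lambda>j. PP (k + i) (r (r' j) - i)) \<Theta> sequentially"
        using Montel_self_maps[of "\<lambda>j. PP (k + i) (r j - i)"] PPm by blast
      have rr: "strict_mono (\<lambda>j. r (r' j))" using \<Psi>(2) \<Theta>(2) by (auto simp: strict_mono_def)
      have big: "\<forall>\<^sub>F j in sequentially. r (r' j) \<ge> i"
        using eventually_ge_at_top[of i] by eventually_elim (meson order_trans seq_suble[OF rr])
      have eq: "\<Psi> w = PP k i (\<Theta> w)" if w: "w \<in> ball 0 1" for w
      proof (rule LIMSEQ_unique)
        show "(\<lambda>j. PP k (r (r' j)) w) \<longlonglongrightarrow> \<Psi> w"
          using LIMSEQ_subseq_LIMSEQ[OF \<Psi>(3)[OF w] \<Theta>(2)] by (simp add: o_def)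
        have "isCont (PP k i) (\<Theta> w)"
          using holomorphic_on_imp_continuous_on[OF self_mapD(1)[OF PPm[of k i]]] self_mapD(3)[OF \<Theta>(1), of w] w
          by (auto simp: continuous_on_eq_continuous_at)
        from isCont_tendsto_compose[OF this \<Theta>(3)[OF w]]
        have "(\<lambda>j. PP k i (PP (k + i) (r (r' j) - i) w)) \<longlonglongrightarrow> PP k i (\<Theta> w)" .
        moreover have "\<forall>\<^sub>F j in sequentially. PP k i (PP (k + i) (r (r' j) - i) w) = PP k (r (r' j)) w"
          using big
        proof eventually_elim
          case (elim j)
          then show ?case using PPadd[of k i "r (r' j) - i"] by simp
        qed
        ultimately show "(\<lambda>j. PP k (r (r' j)) w) \<longlonglongrightarrow> PP k i (\<Theta> w)" by (rule Lim_transform_eventually)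
      qed
      have Tg: "\<Theta> (gl z) = G (k + i) z"
      proof (rule limit_of_moving_values[OF \<Theta>(4)[OF t(1)] smc[OF \<Theta>(1) t(1)] _ sub[OF rr z]])
        show "\<forall>\<^sub>F j in sequentially. PP (k + i) (r (r' j) - i) (G (k + r (r' j)) z) = G (k + i) z"
          using big
        proof eventually_elim
          case (elim j)
          then have "k + i + (r (r' j) - i) = k + r (r' j)" by simp
          then show ?case using PPG[OF z, of "k + i" "r (r' j) - i"] by simp
        qed
      qed (use t in auto)
      have Tn: "cmod (\<Theta> w - w) \<le> cc t2 * \<eta> (k + i)" if w: "cmod w \<le> t2" for w
      proof (rule Lim_norm_ubound[of sequentially "\<lambda>j. PP (k + i) (r (r' j) - i) w - w"])
        show "(\<lambda>j. PP (k + i) (r (r' j) - i) w - w) \<longlonglongrightarrow> \<Theta> w - w"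
          using w t2 by (intro tendsto_intros \<Theta>(3)) auto
      qed (use near[OF t2(1) ty w] in auto)
      have glt: "cmod (gl z) \<le> t" by (rule glb[OF z t(3)])
      have sb: "cball (gl z) s \<subseteq> ball 0 1"
      proof
        fix w assume "w \<in> cball (gl z) s"
        then have "cmod (w - gl z) \<le> s" by (simp add: dist_norm norm_minus_commute)
        then show "w \<in> ball 0 1" using glt t2 norm_triangle_ineq2[of w "gl z"] by (simp add: s_def)
      qed
      have hol: "(\<lambda>w. \<Theta> w - w) holomorphic_on ball 0 1" by (intro holomorphic_intros self_mapD(1)[OF \<Theta>(1)])
      have "cmod ((deriv ^^ 1) (\<lambda>w. \<Theta> w - w) (gl z)) \<le> fact 1 * (cc t2 * \<eta> (k + i)) / s ^ 1"
      proof (rule Cauchy_inequality[OF _ _ t2(3)])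
        show "(\<lambda>w. \<Theta> w - w) holomorphic_on ball (gl z) s" using hol sb ball_subset_cball holomorphic_on_subset by blast
        show "continuous_on (cball (gl z) s) (\<lambda>w. \<Theta> w - w)" using holomorphic_on_imp_continuous_on[OF hol] sb continuous_on_subset by blast
        show "cmod (\<Theta> w - w) \<le> cc t2 * \<eta> (k + i)" if "cmod (gl z - w) = s" for w
          using that glt norm_triangle_ineq2[of w "gl z"] by (intro Tn) (auto simp: s_def norm_minus_commute)
      qed
      also have "\<dots> < 1" using i t2(3) by simp
      finally have d1: "cmod (deriv (\<lambda>w. \<Theta> w - w) (gl z)) < 1" by simp
      have gz: "gl z \<in> ball 0 1" by (rule subsetD[OF glim imageI[OF z]])
      have "\<Theta> field_differentiable at (gl z)"
        using self_mapD(1)[OF \<Theta>(1)] gz by (intro holomorphic_on_imp_differentiable_at[of _ "ball 0 1"]) auto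
      then have "deriv (\<lambda>w. \<Theta> w - w) (gl z) = deriv \<Theta> (gl z) - 1" by (subst deriv_diff) auto
      then have dT: "deriv \<Theta> (gl z) \<noteq> 0" using d1 by auto
      have "deriv \<Psi> (gl z) = deriv (PP k i \<circ> \<Theta>) (gl z)"
        by (rule complex_derivative_transform_within_open[of _ "ball 0 1"])
           (use eq gz self_mapD(1)[OF \<Psi>(1)] self_mapD(1)[OF self_map_comp[OF PPm \<Theta>(1)]] in auto)
      also have "\<dots> = deriv (PP k i) (\<Theta> (gl z)) * deriv \<Theta> (gl z)" using gz by (intro self_map_deriv_comp[OF PPm \<Theta>(1)]) auto
      finally show "deriv \<Psi> (gl z) \<noteq> 0" using PPG[OF z, of k i] dT unfolding Tg by simp
    qed
    then show ?thesis unfolding factors_def using \<Psi>(1) by blast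
  qed
  have f0: "factors g0 gl" by (rule factors_trans[OF G0 glf glim])
  have adml: "adm gl" using glc glim glx f0 by (simp add: adm_def)
  have "ball 0 1 \<subseteq> gl ` ball 0 1"
  proof (rule ccontr)
    assume "\<not> ball 0 1 \<subseteq> gl ` ball 0 1"
    then obtain a where a: "a \<in> ball 0 1" "a \<notin> gl ` ball 0 1" by blast
    have "gl y \<noteq> 0" using gly bl0 by simp
    then obtain g' where g': "continuous_on (ball 0 1) g'" "g' ` ball 0 1 \<subseteq> ball 0 1" "g' x = 0" "factors gl g'"
      "cmod (gl y) < cmod (g' y)"
      using factors_strictly[OF glc glim x glx y _ a] by blast
    have "adm g'" by (rule admf[OF adml g'(4,1,2,3)])
    \<comment> \<open>Whatever lies beyond \<open>gl\<close> lies beyond every \<open>G n\<close>,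
      so its value at \<open>y\<close> obeys every supremum in the chain; these bounds tend to
      \<open>bl\<close>, the value of \<open>gl\<close> itself.\<close>
    have le: "cmod (g' y) \<le> b (Suc n) + (1/2) ^ n" for n
    proof -
      have "factors (G n) g'" by (rule factors_trans[OF glf g'(4,2)])
      then have "cmod (g' y) \<in> S (G n)" using \<open>adm g'\<close> by (auto simp: S_def)
      then have "cmod (g' y) \<le> Sup (S (G n))" using Sb by (intro cSup_upper)
      then show ?thesis using Gs(2)[of n] by (simp add: b_def)
    qed
    have "(\<lambda>n. b (Suc n) + (1/2) ^ n) \<longlonglongrightarrow> bl + 0"
      by (intro tendsto_add LIMSEQ_Suc bl(1) LIMSEQ_power_zero) auto
    from LIMSEQ_le_const[OF this] le have "cmod (g' y) \<le> bl" by auto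
    then show False using g'(5) gly bl0 by simp
  qed
  then show ?thesis using that[OF glc _ f0] glim by blast
qed

section \<open>The hyperbolic metric\<close>

text \<open>The square root in \<open>rho_disk\<close> is \<open>cmod (1 - cnj a * w)\<close>, so
  the quotient is the modulus of a Moebius transformation and Schwarz-Pick becomes
  applicable.\<close>

lemma rho_disk_Moebius:
  assumes "cmod a < 1" "cmod w < 1"
  shows "rho_disk a w = 2 * artanh (cmod (Moebius_function 0 a w))"
proof -
  have "(cmod (1 - cnj a * w))\<^sup>2 = (cmod (a - w))\<^sup>2 + (1 - (cmod a)\<^sup>2) * (1 - (cmod w)\<^sup>2)"
    unfolding cmod_power2 by (simp add: power2_eq_square algebra_simps)
  then have "sqrt ((cmod (a - w))\<^sup>2 + (1 - (cmod a)\<^sup>2) * (1 - (cmod w)\<^sup>2)) = cmod (1 - cnj a * w)"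
    by (metis norm_ge_zero real_sqrt_abs abs_of_nonneg)
  then show ?thesis unfolding rho_disk_def by (simp add: Moebius_function_simple norm_divide norm_minus_commute)
qed

lemma artanh_mono_real:
  fixes a b :: real
  assumes "0 \<le> a" "a \<le> b" "b < 1"
  shows "artanh a \<le> artanh b"
  unfolding artanh_def using assms by (auto intro!: ln_mono frac_le divide_pos_pos)

lemma rho_disk_nonneg:
  assumes "cmod a < 1" "cmod w < 1" shows "rho_disk a w \<ge> 0"
  using artanh_mono_real[of 0 "cmod (Moebius_function 0 a w)"] Moebius_function_norm_lt_1[OF assms]
  by (simp add: rho_disk_Moebius[OF assms])

lemma rho_disk_contract:
  assumes "Q holomorphic_on ball 0 1" "\<And>w. cmod w < 1 \<Longrightarrow> cmod (Q w) < 1" "cmod a < 1" "cmod w < 1"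
  shows "rho_disk (Q a) (Q w) \<le> rho_disk a w"
  unfolding rho_disk_Moebius[OF assms(3,4)] rho_disk_Moebius[OF assms(2)[OF assms(3)] assms(2)[OF assms(4)]]
  using Schwarz_Pick[OF assms] Moebius_function_norm_lt_1[OF assms(3,4)] by (simp add: artanh_mono_real)

text \<open>The Riemann map picked by \<open>SOME\<close> is an unknown automorphism of the disk. It
  and its inverse both contract \<open>rho_disk\<close>, so it is an isometry whichever it
  is.\<close>

lemma rho_dom_ball:
  assumes xy: "cmod x < 1" "cmod y < 1"
  shows "rho_dom (ball 0 1) x y = rho_disk x y"
proof -
  let ?P = "\<lambda>h. h holomorphic_on ball 0 1 \<and> inj_on h (ball 0 1) \<and> h ` ball 0 1 = ball (0::complex) 1"
  define h where "h = (SOME h. ?P h)"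
  have "?P id" by (auto simp: id_def)
  then have h: "?P h" unfolding h_def by (rule someI[of ?P])
  have hh: "h holomorphic_on ball 0 1" "inj_on h (ball 0 1)" "h ` ball 0 1 = ball 0 1" using h by (blast+)
  obtain k where k: "k holomorphic_on h ` ball 0 1" "\<And>z. z \<in> ball 0 1 \<Longrightarrow> deriv h z * deriv k (h z) = 1"
      "\<And>z. z \<in> ball 0 1 \<Longrightarrow> k (h z) = z"
    by (rule holomorphic_has_inverse[OF hh(1) open_ball hh(2)]) blast
  have h1: "cmod (h w) < 1" if "cmod w < 1" for w using imageI[of w "ball 0 1" h] that unfolding hh(3) by simp
  have k1: "cmod (k w) < 1" if w: "cmod w < 1" for w
  proof -
    have "w \<in> h ` ball 0 1" unfolding hh(3) using w by simp
    then obtain u where "u \<in> ball 0 1" "w = h u" by blast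
    then show ?thesis using k(3)[of u] by simp
  qed
  have "rho_disk (h x) (h y) \<le> rho_disk x y" by (rule rho_disk_contract[OF hh(1) h1 xy])
  moreover have "rho_disk (k (h x)) (k (h y)) \<le> rho_disk (h x) (h y)"
    by (rule rho_disk_contract[OF k(1)[unfolded hh(3)] k1 h1[OF xy(1)] h1[OF xy(2)]])
  ultimately show ?thesis using k(3) xy by (simp add: rho_dom_def h_def[symmetric] Let_def)
qed

section \<open>Comparison of \<open>W_lam\<close> with the hyperbolic metric\<close>

lemma W_lam_lower:
  assumes "lam \<ge> 1" "rho_disk x y \<ge> 0" shows "rho_disk x y / 2 \<le> W_lam lam x y"
proof -
  define t where "t = rho_disk x y / 2"
  have t: "t \<ge> 0" using assms by (simp add: t_def)
  have s: "sinh t \<ge> 0" using t by simp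
  have "2 * sinh t = exp t - exp (- t)" by (simp add: sinh_def)
  moreover have "exp (- t) \<le> 1" using t by simp
  ultimately have "exp t \<le> 1 + 2 * sinh t" by linarith
  also have "\<dots> \<le> 1 + 2 * lam * sinh t" using mult_right_mono[OF assms(1) s] by simp
  finally have "ln (exp t) \<le> ln (1 + 2 * lam * sinh t)" by (intro ln_mono) auto
  then show ?thesis by (simp add: W_lam_def t_def)
qed

text \<open>Bernoulli's inequality \<open>1 + lam * u \<le> (1 + u) powr lam\<close> in logarithmic
  form, obtained from two uses of \<open>ln t \<le> t - 1\<close>.\<close>

lemma ln_one_plus_mult_le:
  fixes lam u :: real
  assumes "lam \<ge> 1" "u \<ge> 0" shows "ln (1 + lam * u) \<le> lam * ln (1 + u)"
proof -
  have lu: "lam * u \<ge> 0" using assms by simp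
  have p: "1 + lam * u > 0" "1 + u > 0" using assms(2) lu by linarith+
  have "ln (1 + lam * u) - ln (1 + u) = ln ((1 + lam * u) / (1 + u))" using p by (subst ln_div) auto
  also have "\<dots> \<le> (1 + lam * u) / (1 + u) - 1" using p by (intro ln_le_minus_one divide_pos_pos)
  also have "\<dots> = (lam - 1) * (u / (1 + u))" using assms by (simp add: field_simps)
  also have "\<dots> \<le> (lam - 1) * ln (1 + u)"
  proof (rule mult_left_mono)
    have "ln (1 / (1 + u)) \<le> 1 / (1 + u) - 1" using assms by (intro ln_le_minus_one) auto
    moreover have "1 / (1 + u) - 1 = - (u / (1 + u))" using assms by (simp add: field_simps)
    moreover have "ln (1 / (1 + u)) = - ln (1 + u)" using assms by (simp add: ln_div)
    ultimately show "u / (1 + u) \<le> ln (1 + u)" by simp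
  qed (use assms in simp)
  finally show ?thesis by (simp add: algebra_simps)
qed

text \<open>With \<open>E\<close> the exponential of half the distance, the case
  \<open>lam = 1\<close> is \<open>1 + E - 1 / E \<le> E * E\<close>, which amounts to
  \<open>(E - 1) * (E - 1) * (E + 1) \<ge> 0\<close>; Bernoulli's inequality then extracts the
  factor \<open>lam\<close>.\<close>

lemma W_lam_upper:
  assumes "lam \<ge> 1" "rho_disk x y \<ge> 0" shows "W_lam lam x y \<le> lam * rho_disk x y"
proof -
  define t where "t = rho_disk x y / 2"
  have t: "t \<ge> 0" using assms by (simp add: t_def)
  have s: "sinh t \<ge> 0" using t by simp
  define E where "E = exp t"
  have E: "E \<ge> 1" using t by (simp add: E_def)
  have "2 * sinh t = exp t - exp (- t)" by (simp add: sinh_def)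
  then have "1 + 2 * sinh t = 1 + E - 1 / E" unfolding E_def exp_minus inverse_eq_divide by linarith
  also have "\<dots> \<le> E * E"
  proof -
    have "0 \<le> (E - 1) * (E - 1) * (E + 1)" using E by simp
    then have "E + E * E - 1 \<le> E * E * E" by (simp add: algebra_simps)
    then show ?thesis using E by (simp add: field_simps)
  qed
  also have "\<dots> = exp (2 * t)" by (simp add: E_def exp_add[symmetric])
  finally have "ln (1 + 2 * sinh t) \<le> ln (exp (2 * t))"
    by (intro ln_mono add_pos_nonneg mult_nonneg_nonneg s) auto
  then have "ln (1 + 2 * sinh t) \<le> rho_disk x y" by (simp add: t_def)
  then have "lam * ln (1 + 2 * sinh t) \<le> lam * rho_disk x y" using assms by (intro mult_left_mono) auto
  moreover have "W_lam lam x y \<le> lam * ln (1 + 2 * sinh t)"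
    using ln_one_plus_mult_le[OF assms(1), of "2 * sinh t"] s by (simp add: W_lam_def t_def mult_ac)
  ultimately show ?thesis by linarith
qed

section \<open>Schwarz inequality for quasiregular self-maps of the disk with arbitrary
  image\<close>

lemma quasiregular_factors:
  assumes f: "quasiregular K (ball 0 1) f" and m: "M holomorphic_on ball 0 1" "M ` ball 0 1 \<subseteq> ball 0 1"
      "\<And>w. w \<in> ball 0 1 \<Longrightarrow> deriv M w \<noteq> 0"
    and fg: "\<And>z. z \<in> ball 0 1 \<Longrightarrow> f z = M (g0 z)"
    and g: "continuous_on (ball 0 1) g" "g ` ball 0 1 \<subseteq> ball 0 1" "factors g0 g"
  obtains \<Phi> where "\<Phi> holomorphic_on ball 0 1" "\<Phi> ` ball 0 1 \<subseteq> ball 0 1" "\<And>z. z \<in> ball 0 1 \<Longrightarrow> f z = \<Phi> (g z)"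
    "quasiregular K (ball 0 1) g"
proof -
  obtain P where P: "self_map P" "\<And>z. z \<in> ball 0 1 \<Longrightarrow> g0 z = P (g z) \<and> deriv P (g z) \<noteq> 0"
    using g(3) by (auto simp: factors_def)
  have Pb: "P ` ball 0 1 \<subseteq> ball 0 1" using P(1) by (simp add: self_map_def)
  have h: "M \<circ> P holomorphic_on ball 0 1"
    by (rule holomorphic_on_compose_gen[OF self_mapD(1)[OF P(1)] m(1) Pb])
  have eq: "f z = (M \<circ> P) (g z)" if "z \<in> ball 0 1" for z using fg[OF that] P(2)[OF that] by simp
  have "quasiregular K (ball 0 1) g"
  proof (rule quasiregular_lift[OF f g(1) open_ball g(2) h _ eq])
    fix z :: complex assume z: "z \<in> ball 0 1"
    have gz: "g z \<in> ball 0 1" by (rule subsetD[OF g(2) imageI[OF z]])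
    have pz: "P (g z) \<in> ball 0 1" by (rule subsetD[OF Pb imageI[OF gz]])
    have "deriv (M \<circ> P) (g z) = deriv M (P (g z)) * deriv P (g z)"
      by (rule deriv_chain; rule holomorphic_on_imp_differentiable_at[of _ "ball 0 1"])
         (use self_mapD(1)[OF P(1)] m(1) gz pz in auto)
    then show "deriv (M \<circ> P) (g z) \<noteq> 0" using m(3)[OF pz] P(2)[OF z] by simp
  qed
  moreover have "(M \<circ> P) ` ball 0 1 \<subseteq> ball 0 1" using m(2) Pb by fastforce
  ultimately show ?thesis using that[of "M \<circ> P"] h eq by blast
qed

text \<open>A Moebius map first moves \<open>f x\<close> to \<open>0\<close>, the normalisation on
  which \<open>factors_onto\<close> rests; \<open>f x \<noteq> f y\<close> makes the maximised
  quantity positive. The lift \<open>g\<close> has the whole disk as image, so both hyperbolic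
  metrics in the Schwarz hypothesis are that of the disk.\<close>

lemma quasiregular_Schwarz:
  assumes K: "K \<ge> 1" and f: "quasiregular K (ball 0 1) f" "f ` ball 0 1 \<subseteq> ball 0 1"
    and c: "qr_schwarz_const K c" and x: "x \<in> ball 0 1" and y: "y \<in> ball 0 1" and ne: "f x \<noteq> f y"
  shows "rho_disk (f x) (f y) \<le> c * max (rho_disk x y) (rho_disk x y powr (1 / K))"
proof -
  have f1: "cmod (f z) < 1" if "z \<in> ball 0 1" for z using subsetD[OF f(2) imageI[OF that]] by simp
  let ?M = "Moebius_function 0 (- f x)"
  define g0 where "g0 z = Moebius_function 0 (f x) (f z)" for z
  have fx: "cmod (f x) < 1" "cmod (- f x) < 1" using f1[OF x] by auto
  have cf: "continuous_on (ball 0 1) f" using f(1) by (auto simp: quasiregular_def sobolev_12_loc_def)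
  have g0c: "continuous_on (ball 0 1) g0"
    unfolding g0_def by (rule continuous_on_compose2[OF holomorphic_on_imp_continuous_on[OF Moebius_function_holomorphic[OF fx(1)]] cf f(2)])
  have g0i: "g0 ` ball 0 1 \<subseteq> ball 0 1"
    unfolding g0_def using Moebius_function_norm_lt_1[OF fx(1) f1] by auto
  have g0x: "g0 x = 0" by (simp add: g0_def Moebius_function_eq_zero)
  have g0y: "g0 y \<noteq> 0"
    using Moebius_norm_identity(1)[OF fx(1) f1[OF y]] ne by (simp add: g0_def Moebius_function_simple)
  have Mh: "?M holomorphic_on ball 0 1" by (rule Moebius_function_holomorphic[OF fx(2)])
  have Mi: "?M ` ball 0 1 \<subseteq> ball 0 1" using Moebius_function_norm_lt_1[OF fx(2)] by auto
  have Md: "deriv ?M w \<noteq> 0" if "w \<in> ball 0 1" for w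
    using DERIV_imp_deriv[OF Moebius_deriv(1)[OF fx(2), of w]] Moebius_deriv(2)[OF fx(2), of w] that by simp
  have fg: "f z = ?M (g0 z)" if "z \<in> ball 0 1" for z
    unfolding g0_def using Moebius_function_compose[of "- f x" "f x" "f z"] fx f1[OF that] by simp
  have qf: "quasiregular K (ball 0 1) g" "\<exists>\<Phi>. \<Phi> holomorphic_on ball 0 1 \<and> \<Phi> ` ball 0 1 \<subseteq> ball 0 1 \<and> (\<forall>z\<in>ball 0 1. f z = \<Phi> (g z))"
    if g: "continuous_on (ball 0 1) g" "g ` ball 0 1 \<subseteq> ball 0 1" "factors g0 g" for g
  proof -
    obtain \<Phi> where "\<Phi> holomorphic_on ball 0 1" "\<Phi> ` ball 0 1 \<subseteq> ball 0 1" "\<And>z. z \<in> ball 0 1 \<Longrightarrow> f z = \<Phi> (g z)"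
      "quasiregular K (ball 0 1) g"
      by (rule quasiregular_factors[OF f(1) Mh Mi Md fg g]; blast)
    then show "quasiregular K (ball 0 1) g" "\<exists>\<Phi>. \<Phi> holomorphic_on ball 0 1 \<and> \<Phi> ` ball 0 1 \<subseteq> ball 0 1 \<and> (\<forall>z\<in>ball 0 1. f z = \<Phi> (g z))"
      by blast+
  qed
  have bd: "\<exists>\<tau><1. \<forall>g. continuous_on (ball 0 1) g \<longrightarrow> g ` ball 0 1 \<subseteq> ball 0 1 \<longrightarrow> g x = 0 \<longrightarrow>
      factors g0 g \<longrightarrow> (\<forall>z\<in>cball 0 \<rho>. cmod (g z) \<le> \<tau>)" if "\<rho> < 1" for \<rho>
  proof -
    have "max \<rho> (cmod x) < 1" using that x by simp
    then obtain \<tau> where t: "\<tau> < 1" "\<And>(g :: complex \<Rightarrow> complex) u z. quasiregular K (ball 0 1) g \<Longrightarrow> g ` ball 0 1 \<subseteq> ball 0 1 \<Longrightarrow>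
      u \<in> cball 0 (max \<rho> (cmod x)) \<Longrightarrow> g u = 0 \<Longrightarrow> z \<in> cball 0 (max \<rho> (cmod x)) \<Longrightarrow> cmod (g z) \<le> \<tau>"
      by (rule quasiregular_disk_bound[OF K]) blast
    show ?thesis
    proof (intro exI[of _ \<tau>] conjI t(1) allI impI ballI)
      fix g :: "complex \<Rightarrow> complex" and z :: complex
      assume g: "continuous_on (ball 0 1) g" "g ` ball 0 1 \<subseteq> ball 0 1" "g x = 0" "factors g0 g" and z: "z \<in> cball 0 \<rho>"
      have "quasiregular K (ball 0 1) g" by (rule qf(1)[OF g(1,2,4)])
      then show "cmod (g z) \<le> \<tau>" using z by (intro t(2)[of g x z] g) auto
    qed
  qed
  obtain g where g: "continuous_on (ball 0 1) g" "g ` ball 0 1 = ball 0 1" "factors g0 g"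
    using factors_onto[OF x y g0c g0i g0x g0y bd] by blast
  have gi: "g ` ball 0 1 \<subseteq> ball 0 1" using g(2) by simp
  obtain \<Phi> where \<Phi>: "\<Phi> holomorphic_on ball 0 1" "\<Phi> ` ball 0 1 \<subseteq> ball 0 1" "\<And>z. z \<in> ball 0 1 \<Longrightarrow> f z = \<Phi> (g z)"
    using qf(2)[OF g(1) gi g(3)] by blast
  have gq: "quasiregular K (ball 0 1) g" by (rule qf(1)[OF g(1) gi g(3)])
  have g1: "cmod (g z) < 1" if "z \<in> ball 0 1" for z using subsetD[OF gi imageI[OF that]] by simp
  have bU: "ball (0::complex) 1 \<noteq> UNIV" by (metis UNIV_I dist_0_norm less_irrefl mem_ball norm_one)
  have "rho_dom (g ` ball 0 1) (g x) (g y) \<le> c * max (rho_dom (ball 0 1) x y) (rho_dom (ball 0 1) x y powr (1 / K))"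
    using c[unfolded qr_schwarz_const_def, rule_format, of "ball 0 1" g x y] x y gq bU
    by (simp add: g(2) convex_imp_simply_connected)
  then have "rho_disk (g x) (g y) \<le> c * max (rho_disk x y) (rho_disk x y powr (1 / K))"
    using x y g1[OF x] g1[OF y] by (simp add: g(2) rho_dom_ball)
  moreover have "rho_disk (\<Phi> (g x)) (\<Phi> (g y)) \<le> rho_disk (g x) (g y)"
    by (rule rho_disk_contract[OF \<Phi>(1) _ g1[OF x] g1[OF y]]) (use \<Phi>(2) in \<open>auto simp: image_subset_iff\<close>)
  ultimately show ?thesis using \<Phi>(3)[OF x] \<Phi>(3)[OF y] by simp
qed

theorem theorem1p3:
  fixes K lam c :: real and f :: "complex \<Rightarrow> complex" and x y :: complex
  assumes "K \<ge> 1"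
    and "quasiregular K (ball 0 1) f"
    and "f ` ball 0 1 \<subseteq> ball 0 1"
    and "\<not> (\<exists>a. \<forall>z\<in>ball 0 1. f z = a)"
    and "lam \<ge> 1"
    and "qr_schwarz_const K c"
    and "K \<le> c"
    and "c \<le> ln (2 * (1 + sqrt (1 - 1 / (exp 1)\<^sup>2))) * (K - 1) + K"
    and "x \<in> ball 0 1" and "y \<in> ball 0 1"
  shows "W_lam lam (f x) (f y) \<le> 2 * lam * c * max (W_lam lam x y powr (1 / K)) (W_lam lam x y)"
proof -
  have c: "c \<ge> 1" using assms(1,7) by simp
  have xy: "cmod x < 1" "cmod y < 1" using assms(9,10) by auto
  let ?r = "rho_disk x y" and ?w = "W_lam lam x y"
  have r0: "?r \<ge> 0" by (rule rho_disk_nonneg[OF xy])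
  have rw: "?r / 2 \<le> ?w" by (rule W_lam_lower[OF assms(5) r0])
  then have w0: "?w \<ge> 0" using r0 by linarith
  have m0: "max (?w powr (1 / K)) ?w \<ge> 0" using w0 by simp
  show ?thesis
  proof (cases "f x = f y")
    case True
    then have "W_lam lam (f x) (f y) = 0" by (simp add: W_lam_def rho_disk_def)
    then show ?thesis using c assms(5) m0 by simp
  next
    case False
    have f1: "cmod (f x) < 1" "cmod (f y) < 1"
      using subsetD[OF assms(3) imageI[OF assms(9)]] subsetD[OF assms(3) imageI[OF assms(10)]] by auto
    \<comment> \<open>This gives the \<open>2\<close> of the final constant, from
      \<open>?r \<le> 2 * ?w\<close> and \<open>2 powr (1 / K) \<le> 2\<close>; the factor
      \<open>lam\<close> comes from \<open>W_lam_upper\<close>.\<close>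
    have "max ?r (?r powr (1 / K)) \<le> 2 * max (?w powr (1 / K)) ?w"
    proof -
      have "?r powr (1 / K) \<le> (2 * ?w) powr (1 / K)" using rw r0 assms(1) by (intro powr_mono2) auto
      also have "\<dots> = 2 powr (1 / K) * ?w powr (1 / K)" using w0 by (simp add: powr_mult)
      also have "\<dots> \<le> 2 * ?w powr (1 / K)"
      proof (rule mult_right_mono)
        have "2 powr (1 / K) \<le> 2 powr (1::real)" using assms(1) by (intro powr_mono) auto
        then show "2 powr (1 / K) \<le> (2::real)" by simp
      qed simp
      finally show ?thesis using rw by (simp add: max_def)
    qed
    then have "c * max ?r (?r powr (1 / K)) \<le> c * (2 * max (?w powr (1 / K)) ?w)" using c by (intro mult_left_mono) auto
    then have "rho_disk (f x) (f y) \<le> c * (2 * max (?w powr (1 / K)) ?w)"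
      using quasiregular_Schwarz[OF assms(1-3,6,9,10) False] by linarith
    then have "lam * rho_disk (f x) (f y) \<le> lam * (c * (2 * max (?w powr (1 / K)) ?w))" using assms(5) by (intro mult_left_mono) auto
    then show ?thesis using W_lam_upper[OF assms(5) rho_disk_nonneg[OF f1]] by (simp add: mult_ac)
  qed
qed

end
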